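(* There is an absolute constant $K>0$ such that the following holds for every real $x\ge e$. Let $\varepsilon\in[(\log x)^{-1/2},1]$ and $c(\varepsilon)=\exp\left(-(\log \varepsilon^{-1})^{1/10}\right)$. Then for all but at most $K\,c(\varepsilon)\,x$ positive integers $m\leq x$, every set $A\subset\mathbb{Z}_m$ with $(A-A)\cap R_m=\{0\}$ satisfies $$|A|\leq m^{1/2-\varepsilon/5}.$$
   Context: $\mathbb{Z}_m$ is the ring of integers modulo $m$; $R_m=\{a^2 : a\in\mathbb{Z}_m\}$ is the set of all squares in $\mathbb{Z}_m$ (including $0$ and squares that are not units); $A-A=\{a-b : a,b\in A\}$. $\log$ is the natural logarithm. *)

theory Defs
  imports Complex_Main "HOL-Number_Theory.Residues"
begin

text \<open>
  The ring of integers modulo \<open>m\<close> is the library's \<^const>\<open>residue_ring\<close>, with carrier \<open>{0..m - 1}\<close>.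
  The \<open>residues\<close> locale assumes \<open>m > 1\<close>, and for \<open>m = 1\<close> the record field \<open>one\<close> lies outside the
  carrier; the notions below use only \<open>carrier\<close>, \<open>\<zero>\<close>, \<open>\<otimes>\<close> and \<open>\<ominus>\<close>, which are those of the zero
  ring in that case.
\<close>

definition squares :: "('a, 'b) ring_scheme \<Rightarrow> 'a set" where
  "squares R = {a \<otimes>\<^bsub>R\<^esub> a | a. a \<in> carrier R}"

definition difference_set :: "('a, 'b) ring_scheme \<Rightarrow> 'a set \<Rightarrow> 'a set" where
  "difference_set R A = {a \<ominus>\<^bsub>R\<^esub> b | a b. a \<in> A \<and> b \<in> A}"

text \<open>At \<open>\<epsilon> = 1\<close> the base of the power is \<open>0\<close>, and \<open>0 powr (1/10) = 0\<close> gives the intended value \<open>1\<close>.\<close>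

definition c_eps :: "real \<Rightarrow> real" where
  "c_eps \<epsilon> = exp (- (ln (inverse \<epsilon>) powr (1/10)))"

end

theory Submission
  imports Defs
    "HOL-Analysis.Infinite_Products"
    "HOL-Number_Theory.Number_Theory"
    "HOL-Computational_Algebra.Squarefree"
    "HOL-Real_Asymp.Real_Asymp"
begin

text \<open>
  Let \<open>A\<close> be a set of residues modulo \<open>m\<close> whose differences are squares only when they vanish, and
  let \<open>M\<close> be a product of odd primes each dividing \<open>m\<close> exactly once, \<open>m = r M\<close>. Splitting \<open>A\<close> into
  classes modulo \<open>r\<close> costs a factor \<open>r\<close>, and inside one class any two distinct elements differ by a
  non-residue modulo some \<open>p\<close> dividing \<open>M\<close>. Such a class is bounded by linear programming: if \<open>F\<close> is
  supported on the squares modulo \<open>M\<close> and its Fourier transform \<open>H\<close> has nonnegative real part, then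
  the sum of \<open>F (a - b)\<close> over all pairs has only its diagonal terms and is at least
  \<open>H 0 * (card A)\<^sup>2 / M\<close>, so \<open>card A \<le> M * F 0 / H 0\<close>.

  The function \<open>F\<close> is assembled from \<open>\<delta>\<close>, the indicator of \<open>0\<close> modulo \<open>p\<close>, and from the number \<open>\<rho>\<close> of
  square roots modulo \<open>p\<close>. The transform of \<open>\<rho>\<close> is the quadratic Gauss sum: it is \<open>p\<close> at the frequency
  \<open>0\<close>, and elsewhere it has absolute value \<open>sqrt p\<close> and is real for \<open>p\<close> congruent to \<open>1\<close> and purely
  imaginary for \<open>p\<close> congruent to \<open>3\<close> modulo \<open>4\<close>. A prime of the first kind contributes the factor
  \<open>sqrt p \<delta> + \<rho>\<close>, which yields exactly \<open>sqrt p\<close>. For the \<open>k\<close> primes of the second kind the product of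
  the factors \<open>2 k sqrt p \<delta> + \<rho>\<close> is admissible, because \<open>k\<close> small rotations stay in the right half
  plane; it yields \<open>sqrt M\<close> up to a factor \<open>(C k)^k\<close>. The saving comes from the observation that the
  part of this product that is odd under \<open>\<rho> \<mapsto> - \<rho>\<close> is still admissible. Every term of this odd part
  contains at least one \<open>\<rho>\<close>, which makes \<open>F 0\<close> smaller by the square root of the least prime involved,
  whereas \<open>H 0\<close> still contains the full product of the primes as soon as \<open>k\<close> is odd. Hence an odd number
  of primes congruent to \<open>3\<close>, all of them at least \<open>Q\<close>, saves \<open>sqrt Q\<close>:
  \<open>card_square_difference_free_le\<close>.

  To profit from this one wants \<open>z < z'\<close> such that \<open>m\<close> has no prime divisor congruent to \<open>3\<close> in
  \<open>(z, z']\<close>, an odd number of them above \<open>z'\<close>, and a \<open>z\<close>-smooth part of size at most \<open>sqrt z'\<close>. Then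
  \<open>r\<close> is not much larger than \<open>sqrt z'\<close>, which costs \<open>z'^(1/4)\<close> against the saving \<open>sqrt z'\<close>:
  \<open>card_square_difference_free_gap_le\<close>.

  Put \<open>L = ln (1/\<epsilon>)\<close> and \<open>T = L^(1/8)\<close>, and cut the range between \<open>x^(sqrt \<epsilon>)\<close> and \<open>x^(1/(2T))\<close> at points
  each of which is the \<open>T\<close>-th power of the next. Group the pieces into windows of three consecutive ones
  and call a window good if the middle piece contains exactly one prime divisor of \<open>m\<close> congruent to \<open>3\<close>
  and the outer pieces contain none. One of the two empty pieces then serves as the gap: passing the
  middle prime flips the parity of the number of such primes above. By Mertens' estimates a window is
  good with probability at least \<open>c T^(-3)\<close>; the windows are nearly independent, which is quantified by
  weighting each \<open>m\<close> with the logarithms of its prime factors outside the windows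
  (\<open>sum_count_ln_le\<close>, \<open>sum_sieve_weight_avoiding_le\<close>). With about \<open>L / ln L\<close> windows the proportion of
  \<open>m\<close> without a good one is at most \<open>exp (- c T^(-3) L / ln L)\<close>. By Rankin's trick a smooth part is
  too large for a proportion at most \<open>C exp (- T / 2)\<close> of the \<open>m\<close> at each of the \<open>O(L)\<close> cut points. Both
  are of smaller order than \<open>exp (- L^(1/10))\<close>, and any exponent strictly between \<open>1/10\<close> and \<open>3/10\<close> in place
  of \<open>1/8\<close> would give this. Discarding the \<open>m\<close> whose square part exceeds \<open>exp (L^(1/10))\<close> costs a proportion
  of at most \<open>2 exp (- L^(1/10))\<close>.
\<close>

section \<open>Quadratic Gauss sums\<close>

definition additive_char :: "nat \<Rightarrow> int \<Rightarrow> complex" where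
  "additive_char p n = cis (2 * pi * real_of_int n / real p)"

lemma additive_char_add: "additive_char p (m + n) = additive_char p m * additive_char p n"
  by (simp add: additive_char_def cis_mult add_divide_distrib distrib_left)

lemma additive_char_0 [simp]: "additive_char p 0 = 1"
  by (simp add: additive_char_def)

lemma cnj_additive_char: "cnj (additive_char p n) = additive_char p (- n)"
  by (simp add: additive_char_def cis_cnj)

lemma additive_char_eq_1_iff:
  assumes "p > 0"
  shows "additive_char p n = 1 \<longleftrightarrow> int p dvd n"
proof
  assume "additive_char p n = 1"
  then have "cos (2 * pi * real_of_int n / real p) = 1"
    unfolding additive_char_def by (metis cis.sel(1) one_complex.sel(1))
  then obtain k :: int where "2 * pi * real_of_int n / real p = real_of_int k * 2 * pi"
    using cos_one_2pi_int by auto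
  then have "real_of_int n = real_of_int (k * int p)"
    using assms by (simp add: field_simps)
  then have "n = k * int p"
    by linarith
  then show "int p dvd n" by simp
next
  assume "int p dvd n"
  then obtain k where "n = int p * k" by blast
  then have "2 * pi * real_of_int n / real p = 2 * pi * real_of_int k"
    using assms by simp
  then have "additive_char p n = cis (2 * pi * real_of_int k)"
    by (simp only: additive_char_def)
  also have "\<dots> = 1"
    by (rule cis_multiple_2pi) simp
  finally show "additive_char p n = 1" .
qed

lemma additive_char_cong:
  assumes "p > 0" "[m = n] (mod int p)"
  shows "additive_char p m = additive_char p n"
proof -
  have "additive_char p (m - n) = 1"
    using assms additive_char_eq_1_iff[of p "m - n"] by (simp add: cong_iff_dvd_diff)
  then show ?thesis
    using additive_char_add[of p "m - n" n] by simp
qed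

lemma additive_char_power: "additive_char p (int k * t) = additive_char p t ^ k"
  by (induction k) (simp_all add: distrib_right additive_char_add)

lemma sum_int_nat: "(\<Sum>\<xi>\<in>{0..<int p}. f \<xi>) = (\<Sum>k<p. f (int k))"
  by (rule sum.reindex_bij_witness[of _ int nat]) auto

lemma sum_additive_char:
  assumes "p > 0"
  shows "(\<Sum>\<xi>\<in>{0..<int p}. additive_char p (\<xi> * t)) = (if int p dvd t then of_nat p else 0)"
proof (cases "int p dvd t")
  case True
  have "additive_char p (\<xi> * t) = 1" for \<xi>
    using True assms by (simp add: additive_char_eq_1_iff)
  then show ?thesis using True by simp
next
  case False
  have ne: "additive_char p t \<noteq> 1"
    using False assms by (simp add: additive_char_eq_1_iff)
  have one: "additive_char p t ^ p = 1"
    using assms by (simp flip: additive_char_power add: additive_char_eq_1_iff)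
  have "(\<Sum>\<xi>\<in>{0..<int p}. additive_char p (\<xi> * t)) = (\<Sum>k<p. additive_char p t ^ k)"
    by (simp add: sum_int_nat additive_char_power)
  also have "\<dots> = 0"
    using ne one by (simp add: geometric_sum)
  finally show ?thesis using False by simp
qed

lemma sum_residues_reindex:
  fixes f :: "int \<Rightarrow> complex"
  assumes "p > 0"
    and per: "\<And>a b. [a = b] (mod int p) \<Longrightarrow> f a = f b"
    and inj: "\<And>a b. [g a = g b] (mod int p) \<Longrightarrow> [a = b] (mod int p)"
  shows "(\<Sum>u\<in>{0..<int p}. f (g u)) = (\<Sum>u\<in>{0..<int p}. f u)"
proof -
  let ?R = "{0..<int p}" and ?h = "\<lambda>u. g u mod int p"
  have "inj_on ?h ?R"
  proof (rule inj_onI)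
    fix a b assume ab: "a \<in> ?R" "b \<in> ?R" "?h a = ?h b"
    have "[a = b] (mod int p)" by (rule inj) (use ab in \<open>simp add: unique_euclidean_semiring_class.cong_def\<close>)
    then have "a mod int p = b mod int p" by (simp only: unique_euclidean_semiring_class.cong_def)
    then show "a = b" using ab(1,2) by simp
  qed
  moreover have "?h ` ?R \<subseteq> ?R" using assms by auto
  ultimately have im: "?h ` ?R = ?R"
    by (simp add: endo_inj_surj)
  have "(\<Sum>u\<in>?R. f u) = (\<Sum>u\<in>?h ` ?R. f u)" by (simp add: im)
  also have "\<dots> = (\<Sum>u\<in>?R. f (?h u))"
    using \<open>inj_on ?h ?R\<close> by (simp add: sum.reindex)
  also have "\<dots> = (\<Sum>u\<in>?R. f (g u))"
    by (intro sum.cong per) (auto simp: unique_euclidean_semiring_class.cong_def)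
  finally show ?thesis by simp
qed

definition square_roots :: "nat \<Rightarrow> int \<Rightarrow> int set" where
  "square_roots p t = {u \<in> {0..<int p}. [u\<^sup>2 = t] (mod int p)}"

text \<open>
  This is the discrete Fourier transform of \<open>t \<mapsto> card (square_roots p t)\<close>; summing over \<open>u\<close> rather
  than over \<open>t\<close> with the Legendre symbol includes the square \<open>0\<close> and gives the value \<open>p\<close> at \<open>\<xi> = 0\<close>.
\<close>

definition gauss_sum :: "nat \<Rightarrow> int \<Rightarrow> complex" where
  "gauss_sum p \<xi> = (\<Sum>u\<in>{0..<int p}. additive_char p (- \<xi> * u\<^sup>2))"

lemma card_square_roots_fourier:
  assumes "p > 0"
  shows "complex_of_nat (card (square_roots p t)) =
    (\<Sum>\<xi>\<in>{0..<int p}. gauss_sum p \<xi> / of_nat p * additive_char p (\<xi> * t))"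
proof -
  have "(\<Sum>\<xi>\<in>{0..<int p}. gauss_sum p \<xi> / of_nat p * additive_char p (\<xi> * t)) =
    (\<Sum>\<xi>\<in>{0..<int p}. \<Sum>u\<in>{0..<int p}. additive_char p (\<xi> * (t - u\<^sup>2)) / of_nat p)"
    by (simp add: gauss_sum_def sum_distrib_right sum_divide_distrib
        flip: additive_char_add) (simp add: algebra_simps)
  also have "\<dots> = (\<Sum>u\<in>{0..<int p}. (\<Sum>\<xi>\<in>{0..<int p}. additive_char p (\<xi> * (t - u\<^sup>2))) / of_nat p)"
    by (subst sum.swap) (simp add: sum_divide_distrib)
  also have "\<dots> = (\<Sum>u\<in>{0..<int p}. if [u\<^sup>2 = t] (mod int p) then 1 else 0)"
    using assms by (intro sum.cong) (auto simp: sum_additive_char cong_iff_dvd_diff dvd_diff_commute)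
  also have "\<dots> = of_nat (card (square_roots p t))"
    by (simp add: square_roots_def sum.If_cases Int_def)
  finally show ?thesis by simp
qed

lemma gauss_sum_0: "gauss_sum p 0 = of_nat p"
  by (simp add: gauss_sum_def)

text \<open>
  The substitution \<open>u = v + w\<close> makes the phase linear in \<open>v\<close>, with coefficient \<open>-2 \<xi> w\<close>. Orthogonality
  then leaves only \<open>w = 0\<close>; here \<open>p\<close> has to be odd.
\<close>

lemma gauss_sum_norm_square:
  assumes p: "prime p" "odd p" and \<xi>: "\<not> int p dvd \<xi>"
  shows "gauss_sum p \<xi> * cnj (gauss_sum p \<xi>) = of_nat p"
proof -
  let ?R = "{0..<int p}"
  have p0: "p > 0" using p prime_gt_0_nat by blast
  have "gauss_sum p \<xi> * cnj (gauss_sum p \<xi>) =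
      (\<Sum>v\<in>?R. \<Sum>u\<in>?R. additive_char p (\<xi> * (v\<^sup>2 - u\<^sup>2)))"
    unfolding gauss_sum_def cnj_sum sum_product
    by (subst sum.swap) (simp add: cnj_additive_char algebra_simps flip: additive_char_add)
  also have "\<dots> = (\<Sum>v\<in>?R. \<Sum>w\<in>?R. additive_char p (\<xi> * (v\<^sup>2 - (v + w)\<^sup>2)))"
  proof (rule sum.cong[OF refl], rule sym)
    fix v :: int
    show "(\<Sum>w\<in>?R. additive_char p (\<xi> * (v\<^sup>2 - (v + w)\<^sup>2))) =
        (\<Sum>u\<in>?R. additive_char p (\<xi> * (v\<^sup>2 - u\<^sup>2)))"
      by (rule sum_residues_reindex[OF p0, where g = "\<lambda>w. v + w"])
         (auto intro!: additive_char_cong[OF p0] cong_mult cong_diff cong_pow simp: cong_add_lcancel)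
  qed
  also have "\<dots> = (\<Sum>w\<in>?R. \<Sum>v\<in>?R. additive_char p (- \<xi> * w\<^sup>2) * additive_char p (v * (- 2 * \<xi> * w)))"
    by (subst sum.swap) (simp flip: additive_char_add add: algebra_simps power2_eq_square)
  also have "\<dots> = (\<Sum>w\<in>?R. additive_char p (- \<xi> * w\<^sup>2) * (if w = 0 then of_nat p else 0))"
  proof (rule sum.cong[OF refl])
    fix w assume w: "w \<in> ?R"
    have "int p dvd - 2 * \<xi> * w \<longleftrightarrow> w = 0"
    proof
      assume "int p dvd - 2 * \<xi> * w"
      then have "int p dvd 2 * (\<xi> * w)" by (simp add: mult.assoc)
      moreover have "\<not> int p dvd 2"
        using p by (metis dvd_refl int_dvd_int_iff of_nat_numeral primes_dvd_imp_eq two_is_prime_nat)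
      ultimately have "int p dvd w"
        using p \<xi> by (simp add: prime_dvd_mult_iff)
      then show "w = 0" using w zdvd_not_zless[of w "int p"] by fastforce
    qed simp
    then show "(\<Sum>v\<in>?R. additive_char p (- \<xi> * w\<^sup>2) * additive_char p (v * (- 2 * \<xi> * w))) =
        additive_char p (- \<xi> * w\<^sup>2) * (if w = 0 then of_nat p else 0)"
      by (simp only: sum_distrib_left[symmetric] sum_additive_char[OF p0])
  qed
  also have "\<dots> = (\<Sum>w\<in>?R. if w = 0 then of_nat p else 0)"
    by (intro sum.cong) auto
  also have "\<dots> = of_nat p" using p0 by simp
  finally show ?thesis .
qed

lemma norm_gauss_sum:
  assumes "prime p" "odd p" "\<not> int p dvd \<xi>"
  shows "norm (gauss_sum p \<xi>) = sqrt (real p)"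
proof -
  have "complex_of_real ((norm (gauss_sum p \<xi>))\<^sup>2) = gauss_sum p \<xi> * cnj (gauss_sum p \<xi>)"
    by (rule complex_norm_square)
  also have "\<dots> = complex_of_real (real p)"
    using gauss_sum_norm_square[OF assms] by simp
  finally have "complex_of_real ((norm (gauss_sum p \<xi>))\<^sup>2) = complex_of_real (real p)" .
  then have "(norm (gauss_sum p \<xi>))\<^sup>2 = real p"
    using of_real_eq_iff by blast
  then show ?thesis
    by (simp add: real_sqrt_unique)
qed

lemma cnj_gauss_sum: "cnj (gauss_sum p \<xi>) = (\<Sum>u\<in>{0..<int p}. additive_char p (\<xi> * u\<^sup>2))"
  by (simp add: gauss_sum_def cnj_additive_char)

text \<open>
  If \<open>i\<^sup>2 = -1\<close> modulo \<open>p\<close>, then replacing \<open>u\<close> by \<open>i u\<close> permutes the residues and conjugates every term of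
  the Gauss sum, which is therefore real.
\<close>

lemma Im_gauss_sum_eq_0:
  assumes p: "prime p" "p mod 4 = 1"
  shows "Im (gauss_sum p \<xi>) = 0"
proof -
  have p0: "p > 0" using p prime_gt_0_nat by blast
  have p2: "2 < p" using p prime_ge_2_nat[of p] by (cases "p = 2") auto
  obtain i :: int where i: "[i\<^sup>2 = - 1] (mod int p)"
  proof -
    have "[Legendre (-1) (int p) = (-1) ^ ((p - 1) div 2)] (mod int p)"
      using euler_criterion[OF p(1) p2] .
    moreover have "even ((p - 1) div 2)" using p(2) by presburger
    ultimately have L: "[Legendre (-1) (int p) = 1] (mod int p)" by simp
    have "\<not> [(-1::int) = 1] (mod int p)"
      using p2 zdvd_not_zless[of 2 "int p"] by (auto simp: cong_iff_dvd_diff)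
    moreover have "\<not> [(0::int) = 1] (mod int p)"
      using p2 by (auto simp: cong_iff_dvd_diff)
    ultimately have "QuadRes (int p) (-1)"
      using L by (auto simp: Legendre_def split: if_splits)
    then show thesis using that by (auto simp: QuadRes_def)
  qed
  have "cnj (gauss_sum p \<xi>) = (\<Sum>u\<in>{0..<int p}. additive_char p (- \<xi> * (i * u)\<^sup>2))"
    unfolding cnj_gauss_sum
  proof (intro sum.cong refl additive_char_cong[OF p0])
    fix u :: int
    have "[- \<xi> * (i * u)\<^sup>2 = - \<xi> * u\<^sup>2 * i\<^sup>2] (mod int p)"
      by (simp add: power_mult_distrib ac_simps)
    also have "[- \<xi> * u\<^sup>2 * i\<^sup>2 = - \<xi> * u\<^sup>2 * (- 1)] (mod int p)"
      by (intro cong_mult i) auto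
    finally show "[\<xi> * u\<^sup>2 = - \<xi> * (i * u)\<^sup>2] (mod int p)"
      by (simp add: cong_sym)
  qed
  also have "\<dots> = gauss_sum p \<xi>"
    unfolding gauss_sum_def
  proof (rule sum_residues_reindex[OF p0, where g = "\<lambda>u. i * u"])
    fix a b :: int
    show "additive_char p (- \<xi> * a\<^sup>2) = additive_char p (- \<xi> * b\<^sup>2)" if "[a = b] (mod int p)"
      using that by (intro additive_char_cong[OF p0] cong_mult cong_pow) auto
    assume "[i * a = i * b] (mod int p)"
    then have "[i * (i * a) = i * (i * b)] (mod int p)" by (rule cong_scalar_left)
    moreover have "[i * (i * c) = - c] (mod int p)" for c
      using cong_mult[OF i cong_refl[of c]] by (simp add: power2_eq_square mult.assoc)
    ultimately have "[- a = - b] (mod int p)"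
      by (meson cong_sym cong_trans)
    then show "[a = b] (mod int p)" by (simp only: cong_minus_minus_iff)
  qed
  finally show ?thesis
    by (metis complex_cnj cnj.sel(2) neg_equal_zero)
qed

text \<open>
  Raising \<open>u\<^sup>2 = - v\<^sup>2\<close> to the odd power \<open>(p - 1) / 2\<close> would give \<open>1 = -1\<close> by Fermat's theorem.
\<close>

lemma sum_two_squares_cong_0:
  fixes u v :: int
  assumes p: "prime p" "p mod 4 = 3" and uv: "[u\<^sup>2 = - (v\<^sup>2)] (mod int p)"
  shows "int p dvd u"
proof (rule ccontr)
  assume u: "\<not> int p dvd u"
  have v: "\<not> int p dvd v"
  proof
    assume "int p dvd v"
    then have "[u\<^sup>2 = 0] (mod int p)"
      using uv by (metis cong_0_iff cong_trans dvd_minus_iff dvd_power dvd_trans pos2)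
    then show False using u p by (simp add: cong_0_iff prime_dvd_power_iff)
  qed
  let ?h = "(p - 1) div 2"
  have h: "p - 1 = 2 * ?h" "odd ?h" using p(2) by presburger+
  have fermat: "[w ^ (p - 1) = 1] (mod int p)" if "\<not> int p dvd w" for w :: int
  proof -
    have "\<not> p dvd nat (w mod int p)"
      using that p prime_gt_0_nat[of p]
      by (metis dvd_mod_iff int_dvd_int_iff nat_0_le of_nat_0_less_iff pos_mod_sign dvd_refl)
    then have "[nat (w mod int p) ^ (p - 1) = 1] (mod p)"
      by (rule fermat_theorem[OF p(1)])
    then have "[int (nat (w mod int p) ^ (p - 1)) = int 1] (mod int p)"
      using cong_int_iff by blast
    moreover have "int (nat (w mod int p) ^ (p - 1)) = (w mod int p) ^ (p - 1)"
      using p prime_gt_0_nat[of p] by simp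
    ultimately show ?thesis by (simp add: unique_euclidean_semiring_class.cong_def power_mod)
  qed
  have "[u ^ (p - 1) = (u\<^sup>2) ^ ?h] (mod int p)" by (subst h(1)) (simp add: power_mult)
  also have "[(u\<^sup>2) ^ ?h = (- (v\<^sup>2)) ^ ?h] (mod int p)" by (intro cong_pow uv)
  also have "(- (v\<^sup>2)) ^ ?h = - (v ^ (p - 1))"
    using h(2) by (subst (2) h(1)) (simp add: power_mult)
  also have "[- (v ^ (p - 1)) = - 1] (mod int p)"
    using fermat[OF v] by (simp add: cong_minus_minus_iff)
  finally have "[1 = - 1] (mod int p)"
    using fermat[OF u] by (meson cong_sym cong_trans)
  then have "int p dvd 2" by (simp add: cong_iff_dvd_diff)
  then have "int p \<le> 2" by (rule zdvd_imp_le) simp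
  then have "p \<le> 2" by linarith
  then show False using p prime_ge_2_nat[of p] by auto
qed

lemma card_square_roots_le_2:
  assumes p: "prime p"
  shows "card (square_roots p t) \<le> 2"
proof (cases "square_roots p t = {}")
  case False
  have p0: "p > 0" using p prime_gt_0_nat by blast
  from False obtain u where u: "u \<in> {0..<int p}" "[u\<^sup>2 = t] (mod int p)"
    by (auto simp: square_roots_def)
  have "square_roots p t \<subseteq> {u, (- u) mod int p}"
  proof
    fix v assume "v \<in> square_roots p t"
    then have v: "v \<in> {0..<int p}" "[v\<^sup>2 = t] (mod int p)" by (auto simp: square_roots_def)
    have "[v\<^sup>2 = u\<^sup>2] (mod int p)" using u v by (meson cong_sym cong_trans)
    then have "int p dvd (v - u) * (v + u)"
      by (simp add: cong_iff_dvd_diff power2_eq_square algebra_simps)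
    then have "int p dvd v - u \<or> int p dvd v + u"
      using p by (simp add: prime_dvd_mult_iff)
    then have "[v = u] (mod int p) \<or> [v = - u] (mod int p)"
      by (simp add: cong_iff_dvd_diff)
    then show "v \<in> {u, (- u) mod int p}"
      using u v by (auto simp: unique_euclidean_semiring_class.cong_def)
  qed
  then have "card (square_roots p t) \<le> card {u, (- u) mod int p}"
    by (intro card_mono) auto
  also have "\<dots> \<le> 2" by (simp add: card_insert_if)
  finally show ?thesis .
qed auto

lemma square_roots_cong:
  assumes "[s = t] (mod int p)"
  shows "square_roots p s = square_roots p t"
  using assms unfolding square_roots_def by (meson cong_sym cong_trans)

lemma sum_card_square_roots:
  assumes p0: "p > 0"
  shows "(\<Sum>t\<in>{0..<int p}. card (square_roots p t)) = p"
proof -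
  have "(\<Sum>t\<in>{0..<int p}. card (square_roots p t)) =
      (\<Sum>t\<in>{0..<int p}. \<Sum>u\<in>{0..<int p}. if t = u\<^sup>2 mod int p then 1 else 0)"
    by (intro sum.cong refl)
       (auto simp: square_roots_def sum.If_cases Int_def unique_euclidean_semiring_class.cong_def intro!: arg_cong[where f = card])
  also have "\<dots> = (\<Sum>u\<in>{0..<int p}. \<Sum>t\<in>{0..<int p}. if t = u\<^sup>2 mod int p then 1 else 0)"
    by (rule sum.swap)
  also have "\<dots> = (\<Sum>u\<in>{0..<int p}. 1)"
    using p0 by (intro sum.cong refl) simp
  finally show ?thesis by simp
qed

text \<open>
  For \<open>t \<noteq> 0\<close> at most one of \<open>t\<close> and \<open>- t\<close> is a square, since \<open>-1\<close> is not, so the sum is at most \<open>2\<close>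
  everywhere. Its average over all \<open>t\<close> is exactly \<open>2\<close>, because every residue is a square root of one
  \<open>t\<close>. Hence it equals \<open>2\<close> everywhere.
\<close>

lemma card_square_roots_add_minus:
  assumes p: "prime p" "p mod 4 = 3" and t: "t \<in> {0..<int p}"
  shows "card (square_roots p t) + card (square_roots p (- t)) = 2"
proof -
  have p0: "p > 0" using p prime_gt_0_nat by blast
  let ?R = "{0..<int p}"
  let ?n = "\<lambda>t. card (square_roots p t)"
  have le: "?n t + ?n (- t) \<le> 2" if t: "t \<in> ?R" for t
  proof (cases "square_roots p t = {} \<or> square_roots p (- t) = {}")
    case True
    then show ?thesis using card_square_roots_le_2[OF p(1)] by auto
  next
    case False
    then obtain u v where uv: "[u\<^sup>2 = t] (mod int p)" "[v\<^sup>2 = - t] (mod int p)"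
      by (auto simp: square_roots_def)
    have "[- (v\<^sup>2) = - (- t)] (mod int p)"
      using uv(2) cong_minus_minus_iff by blast
    then have "[u\<^sup>2 = - (v\<^sup>2)] (mod int p)"
      using uv(1) by (metis cong_sym cong_trans minus_minus)
    then have "int p dvd u" using p by (intro sum_two_squares_cong_0)
    then have "int p dvd t"
      using uv(1) by (metis cong_dvd_iff dvd_power dvd_trans pos2)
    then have t0: "t = 0" using t zdvd_not_zless[of t "int p"] by fastforce
    have "square_roots p 0 \<subseteq> {0}"
    proof
      fix w assume "w \<in> square_roots p 0"
      then have "w \<in> ?R" "int p dvd w"
        using p by (auto simp: square_roots_def cong_0_iff prime_dvd_power_iff)
      then show "w \<in> {0}" using zdvd_not_zless[of w "int p"] by fastforce
    qed
    then have "?n 0 \<le> 1" using card_mono[of "{0::int}"] by fastforce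
    then show ?thesis using t0 by simp
  qed
  have "(\<Sum>t\<in>?R. complex_of_nat (?n (- t))) = (\<Sum>t\<in>?R. complex_of_nat (?n t))"
    by (rule sum_residues_reindex[OF p0, where g = uminus])
       (auto simp: square_roots_cong cong_minus_minus_iff dest: square_roots_cong)
  then have "complex_of_nat (\<Sum>t\<in>?R. ?n (- t)) = complex_of_nat (\<Sum>t\<in>?R. ?n t)"
    by simp
  then have "(\<Sum>t\<in>?R. ?n (- t)) = p"
    using sum_card_square_roots[OF p0] of_nat_eq_iff by metis
  then have "(\<Sum>t\<in>?R. 2 - real (?n t + ?n (- t))) = 0"
    using sum_card_square_roots[OF p0]
    by (simp add: sum_subtractf sum.distrib flip: of_nat_sum)
  moreover have "0 \<le> 2 - real (?n t + ?n (- t))" if "t \<in> ?R" for t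
    using le[OF that] by linarith
  ultimately have "2 - real (?n t + ?n (- t)) = 0"
    using t by (subst (asm) sum_nonneg_eq_0_iff) auto
  then show ?thesis by linarith
qed

text \<open>
  Adding the conjugate amounts to transforming \<open>t \<mapsto> card (square_roots p t) + card (square_roots p (- t))\<close>,
  which is constant, so that the transform vanishes away from the frequency \<open>0\<close>.
\<close>

lemma Re_gauss_sum_eq_0:
  assumes p: "prime p" "p mod 4 = 3" and \<xi>: "\<not> int p dvd \<xi>"
  shows "Re (gauss_sum p \<xi>) = 0"
proof -
  have p0: "p > 0" using p prime_gt_0_nat by blast
  let ?R = "{0..<int p}"
  let ?n = "\<lambda>t. complex_of_nat (card (square_roots p t))"
  have *: "(\<Sum>u\<in>?R. additive_char p (\<eta> * u\<^sup>2)) = (\<Sum>t\<in>?R. ?n t * additive_char p (\<eta> * t))" for \<eta>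
  proof -
    have "(\<Sum>t\<in>?R. ?n t * additive_char p (\<eta> * t)) =
        (\<Sum>t\<in>?R. \<Sum>u\<in>?R. if u\<^sup>2 mod int p = t then additive_char p (\<eta> * t) else 0)"
      by (intro sum.cong refl)
         (auto simp: square_roots_def sum.If_cases Int_def unique_euclidean_semiring_class.cong_def eq_commute[of _ "_ mod _"])
    also have "\<dots> = (\<Sum>u\<in>?R. \<Sum>t\<in>?R. if u\<^sup>2 mod int p = t then additive_char p (\<eta> * t) else 0)"
      by (rule sum.swap)
    also have "\<dots> = (\<Sum>u\<in>?R. additive_char p (\<eta> * (u\<^sup>2 mod int p)))"
      using p0 by (intro sum.cong refl) simp
    also have "\<dots> = (\<Sum>u\<in>?R. additive_char p (\<eta> * u\<^sup>2))"
      by (intro sum.cong refl additive_char_cong[OF p0]) (simp add: unique_euclidean_semiring_class.cong_def mod_mult_right_eq)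
    finally show ?thesis by simp
  qed
  have "gauss_sum p \<xi> = (\<Sum>t\<in>?R. ?n (- t) * additive_char p (- \<xi> * (- t)))"
    unfolding gauss_sum_def *
  proof (rule sum_residues_reindex[OF p0, where g = uminus, symmetric])
    fix a b :: int
    show "?n a * additive_char p (- \<xi> * a) = ?n b * additive_char p (- \<xi> * b)"
      if "[a = b] (mod int p)"
      using square_roots_cong[OF that] additive_char_cong[OF p0 cong_scalar_left[OF that, of "- \<xi>"]]
      by simp
    show "[a = b] (mod int p)" if "[- a = - b] (mod int p)"
      using that by (simp only: cong_minus_minus_iff)
  qed
  then have "gauss_sum p \<xi> = (\<Sum>t\<in>?R. ?n (- t) * additive_char p (\<xi> * t))" by simp
  moreover have "cnj (gauss_sum p \<xi>) = (\<Sum>t\<in>?R. ?n t * additive_char p (\<xi> * t))"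
    unfolding cnj_gauss_sum * ..
  ultimately have "gauss_sum p \<xi> + cnj (gauss_sum p \<xi>) =
      (\<Sum>t\<in>?R. of_nat (card (square_roots p t) + card (square_roots p (- t))) * additive_char p (\<xi> * t))"
    by (simp add: sum.distrib distrib_right)
  also have "\<dots> = (\<Sum>t\<in>?R. 2 * additive_char p (t * \<xi>))"
    by (intro sum.cong refl) (simp only: card_square_roots_add_minus[OF p], simp add: mult.commute)
  also have "\<dots> = 0"
    using \<xi> by (simp add: sum_distrib_left[symmetric] sum_additive_char[OF p0])
  finally have "2 * Re (gauss_sum p \<xi>) = 0"
    by (metis complex_add_cnj of_real_eq_0_iff)
  then show ?thesis by simp
qed

section \<open>A spectral bound for sets without square differences\<close>

text \<open>
  The product differs from \<open>1\<close> by at most \<open>(1 + 1/(2k))^k - 1 \<le> sqrt (exp 1) - 1 < 1\<close>, where \<open>k = card S\<close>.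
\<close>

lemma Re_prod_one_plus_nonneg:
  fixes z :: "nat \<Rightarrow> complex"
  assumes "finite S" "\<And>p. p \<in> S \<Longrightarrow> norm (z p) \<le> 1 / (2 * real (card S))"
  shows "0 \<le> Re (\<Prod>p\<in>S. 1 + z p)"
proof (cases "S = {}")
  case False
  define k where "k = card S"
  have k: "k > 0" using False assms(1) by (simp add: k_def card_gt_0_iff)
  have "norm ((\<Prod>p\<in>S. 1 + z p) - 1) \<le> (\<Prod>p\<in>S. 1 + norm (z p)) - 1"
    by (rule norm_prod_minus1_le_prod_minus1)
  also have "(\<Prod>p\<in>S. 1 + norm (z p)) \<le> (\<Prod>p\<in>S. 1 + 1 / (2 * real k))"
    using assms(2) by (intro prod_mono) (auto simp: k_def add_nonneg_nonneg)
  also have "\<dots> = (1 + 1 / (2 * real k)) ^ k" by (simp add: k_def)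
  also have "\<dots> \<le> exp (1 / (2 * real k)) ^ k"
    by (intro power_mono) (auto intro: exp_ge_add_one_self)
  also have "\<dots> = exp (1 / 2)" using k by (simp flip: exp_of_nat_mult)
  also have "\<dots> \<le> 2"
    using exp_bound[of "1 / 2 :: real"] by (simp add: power2_eq_square)
  finally have "norm ((\<Prod>p\<in>S. 1 + z p) - 1) \<le> 1" by simp
  then have "\<bar>Re ((\<Prod>p\<in>S. 1 + z p) - 1)\<bar> \<le> 1"
    using abs_Re_le_cmod order_trans by blast
  then show ?thesis by simp
qed simp

text \<open>
  Expanding the two products, their difference keeps twice the terms with an odd number of factors \<open>b\<close>,
  and among them the full product of \<open>b\<close> if \<open>card S\<close> is odd; their sum keeps the other terms. Adding a
  factor mixes the two, so they are treated together.
\<close>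

lemma prod_add_minus_prod_diff_ge:
  fixes a b :: "'a \<Rightarrow> real"
  assumes "finite S" "\<And>p. p \<in> S \<Longrightarrow> 0 \<le> a p" "\<And>p. p \<in> S \<Longrightarrow> 0 \<le> b p"
  shows "(1 - (-1) ^ card S) * prod b S \<le> (\<Prod>p\<in>S. a p + b p) - (\<Prod>p\<in>S. a p - b p) \<and>
    (1 + (-1) ^ card S) * prod b S \<le> (\<Prod>p\<in>S. a p + b p) + (\<Prod>p\<in>S. a p - b p)"
  using assms
proof (induction S rule: finite_induct)
  case (insert q S)
  define P where "P = (\<Prod>p\<in>S. a p + b p)"
  define N where "N = (\<Prod>p\<in>S. a p - b p)"
  define B where "B = prod b S"
  define s :: real where "s = (-1) ^ card S"
  have s: "\<bar>s\<bar> = 1" by (simp add: s_def power_abs)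
  have B: "B \<ge> 0" unfolding B_def using insert by (intro prod_nonneg) auto
  have IH: "(1 - s) * B \<le> P - N" "(1 + s) * B \<le> P + N"
    using insert by (auto simp: P_def N_def B_def s_def)
  have ab: "0 \<le> a q" "0 \<le> b q" using insert by auto
  have nn: "0 \<le> P - N" "0 \<le> P + N"
    using IH B s by (smt (verit) mult_nonneg_nonneg)+
  have 1: "b q * ((1 + s) * B) \<le> a q * (P - N) + b q * (P + N)"
    using mult_left_mono[OF IH(2) ab(2)] mult_nonneg_nonneg[OF ab(1) nn(1)] by linarith
  have 2: "b q * ((1 - s) * B) \<le> a q * (P + N) + b q * (P - N)"
    using mult_left_mono[OF IH(1) ab(2)] mult_nonneg_nonneg[OF ab(1) nn(2)] by linarith
  show "(1 - (-1) ^ card (insert q S)) * prod b (insert q S) \<le>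
      (\<Prod>p\<in>insert q S. a p + b p) - (\<Prod>p\<in>insert q S. a p - b p) \<and>
    (1 + (-1) ^ card (insert q S)) * prod b (insert q S) \<le>
      (\<Prod>p\<in>insert q S. a p + b p) + (\<Prod>p\<in>insert q S. a p - b p)"
    using insert(1,2) 1 2
    by (simp_all add: P_def[symmetric] N_def[symmetric] B_def[symmetric] s_def[symmetric] algebra_simps)
qed auto

lemma abs_prod_diff_le_prod_add:
  fixes a b :: "'a \<Rightarrow> real"
  assumes "\<And>p. p \<in> S \<Longrightarrow> 0 \<le> a p" "\<And>p. p \<in> S \<Longrightarrow> 0 \<le> b p"
  shows "\<bar>\<Prod>p\<in>S. a p - b p\<bar> \<le> (\<Prod>p\<in>S. a p + b p)"
  unfolding abs_prod using assms by (intro prod_mono) (fastforce simp: abs_le_iff)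

text \<open>
  The difference is twice the sum of the terms of the expansion in which an odd number of factors \<open>a p\<close>, hence
  at least one, is replaced by \<open>1\<close>, and each such replacement gains a factor \<open>\<beta>\<close>.
\<close>

lemma prod_add_1_minus_prod_diff_1_le:
  fixes a :: "'a \<Rightarrow> real"
  assumes "finite S" "\<beta> > 0" "\<And>p. p \<in> S \<Longrightarrow> \<beta> \<le> a p"
  shows "(\<Prod>p\<in>S. a p + 1) - (\<Prod>p\<in>S. a p - 1) \<le> 2 * real (card S) * (\<Prod>p\<in>S. a p + 1) / \<beta>"
  using assms(1,3)
proof (induction S rule: finite_induct)
  case (insert q S)
  define P where "P = (\<Prod>p\<in>S. a p + 1)"
  define N where "N = (\<Prod>p\<in>S. a p - 1)"
  have nonneg: "0 \<le> a p" if "p \<in> insert q S" for p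
    using insert(4)[OF that] assms(2) by linarith
  have IH: "P - N \<le> 2 * real (card S) * P / \<beta>" using insert by (auto simp: P_def N_def)
  have P: "P \<ge> 0" unfolding P_def using nonneg by (intro prod_nonneg) (auto intro: add_nonneg_nonneg)
  have NP: "N \<le> P"
    using abs_prod_diff_le_prod_add[of S a "\<lambda>_. 1"] nonneg by (force simp: P_def N_def)
  have q: "\<beta> \<le> a q" using insert by auto
  have "\<beta> * P \<le> (a q + 1) * P" using q P by (intro mult_right_mono) auto
  then have PQ: "P \<le> (a q + 1) * P / \<beta>" using assms(2) by (simp add: field_simps)
  have "(a q + 1) * P - (a q - 1) * N = (a q + 1) * (P - N) + 2 * N"
    by (simp add: algebra_simps)
  also have "\<dots> \<le> (a q + 1) * (2 * real (card S) * P / \<beta>) + 2 * ((a q + 1) * P / \<beta>)"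
    using IH NP PQ q assms(2) by (intro add_mono mult_left_mono) auto
  also have "\<dots> = 2 * real (Suc (card S)) * ((a q + 1) * P) / \<beta>"
    using assms(2) by (simp add: field_simps)
  finally show ?case using insert(1,2) by (simp add: P_def N_def)
qed simp

text \<open>
  Writing each kernel by its Fourier expansion diagonalises the quadratic form of a product kernel on the
  indicator function of \<open>A\<close>.
\<close>

lemma sum_prod_kernel_fourier:
  fixes f g :: "nat \<Rightarrow> int \<Rightarrow> complex"
  assumes S: "finite S" and A: "finite A"
    and f: "\<And>p t. p \<in> S \<Longrightarrow> f p t = (\<Sum>\<xi>\<in>{0..<int p}. g p \<xi> / of_nat p * additive_char p (\<xi> * t))"
  shows "(\<Sum>a\<in>A. \<Sum>b\<in>A. \<Prod>p\<in>S. f p (a - b)) =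
    (\<Sum>\<xi>\<in>(\<Pi>\<^sub>E p\<in>S. {0..<int p}). (\<Prod>p\<in>S. g p (\<xi> p)) / of_nat (\<Prod>S) *
      of_real ((norm (\<Sum>a\<in>A. \<Prod>p\<in>S. additive_char p (\<xi> p * a)))\<^sup>2))"
proof -
  let ?X = "\<Pi>\<^sub>E p\<in>S. {0..<int p}"
  let ?E = "\<lambda>\<xi> a. \<Prod>p\<in>S. additive_char p (\<xi> p * a)"
  have E: "(\<Prod>p\<in>S. additive_char p (\<xi> p * (a - b))) = ?E \<xi> a * cnj (?E \<xi> b)" for \<xi> a b
    by (simp add: cnj_prod cnj_additive_char algebra_simps flip: prod.distrib additive_char_add)
  have "(\<Sum>a\<in>A. \<Sum>b\<in>A. \<Prod>p\<in>S. f p (a - b)) =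
      (\<Sum>a\<in>A. \<Sum>b\<in>A. \<Sum>\<xi>\<in>?X. \<Prod>p\<in>S. g p (\<xi> p) / of_nat p * additive_char p (\<xi> p * (a - b)))"
    using S f by (simp add: prod_sum_PiE)
  also have "\<dots> = (\<Sum>a\<in>A. \<Sum>b\<in>A. \<Sum>\<xi>\<in>?X. (\<Prod>p\<in>S. g p (\<xi> p)) / of_nat (\<Prod>S) * (?E \<xi> a * cnj (?E \<xi> b)))"
    by (simp add: prod.distrib prod_dividef E)
  also have "\<dots> = (\<Sum>a\<in>A. \<Sum>\<xi>\<in>?X. \<Sum>b\<in>A. (\<Prod>p\<in>S. g p (\<xi> p)) / of_nat (\<Prod>S) * (?E \<xi> a * cnj (?E \<xi> b)))"
    by (intro sum.cong[OF refl] sum.swap)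
  also have "\<dots> = (\<Sum>\<xi>\<in>?X. \<Sum>a\<in>A. \<Sum>b\<in>A. (\<Prod>p\<in>S. g p (\<xi> p)) / of_nat (\<Prod>S) * (?E \<xi> a * cnj (?E \<xi> b)))"
    by (rule sum.swap)
  also have "\<dots> = (\<Sum>\<xi>\<in>?X. (\<Prod>p\<in>S. g p (\<xi> p)) / of_nat (\<Prod>S) * ((\<Sum>a\<in>A. ?E \<xi> a) * cnj (\<Sum>b\<in>A. ?E \<xi> b)))"
    by (simp only: cnj_sum sum_product, simp only: sum_distrib_left)
  finally show ?thesis by (simp only: complex_norm_square)
qed

text \<open>
  The sign \<open>s\<close> is there to extract the part of a product of such local factors that is odd in the number of
  square roots, as half of the difference between the products for \<open>s = 1\<close> and \<open>s = -1\<close>.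
\<close>

definition signed_kernel :: "(nat \<Rightarrow> real) \<Rightarrow> real \<Rightarrow> nat \<Rightarrow> int \<Rightarrow> complex" where
  "signed_kernel \<alpha> s p t =
    of_real (\<alpha> p * of_bool (int p dvd t) + s * real (card (square_roots p t)))"

lemma signed_kernel_fourier:
  assumes "p > 0"
  shows "signed_kernel \<alpha> s p t =
    (\<Sum>\<xi>\<in>{0..<int p}. (of_real (\<alpha> p) + of_real s * gauss_sum p \<xi>) / of_nat p * additive_char p (\<xi> * t))"
proof -
  have "(\<Sum>\<xi>\<in>{0..<int p}. (of_real (\<alpha> p) + of_real s * gauss_sum p \<xi>) / of_nat p * additive_char p (\<xi> * t))
    = (\<Sum>\<xi>\<in>{0..<int p}. of_real (\<alpha> p) / of_nat p * additive_char p (\<xi> * t) +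
        of_real s * (gauss_sum p \<xi> / of_nat p * additive_char p (\<xi> * t)))"
    by (intro sum.cong) (auto simp: add_divide_distrib distrib_right)
  also have "\<dots> = of_real (\<alpha> p) / of_nat p * (\<Sum>\<xi>\<in>{0..<int p}. additive_char p (\<xi> * t)) +
        of_real s * of_nat (card (square_roots p t))"
    by (simp only: card_square_roots_fourier[OF assms] sum.distrib sum_distrib_left)
  also have "\<dots> = signed_kernel \<alpha> s p t"
    using assms by (simp add: sum_additive_char signed_kernel_def)
  finally show ?thesis by simp
qed

lemma signed_kernel_0:
  assumes "prime p"
  shows "signed_kernel \<alpha> s p 0 = of_real (\<alpha> p + s)"
proof -
  have "square_roots p 0 = {0}"
  proof (intro subset_antisym subsetI)
    fix w assume "w \<in> square_roots p 0"
    then have "w \<in> {0..<int p}" "int p dvd w"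
      using assms by (auto simp: square_roots_def cong_0_iff prime_dvd_power_iff)
    then show "w \<in> {0}" using zdvd_not_zless[of w "int p"] by fastforce
  qed (use assms prime_gt_0_nat[of p] in \<open>auto simp: square_roots_def\<close>)
  then show ?thesis by (simp add: signed_kernel_def)
qed

lemma signed_kernel_eq_0:
  assumes "p > 0" "\<And>c. \<not> [t = c\<^sup>2] (mod int p)"
  shows "signed_kernel \<alpha> s p t = 0"
proof -
  have "square_roots p t = {}"
    using assms(2) by (auto simp: square_roots_def intro: cong_sym)
  moreover have "\<not> int p dvd t"
    using assms(2)[of 0] by (simp add: cong_0_iff)
  ultimately show ?thesis by (simp add: signed_kernel_def)
qed

lemma sqrt_prod:
  assumes "finite S"
  shows "sqrt (\<Prod>p\<in>S. f p) = (\<Prod>p\<in>S. sqrt (f p))"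
  using assms by (induction S rule: finite_induct) (auto simp: real_sqrt_mult)

text \<open>
  The linear programming bound for the odd part described at the beginning. At a frequency \<open>\<xi>\<close> let \<open>V\<close> be
  the set of \<open>p\<close> in \<open>S3\<close> with \<open>\<xi> p = 0\<close> and \<open>U\<close> its complement in \<open>S3\<close>. On \<open>U\<close> the Gauss sums are imaginary,
  so the two products over \<open>U\<close> are complex conjugate to each other and share a real part, which is
  nonnegative by \<open>Re_prod_one_plus_nonneg\<close>; the products over \<open>V\<close> and over \<open>S1\<close> are real, and for \<open>V\<close>
  the sign \<open>s = 1\<close> gives the larger one. Hence the transform of the odd part has nonnegative real part.
\<close>

lemma card_square_difference_free_le:
  fixes A :: "int set"
  assumes fin: "finite S1" "finite S3" "finite A"
    and S1: "\<And>p. p \<in> S1 \<Longrightarrow> prime p \<and> p mod 4 = 1"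
    and S3: "\<And>p. p \<in> S3 \<Longrightarrow> prime p \<and> p mod 4 = 3 \<and> Q \<le> real p"
    and odd: "odd (card S3)" and Q: "Q > 0"
    and A: "\<And>a b. a \<in> A \<Longrightarrow> b \<in> A \<Longrightarrow>
      (\<And>p. p \<in> S1 \<union> S3 \<Longrightarrow> \<exists>c. [a - b = c\<^sup>2] (mod int p)) \<Longrightarrow> a = b"
  shows "real (card A) \<le> sqrt (real (\<Prod>(S1 \<union> S3))) * (3 * real (card S3)) ^ card S3 / sqrt Q"
proof (cases "A = {}")
  case True
  then show ?thesis using Q by (simp add: prod_nonneg)
next
  case False
  define k where "k = card S3"
  have k: "k > 0" "odd k" using odd by (auto simp: k_def odd_pos)
  have S3ne: "S3 \<noteq> {}" using k by (auto simp: k_def)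
  define S where "S = S1 \<union> S3"
  have dis: "S1 \<inter> S3 = {}" using S1 S3 by fastforce
  have finS: "finite S" using fin by (simp add: S_def)
  have prS: "prime p" if "p \<in> S" for p using that S1 S3 by (auto simp: S_def)
  have p0: "p > 0" if "p \<in> S" for p using prS[OF that] prime_gt_0_nat by blast
  have oddp: "Parity.odd p" if "p \<in> S" for p
  proof -
    have "p mod 4 = 1 \<or> p mod 4 = 3" using that S1 S3 by (auto simp: S_def)
    then show ?thesis by presburger
  qed
  \<comment> \<open>With these weights the factors for \<open>S1\<close> have nonnegative transform, and those for \<open>S3\<close> have argument about \<open>1 / (2 k)\<close>.\<close>
  define \<alpha> where "\<alpha> p = (if p \<in> S3 then 2 * real k * sqrt (real p) else sqrt (real p))" for p
  \<comment> \<open>Only the primes of \<open>S3\<close> change sign: the odd part is taken with respect to them.\<close>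
  define sg :: "real \<Rightarrow> nat \<Rightarrow> real" where "sg s p = (if p \<in> S3 then s else 1)" for s p
  define F where "F s t = (\<Prod>p\<in>S. signed_kernel \<alpha> (sg s p) p t)" for s t
  define G where "G s \<xi> = (\<Prod>p\<in>S. of_real (\<alpha> p) + of_real (sg s p) * gauss_sum p (\<xi> p))" for s \<xi>
  define H where "H \<xi> = (norm (\<Sum>a\<in>A. \<Prod>p\<in>S. additive_char p (\<xi> p * a)))\<^sup>2" for \<xi>
  let ?X = "\<Pi>\<^sub>E p\<in>S. {0..<int p}"
  define M where "M = \<Prod>S"
  have M: "real M > 0" using p0 by (auto simp: M_def intro!: prod_pos)

  have fourier: "(\<Sum>a\<in>A. \<Sum>b\<in>A. F s (a - b)) = (\<Sum>\<xi>\<in>?X. G s \<xi> / of_nat M * of_real (H \<xi>))" for s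
    unfolding F_def G_def H_def M_def
    by (rule sum_prod_kernel_fourier[OF finS fin(3)]) (rule signed_kernel_fourier, rule p0)

  \<comment> \<open>Off the diagonal some prime sees a non-residue, where its local factor vanishes.\<close>
  have diag: "(\<Sum>a\<in>A. \<Sum>b\<in>A. F s (a - b)) = of_nat (card A) * F s 0" for s
  proof -
    have "F s (a - b) = (if b = a then F s 0 else 0)" if ab: "a \<in> A" "b \<in> A" for a b
    proof (cases "a = b")
      case False
      then obtain p where p: "p \<in> S" "\<And>c. \<not> [a - b = c\<^sup>2] (mod int p)"
        using A[OF ab] by (auto simp: S_def)
      then have "signed_kernel \<alpha> (sg s p) p (a - b) = 0"
        using p0 by (intro signed_kernel_eq_0) auto
      then show ?thesis using p(1) finS False by (auto simp: F_def)
    qed auto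
    then have "(\<Sum>a\<in>A. \<Sum>b\<in>A. F s (a - b)) = (\<Sum>a\<in>A. \<Sum>b\<in>A. if b = a then F s 0 else 0)"
      by (intro sum.cong refl) auto
    also have "\<dots> = of_nat (card A) * F s 0"
      using fin(3) by simp
    finally show ?thesis .
  qed

  have prodS: "(\<Prod>p\<in>S. h p) = (\<Prod>p\<in>S1. h p) * (\<Prod>p\<in>S3. h p)" for h :: "nat \<Rightarrow> 'b :: comm_monoid_mult"
    unfolding S_def using fin dis by (intro prod.union_disjoint) auto

  have Re_nonneg: "0 \<le> Re (G 1 \<xi> - G (-1) \<xi>)" if \<xi>: "\<xi> \<in> ?X" for \<xi>
  proof -
    have \<xi>p: "\<xi> p \<in> {0..<int p}" if "p \<in> S" for p using \<xi> that by (auto simp: PiE_iff)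
    define V where "V = {p \<in> S3. \<xi> p = 0}"
    define U where "U = S3 - V"
    have VU: "S3 = V \<union> U" "V \<inter> U = {}" "finite V" "finite U"
      using fin by (auto simp: V_def U_def)
    have ndvd: "\<not> int p dvd \<xi> p" if "p \<in> S" "\<xi> p \<noteq> 0" for p
      using \<xi>p[OF that(1)] that(2) zdvd_not_zless[of "\<xi> p" "int p"] by fastforce
    define R1 where "R1 = (\<Prod>p\<in>S1. sqrt (real p) + Re (gauss_sum p (\<xi> p)))"
    have R1: "(\<Prod>p\<in>S1. of_real (\<alpha> p) + of_real (sg s p) * gauss_sum p (\<xi> p)) = of_real R1" for s
      unfolding R1_def of_real_prod
    proof (intro prod.cong refl)
      fix p assume p: "p \<in> S1"
      then have "p \<notin> S3" using dis by auto
      moreover have "gauss_sum p (\<xi> p) = of_real (Re (gauss_sum p (\<xi> p)))"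
        using Im_gauss_sum_eq_0[of p "\<xi> p"] S1[OF p] by (simp add: complex_eq_iff)
      ultimately show "of_real (\<alpha> p) + of_real (sg s p) * gauss_sum p (\<xi> p) =
          of_real (sqrt (real p) + Re (gauss_sum p (\<xi> p)))"
        by (simp add: \<alpha>_def sg_def)
    qed
    have R1_nonneg: "0 \<le> R1"
      unfolding R1_def
    proof (intro prod_nonneg ballI)
      fix p assume p: "p \<in> S1"
      show "0 \<le> sqrt (real p) + Re (gauss_sum p (\<xi> p))"
      proof (cases "\<xi> p = 0")
        case False
        then have "norm (gauss_sum p (\<xi> p)) = sqrt (real p)"
          using p prS oddp ndvd by (intro norm_gauss_sum) (auto simp: S_def)
        then show ?thesis using abs_Re_le_cmod[of "gauss_sum p (\<xi> p)"] by linarith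
      qed (simp add: gauss_sum_0)
    qed
    define PV where "PV s = (\<Prod>p\<in>V. \<alpha> p + s * real p)" for s
    have PV: "(\<Prod>p\<in>V. of_real (\<alpha> p) + of_real (sg s p) * gauss_sum p (\<xi> p)) = complex_of_real (PV s)" for s
      unfolding PV_def of_real_prod
      by (intro prod.cong) (auto simp: V_def gauss_sum_0 sg_def)
    \<comment> \<open>The ratios \<open>z p\<close> are purely imaginary of size \<open>1 / (2 k)\<close>.\<close>
    define z where "z p = gauss_sum p (\<xi> p) / of_real (\<alpha> p)" for p
    define W where "W = (\<Prod>p\<in>U. 1 + z p)"
    define aU where "aU = (\<Prod>p\<in>U. \<alpha> p)"
    have U: "p \<in> S" "\<xi> p \<noteq> 0" "p \<in> S3" if "p \<in> U" for p
      using that by (auto simp: U_def V_def S_def)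
    have \<alpha>pos: "\<alpha> p > 0" if "p \<in> S" for p using p0[OF that] k by (auto simp: \<alpha>_def)
    have zcnj: "cnj (z p) = - z p" if "p \<in> U" for p
    proof -
      have "Re (gauss_sum p (\<xi> p)) = 0"
        using Re_gauss_sum_eq_0[of p "\<xi> p"] S3[of p] U[OF that] ndvd by auto
      then show ?thesis by (simp add: z_def complex_eq_iff)
    qed
    have W: "(\<Prod>p\<in>U. of_real (\<alpha> p) + of_real (sg 1 p) * gauss_sum p (\<xi> p)) = of_real aU * W"
      unfolding aU_def W_def of_real_prod prod.distrib[symmetric]
    proof (intro prod.cong refl)
      fix p assume p: "p \<in> U"
      show "of_real (\<alpha> p) + of_real (sg 1 p) * gauss_sum p (\<xi> p) = of_real (\<alpha> p) * (1 + z p)"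
        using U[OF p] \<alpha>pos[of p] by (simp add: sg_def z_def distrib_left)
    qed
    have W': "(\<Prod>p\<in>U. of_real (\<alpha> p) + of_real (sg (-1) p) * gauss_sum p (\<xi> p)) = of_real aU * cnj W"
      unfolding aU_def W_def of_real_prod cnj_prod prod.distrib[symmetric]
    proof (intro prod.cong refl)
      fix p assume p: "p \<in> U"
      have "cnj (1 + z p) = 1 - z p" using zcnj[OF p] by simp
      then show "of_real (\<alpha> p) + of_real (sg (-1) p) * gauss_sum p (\<xi> p) = of_real (\<alpha> p) * cnj (1 + z p)"
        using U[OF p] \<alpha>pos[of p] by (simp add: sg_def z_def right_diff_distrib)
    qed
    have cardU: "card U \<le> k" unfolding k_def U_def using fin by (intro card_mono) auto
    have ReW: "0 \<le> Re W"
      unfolding W_def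
    proof (rule Re_prod_one_plus_nonneg)
      fix p assume p: "p \<in> U"
      then have cU: "card U > 0" using VU by (auto simp: card_gt_0_iff)
      have "norm (gauss_sum p (\<xi> p)) = sqrt (real p)"
        using p prS oddp ndvd U by (intro norm_gauss_sum) auto
      then have "norm (z p) = 1 / (2 * real k)"
        using U[OF p] p0[of p] k by (simp add: z_def norm_divide norm_mult \<alpha>_def)
      also have "\<dots> \<le> 1 / (2 * real (card U))" using cardU cU by (simp add: frac_le)
      finally show "norm (z p) \<le> 1 / (2 * real (card U))" .
    qed (use VU in auto)
    have aU: "0 \<le> aU" unfolding aU_def using \<alpha>pos U by (intro prod_nonneg) (auto intro: less_imp_le)
    have "\<bar>PV (-1)\<bar> \<le> PV 1"
      using abs_prod_diff_le_prod_add[of V \<alpha> real] \<alpha>pos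
      by (auto simp: PV_def V_def S_def intro: less_imp_le)
    then have PVd: "0 \<le> PV 1 - PV (-1)" by linarith
    have "G s \<xi> = of_real R1 * (of_real (PV s) *
        (\<Prod>p\<in>U. of_real (\<alpha> p) + of_real (sg s p) * gauss_sum p (\<xi> p)))" for s
      unfolding G_def prodS R1 PV[symmetric]
      using VU prod.union_disjoint[of V U] by auto
    then have "Re (G 1 \<xi> - G (-1) \<xi>) = R1 * (PV 1 - PV (-1)) * aU * Re W"
      by (simp only: W W') (simp add: algebra_simps)
    then show ?thesis using R1_nonneg PVd aU ReW by simp
  qed

  define B where "B = (\<Prod>p\<in>S1. sqrt (real p) + real p) * (\<Prod>p\<in>S3. real p)"
  define f where "f = (\<Prod>p\<in>S1. sqrt (real p) + 1) * ((\<Prod>p\<in>S3. \<alpha> p + 1) - (\<Prod>p\<in>S3. \<alpha> p - 1))"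
  have B_pos: "B > 0"
    using p0 by (auto simp: B_def S_def intro!: mult_pos_pos prod_pos add_nonneg_pos)
  have F0: "F 1 0 - F (-1) 0 = of_real f"
  proof -
    have 1: "(\<Prod>p\<in>S1. signed_kernel \<alpha> (sg s p) p 0) = of_real (\<Prod>p\<in>S1. sqrt (real p) + 1)" for s
      unfolding of_real_prod using S1 dis
      by (intro prod.cong) (auto simp: signed_kernel_0 sg_def \<alpha>_def)
    have 3: "(\<Prod>p\<in>S3. signed_kernel \<alpha> (sg s p) p 0) = of_real (\<Prod>p\<in>S3. \<alpha> p + s)" for s
      unfolding of_real_prod using S3
      by (intro prod.cong) (auto simp: signed_kernel_0 sg_def)
    show ?thesis unfolding F_def prodS 1 3 f_def
      by (simp add: right_diff_distrib)
  qed
  \<comment> \<open>The frequency \<open>0\<close>, as an element of the index set of the Fourier sum.\<close>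
  define \<zeta> :: "nat \<Rightarrow> int" where "\<zeta> = (\<lambda>p\<in>S. 0)"
  have \<zeta>: "\<zeta> \<in> ?X" using p0 by (auto simp: \<zeta>_def)
  have H0: "H \<zeta> = (real (card A))\<^sup>2"
    by (simp add: H_def \<zeta>_def norm_power)
  have G0: "2 * B \<le> Re (G 1 \<zeta> - G (-1) \<zeta>)"
  proof -
    have 1: "(\<Prod>p\<in>S1. of_real (\<alpha> p) + of_real (sg s p) * gauss_sum p (\<zeta> p)) =
        complex_of_real (\<Prod>p\<in>S1. sqrt (real p) + real p)" for s
      unfolding of_real_prod using dis
      by (intro prod.cong) (auto simp: sg_def \<alpha>_def \<zeta>_def S_def gauss_sum_0)
    have 3: "(\<Prod>p\<in>S3. of_real (\<alpha> p) + of_real (sg s p) * gauss_sum p (\<zeta> p)) =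
        complex_of_real (\<Prod>p\<in>S3. \<alpha> p + s * real p)" for s
      unfolding of_real_prod
      by (intro prod.cong) (auto simp: sg_def \<zeta>_def S_def gauss_sum_0)
    have "2 * (\<Prod>p\<in>S3. real p) \<le> (\<Prod>p\<in>S3. \<alpha> p + real p) - (\<Prod>p\<in>S3. \<alpha> p - real p)"
      using prod_add_minus_prod_diff_ge[of S3 \<alpha> real] fin(2) odd
      by (auto simp: \<alpha>_def)
    moreover have "0 \<le> (\<Prod>p\<in>S1. sqrt (real p) + real p)"
      by (intro prod_nonneg) auto
    ultimately have "(\<Prod>p\<in>S1. sqrt (real p) + real p) * (2 * (\<Prod>p\<in>S3. real p)) \<le>
      (\<Prod>p\<in>S1. sqrt (real p) + real p) * ((\<Prod>p\<in>S3. \<alpha> p + real p) - (\<Prod>p\<in>S3. \<alpha> p - real p))"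
      by (rule mult_left_mono)
    then show ?thesis unfolding G_def prodS 1 3 B_def
      by (simp only: of_real_mult[symmetric] of_real_diff[symmetric] Re_complex_of_real)
         (simp add: algebra_simps)
  qed

  have "2 * B / real M * (real (card A))\<^sup>2 \<le> Re (G 1 \<zeta> - G (-1) \<zeta>) / real M * H \<zeta>"
    unfolding H0 using G0 M by (intro mult_right_mono divide_right_mono) auto
  also have "\<dots> \<le> (\<Sum>\<xi>\<in>?X. Re (G 1 \<xi> - G (-1) \<xi>) / real M * H \<xi>)"
    using \<zeta> finS Re_nonneg M
    by (intro member_le_sum) (auto simp: H_def intro!: mult_nonneg_nonneg divide_nonneg_pos finite_PiE)
  also have "\<dots> = Re ((\<Sum>\<xi>\<in>?X. G 1 \<xi> / of_nat M * of_real (H \<xi>)) - (\<Sum>\<xi>\<in>?X. G (-1) \<xi> / of_nat M * of_real (H \<xi>)))"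
    by (simp add: sum_subtractf[symmetric] left_diff_distrib diff_divide_distrib)
  also have "\<dots> = Re (of_nat (card A) * (F 1 0 - F (-1) 0))"
    unfolding fourier[symmetric] diag by (simp add: right_diff_distrib)
  also have "\<dots> = real (card A) * f" unfolding F0 by simp
  finally have main: "2 * B / real M * (real (card A))\<^sup>2 \<le> real (card A) * f" .
  have cA: "real (card A) > 0" using False fin(3) by (simp add: card_gt_0_iff)
  have main': "real (card A) \<le> real M * f / (2 * B)"
    using main cA B_pos M by (simp add: power2_eq_square field_simps)

  define f' where "f' = (\<Prod>p\<in>S1. sqrt (real p) + 1) * ((3 * real k) ^ k * (\<Prod>p\<in>S3. sqrt (real p)) / sqrt Q)"
  have f'_nonneg: "0 \<le> f'"
    using Q unfolding f'_def
    by (intro mult_nonneg_nonneg divide_nonneg_nonneg prod_nonneg) (auto intro: add_nonneg_nonneg)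
  have "f \<le> (\<Prod>p\<in>S1. sqrt (real p) + 1) * ((3 * real k) ^ k * (\<Prod>p\<in>S3. sqrt (real p)) / sqrt Q)"
    unfolding f_def
  proof (rule mult_left_mono)
    have "2 * real k * sqrt Q \<le> \<alpha> p" if "p \<in> S3" for p
      using S3[OF that] that k by (auto simp: \<alpha>_def intro!: mult_left_mono)
    then have "(\<Prod>p\<in>S3. \<alpha> p + 1) - (\<Prod>p\<in>S3. \<alpha> p - 1) \<le>
        2 * real (card S3) * (\<Prod>p\<in>S3. \<alpha> p + 1) / (2 * real k * sqrt Q)"
      using fin k Q by (intro prod_add_1_minus_prod_diff_1_le) auto
    also have "\<dots> = (\<Prod>p\<in>S3. \<alpha> p + 1) / sqrt Q" using k by (simp add: k_def)
    also have "\<dots> \<le> (\<Prod>p\<in>S3. 3 * real k * sqrt (real p)) / sqrt Q"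
    proof (intro divide_right_mono prod_mono conjI)
      fix p assume p: "p \<in> S3"
      then have "1 \<le> real p" using p0[of p] by (simp add: S_def)
      then have "1 \<le> real k * sqrt (real p)"
        using k mult_mono[of 1 "real k" 1 "sqrt (real p)"] by auto
      then show "\<alpha> p + 1 \<le> 3 * real k * sqrt (real p)" using p by (simp add: \<alpha>_def)
      show "0 \<le> \<alpha> p + 1" by (simp add: \<alpha>_def add_nonneg_nonneg)
    qed (use Q in auto)
    also have "\<dots> = (3 * real k) ^ k * (\<Prod>p\<in>S3. sqrt (real p)) / sqrt Q"
      by (simp add: prod.distrib k_def power_mult_distrib)
    finally show "(\<Prod>p\<in>S3. \<alpha> p + 1) - (\<Prod>p\<in>S3. \<alpha> p - 1) \<le> (3 * real k) ^ k * (\<Prod>p\<in>S3. sqrt (real p)) / sqrt Q" .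
  qed (auto intro!: prod_nonneg add_nonneg_nonneg)
  then have "f / 2 \<le> f'" using f'_nonneg unfolding f'_def by linarith
  then have "real M * (f / 2) / B \<le> real M * f' / B"
    using M B_pos by (intro divide_right_mono mult_left_mono) auto
  then have "real M * f / (2 * B) \<le> real M * f' / B" by simp
  also have "\<dots> = sqrt (real M) * (3 * real k) ^ k / sqrt Q"
  proof -
    have *: "(\<Prod>p\<in>S1. sqrt (real p) + real p) = (\<Prod>p\<in>S1. sqrt (real p)) * (\<Prod>p\<in>S1. sqrt (real p) + 1)"
      unfolding prod.distrib[symmetric] by (intro prod.cong) (auto simp: distrib_left)
    have "real M = (\<Prod>p\<in>S1. real p) * (\<Prod>p\<in>S3. real p)"
      unfolding M_def of_nat_prod using prodS[of real] by simp
    moreover have "(\<Prod>p\<in>S1. real p) = (\<Prod>p\<in>S1. sqrt (real p))\<^sup>2"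
      by (simp add: prod_power_distrib)
    moreover have "sqrt (real M) = (\<Prod>p\<in>S1. sqrt (real p)) * (\<Prod>p\<in>S3. sqrt (real p))"
      unfolding M_def of_nat_prod prodS using fin by (simp add: sqrt_prod real_sqrt_mult)
    moreover have "(\<Prod>p\<in>S1. sqrt (real p)) > 0" "(\<Prod>p\<in>S3. real p) > 0" "(\<Prod>p\<in>S1. sqrt (real p) + 1) > 0"
      using p0 by (auto simp: S_def intro!: prod_pos add_nonneg_pos)
    ultimately show ?thesis unfolding B_def * f'_def by (simp add: field_simps power2_eq_square)
  qed
  finally show ?thesis using main' unfolding M_def S_def k_def by linarith
qed

text \<open>
  Proved from the definition of the additive inverse, so as to include the zero ring \<open>m = 1\<close>.
\<close>

lemma residue_ring_minus:
  assumes "m > 0" "a \<in> carrier (residue_ring (int m))" "b \<in> carrier (residue_ring (int m))"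
  shows "a \<ominus>\<^bsub>residue_ring (int m)\<^esub> b = (a - b) mod int m"
proof -
  let ?R = "residue_ring (int m)"
  have ab: "a \<in> {0..int m - 1}" "b \<in> {0..int m - 1}"
    using assms by (auto simp: residue_ring_def)
  have "a_inv ?R b = (- b) mod int m"
    unfolding a_inv_def m_inv_def
  proof (rule the_equality)
    show "(- b) mod int m \<in> carrier (add_monoid ?R) \<and>
        b \<otimes>\<^bsub>add_monoid ?R\<^esub> ((- b) mod int m) = \<one>\<^bsub>add_monoid ?R\<^esub> \<and>
        ((- b) mod int m) \<otimes>\<^bsub>add_monoid ?R\<^esub> b = \<one>\<^bsub>add_monoid ?R\<^esub>"
      using assms(1) by (auto simp: residue_ring_def mod_simps)
  next
    fix y assume y: "y \<in> carrier (add_monoid ?R) \<and>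
        b \<otimes>\<^bsub>add_monoid ?R\<^esub> y = \<one>\<^bsub>add_monoid ?R\<^esub> \<and>
        y \<otimes>\<^bsub>add_monoid ?R\<^esub> b = \<one>\<^bsub>add_monoid ?R\<^esub>"
    then have "y \<in> {0..int m - 1}" "(b + y) mod int m = 0"
      by (auto simp: residue_ring_def)
    moreover from this have "[y = - b] (mod int m)"
      by (simp add: cong_iff_dvd_diff mod_eq_0_iff_dvd add.commute)
    ultimately show "y = (- b) mod int m"
      by (simp add: unique_euclidean_semiring_class.cong_def)
  qed
  then show ?thesis
    using assms(1) by (simp add: a_minus_def residue_ring_def mod_simps)
qed

lemma square_difference_free_residue:
  assumes m: "m > 0"
    and A: "A \<subseteq> carrier (residue_ring (int m))"
    and free: "difference_set (residue_ring (int m)) A \<inter> squares (residue_ring (int m)) =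
      {\<zero>\<^bsub>residue_ring (int m)\<^esub>}"
    and ab: "a \<in> A" "b \<in> A" and c: "[a - b = c\<^sup>2] (mod int m)"
  shows "a = b"
proof -
  let ?R = "residue_ring (int m)"
  have car: "carrier ?R = {0..int m - 1}" by (simp add: residue_ring_def)
  let ?d = "(a - b) mod int m"
  have "?d \<in> difference_set ?R A"
    unfolding difference_set_def using ab A residue_ring_minus[OF m] by force
  moreover have "?d \<in> squares ?R"
  proof -
    have "?d = (c mod int m) \<otimes>\<^bsub>?R\<^esub> (c mod int m)"
      using c by (simp add: residue_ring_def unique_euclidean_semiring_class.cong_def power2_eq_square mod_simps)
    moreover have "c mod int m \<in> carrier ?R" using m by (simp add: car)
    ultimately show ?thesis unfolding squares_def by blast
  qed
  ultimately have "?d = 0" using free by (auto simp: residue_ring_def)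
  then have "[a = b] (mod int m)" by (simp add: cong_iff_dvd_diff mod_eq_0_iff_dvd)
  moreover have "a \<in> {0..int m - 1}" "b \<in> {0..int m - 1}" using A ab car by auto
  ultimately show "a = b" by (simp add: unique_euclidean_semiring_class.cong_def)
qed

text \<open>
  The Chinese remainder theorem glues the square roots modulo the primes of \<open>S\<close> to the root \<open>0\<close> modulo \<open>r\<close>.
\<close>

lemma square_cong_prod:
  fixes S :: "nat set" and t :: int
  assumes S: "finite S" "\<And>p. p \<in> S \<Longrightarrow> prime p" and r: "r > 0" "coprime r (\<Prod>S)"
    and t: "int r dvd t" "\<And>p. p \<in> S \<Longrightarrow> \<exists>c. [t = c\<^sup>2] (mod int p)"
  shows "\<exists>c. [t = c\<^sup>2] (mod int (r * \<Prod>S))"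
proof -
  have "\<exists>u::nat. [t = (int u)\<^sup>2] (mod int p)" if p: "p \<in> S" for p
  proof -
    obtain c where c: "[t = c\<^sup>2] (mod int p)" using t(2)[OF p] by blast
    have "0 \<le> c mod int p" using S(2)[OF p] prime_gt_0_nat[of p] by simp
    moreover have "[c\<^sup>2 = (c mod int p)\<^sup>2] (mod int p)" by (intro cong_pow) (simp add: unique_euclidean_semiring_class.cong_def)
    ultimately have "[t = (int (nat (c mod int p)))\<^sup>2] (mod int p)"
      using c by (metis cong_trans nat_0_le)
    then show ?thesis by blast
  qed
  then obtain u :: "nat \<Rightarrow> nat" where u: "\<And>p. p \<in> S \<Longrightarrow> [t = (int (u p))\<^sup>2] (mod int p)"
    by metis
  have "\<exists>x. \<forall>i\<in>S. [x = u i] (mod (\<lambda>p. p) i)"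
    using S by (intro chinese_remainder_nat) (auto intro: primes_coprime)
  then obtain x where x: "\<And>p. p \<in> S \<Longrightarrow> [x = u p] (mod p)" by auto
  obtain y where y: "[y = 0] (mod r)" "[y = x] (mod \<Prod>S)"
    using binary_chinese_remainder_nat[OF r(2)] by blast
  have "int r dvd int y" using y(1) by (simp add: cong_0_iff)
  then have 1: "[t = (int y)\<^sup>2] (mod int r)"
    using t(1) by (simp add: cong_iff_dvd_diff power2_eq_square)
  have 2: "[t = (int y)\<^sup>2] (mod int p)" if p: "p \<in> S" for p
  proof -
    have "[y = x] (mod p)" using y(2) dvd_prodI[OF S(1) p, of "\<lambda>p. p"] cong_dvd_modulus_nat by simp
    then have "[y = u p] (mod p)" using x[OF p] cong_trans by blast
    then have "[int y = int (u p)] (mod int p)" by (simp add: cong_int_iff)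
    then show ?thesis using u[OF p] by (meson cong_pow cong_sym cong_trans)
  qed
  have "[t = (int y)\<^sup>2] (mod (\<Prod>p\<in>S. int p))"
    using S 2
    by (intro cong_cong_prod_coprime[where m = int and A = S])
       (auto simp: coprime_int_iff intro: primes_coprime)
  then have "[t = (int y)\<^sup>2] (mod int (\<Prod>S))" by simp
  moreover have "coprime (int r) (int (\<Prod>S))" using r(2) by (simp only: coprime_int_iff)
  ultimately have "[t = (int y)\<^sup>2] (mod (int r * int (\<Prod>S)))"
    using 1 by (intro coprime_cong_mult)
  then show ?thesis by auto
qed

lemma card_square_difference_free_residue_le:
  fixes A :: "int set"
  assumes m: "m = r * \<Prod>(S1 \<union> S3)" "r > 0" "coprime r (\<Prod>(S1 \<union> S3))"
    and A: "A \<subseteq> carrier (residue_ring (int m))"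
    and free: "difference_set (residue_ring (int m)) A \<inter> squares (residue_ring (int m)) =
      {\<zero>\<^bsub>residue_ring (int m)\<^esub>}"
    and fin: "finite S1" "finite S3"
    and S1: "\<And>p. p \<in> S1 \<Longrightarrow> prime p \<and> p mod 4 = 1"
    and S3: "\<And>p. p \<in> S3 \<Longrightarrow> prime p \<and> p mod 4 = 3 \<and> Q \<le> real p"
    and odd: "odd (card S3)" and Q: "Q > 0"
  shows "real (card A) \<le> real r * (sqrt (real (\<Prod>(S1 \<union> S3))) * (3 * real (card S3)) ^ card S3 / sqrt Q)"
proof -
  let ?S = "S1 \<union> S3"
  let ?B = "sqrt (real (\<Prod>?S)) * (3 * real (card S3)) ^ card S3 / sqrt Q"
  have prS: "\<And>p. p \<in> ?S \<Longrightarrow> prime p" using S1 S3 by auto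
  have m0: "m > 0" using m prS prime_gt_0_nat by (auto intro!: prod_pos)
  have finA: "finite A" using A by (rule finite_subset) (simp add: residue_ring_def)
  define C where "C j = {a \<in> A. a mod int r = j}" for j
  have "A = (\<Union>j\<in>{0..<int r}. C j)" using m(2) by (auto simp: C_def)
  then have "card A \<le> (\<Sum>j\<in>{0..<int r}. card (C j))"
    by (metis card_UN_le finite_atLeastLessThan_int)
  then have "real (card A) \<le> (\<Sum>j\<in>{0..<int r}. real (card (C j)))"
    by (simp flip: of_nat_sum)
  also have "\<dots> \<le> (\<Sum>j\<in>{0..<int r}. ?B)"
  proof (rule sum_mono)
    fix j
    show "real (card (C j)) \<le> ?B"
    proof (rule card_square_difference_free_le[OF fin _ S1 S3 odd Q])
      show "finite (C j)" using finA by (simp add: C_def)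
      fix a b assume ab: "a \<in> C j" "b \<in> C j"
        and sq: "\<And>p. p \<in> ?S \<Longrightarrow> \<exists>c. [a - b = c\<^sup>2] (mod int p)"
      have "int r dvd a - b"
        using ab by (simp add: C_def mod_eq_dvd_iff[symmetric])
      then obtain c where "[a - b = c\<^sup>2] (mod int m)"
        using square_cong_prod[of ?S r "a - b"] fin prS m sq by auto
      then show "a = b"
        using ab square_difference_free_residue[OF m0 A free] by (auto simp: C_def)
    qed
  qed
  finally show ?thesis by simp
qed

section \<open>Estimates of Chebyshev and Mertens, also for primes congruent to 3 modulo 4\<close>

abbreviation \<Lambda> :: "nat \<Rightarrow> real" where "\<Lambda> \<equiv> mangoldt"

definition \<psi> :: "nat \<Rightarrow> real" where "\<psi> n = (\<Sum>d\<in>{1..n}. \<Lambda> d)"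

text \<open>
  Both sides run over the pairs \<open>(d, j)\<close> with \<open>d * j \<le> n\<close>.
\<close>

lemma sum_convolution:
  fixes f g :: "nat \<Rightarrow> real"
  shows "(\<Sum>k\<in>{1..n}. \<Sum>d | d dvd k. f d * g (k div d)) = (\<Sum>d\<in>{1..n}. f d * (\<Sum>j\<in>{1..n div d}. g j))"
proof -
  have "(\<Sum>k\<in>{1..n}. \<Sum>d | d dvd k. f d * g (k div d)) =
      (\<Sum>(k, d)\<in>(SIGMA k:{1..n}. {d. d dvd k}). f d * g (k div d))"
    by (rule sum.Sigma) (auto intro!: finite_divisors_nat)
  also have "\<dots> = (\<Sum>(d, j)\<in>(SIGMA d:{1..n}. {1..n div d}). f d * g j)"
  proof (rule sum.reindex_bij_witness[where i = "\<lambda>(d, j). (d * j, d)" and j = "\<lambda>(k, d). (d, k div d)"])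
    fix a assume "a \<in> (SIGMA k:{1..n}. {d. d dvd k})"
    then obtain k d where a: "a = (k, d)" "k \<ge> 1" "k \<le> n" "d dvd k" by auto
    then have d: "d \<ge> 1" "d \<le> n" by (auto intro: Suc_leI Nat.gr0I dest: dvd_imp_le)
    have "k div d \<ge> 1" using a d by (simp add: Suc_leI div_greater_zero_iff dvd_imp_le)
    moreover have "k div d \<le> n div d" using a by (simp add: div_le_mono)
    ultimately show "(case a of (k, d) \<Rightarrow> (d, k div d)) \<in> (SIGMA d:{1..n}. {1..n div d})"
      using a d by auto
    show "(case case a of (k, d) \<Rightarrow> (d, k div d) of (d, j) \<Rightarrow> (d * j, d)) = a" using a by simp
    show "(case case a of (k, d) \<Rightarrow> (d, k div d) of (d, j) \<Rightarrow> f d * g j) = (case a of (k, d) \<Rightarrow> f d * g (k div d))"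
      using a by simp
  next
    fix b assume "b \<in> (SIGMA d:{1..n}. {1..n div d})"
    then obtain d j where b: "b = (d, j)" "d \<ge> 1" "d \<le> n" "j \<ge> 1" "j \<le> n div d" by auto
    have "d * j \<le> n" using b by (metis less_eq_div_iff_mult_less_eq mult.commute less_le_trans zero_less_one)
    then show "(case b of (d, j) \<Rightarrow> (d * j, d)) \<in> (SIGMA k:{1..n}. {d. d dvd k})" using b by auto
    show "(case case b of (d, j) \<Rightarrow> (d * j, d) of (k, d) \<Rightarrow> (d, k div d)) = b" using b by auto
  qed
  also have "\<dots> = (\<Sum>d\<in>{1..n}. f d * (\<Sum>j\<in>{1..n div d}. g j))"
    by (subst sum.Sigma[symmetric]) (auto simp: sum_distrib_left)
  finally show ?thesis .
qed

lemma ln_fact_eq_sum_mangoldt: "ln (fact n) = (\<Sum>d\<in>{1..n}. \<Lambda> d * real (n div d))"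
proof -
  have "ln (fact n) = (\<Sum>k\<in>{1..n}. ln (real k))"
    unfolding fact_prod of_nat_prod by (subst ln_prod) auto
  also have "\<dots> = (\<Sum>k\<in>{1..n}. \<Sum>d | d dvd k. \<Lambda> d * 1)"
    by (intro sum.cong refl) (simp add: mangoldt_sum)
  also have "\<dots> = (\<Sum>d\<in>{1..n}. \<Lambda> d * real (n div d))"
    using sum_convolution[of \<Lambda> "\<lambda>_. 1" n] by simp
  finally show ?thesis .
qed

text \<open>
  The prime powers in \<open>(n/2, n]\<close> are controlled by the central binomial coefficient, which is at most \<open>2^n\<close>;
  halving \<open>n\<close> repeatedly gives the bound.
\<close>

lemma chebyshev_psi_le: "\<psi> n \<le> 4 * real n"
proof (induction n rule: less_induct)
  case (less n)
  show ?case
  proof (cases "n \<le> 1")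
    case True
    then have "n = 0 \<or> n = 1" by auto
    then show ?thesis by (auto simp: \<psi>_def)
  next
    case False
    define m where "m = n div 2"
    have m: "m < n" "n \<le> 2 * m + 1" "2 * m \<le> n" "m \<ge> 1" using False by (auto simp: m_def)
    \<comment> \<open>The coefficient of \<open>\<Lambda> d\<close> in this difference is nonnegative, and it is \<open>1\<close> for \<open>d\<close> in \<open>(m, 2 m]\<close>.\<close>
    have "ln (fact (2 * m) :: real) - 2 * ln (fact m) = ln (real ((2 * m) choose m))"
      by (simp add: binomial_fact[of m "2 * m"] ln_div ln_mult)
    also have "\<dots> \<le> ln (2 ^ (2 * m))"
    proof -
      have "(2 * m) choose m \<le> 2 ^ (2 * m)" by (rule binomial_le_pow2)
      then have "real ((2 * m) choose m) \<le> real (2 ^ (2 * m))" by (simp only: of_nat_le_iff)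
      moreover have "real ((2 * m) choose m) > 0" by simp
      ultimately show ?thesis by (simp only: ln_le_cancel_iff of_nat_power of_nat_numeral zero_less_power zero_less_numeral)
    qed
    also have "\<dots> = 2 * real m * ln 2" by (simp add: ln_realpow)
    finally have up: "ln (fact (2 * m) :: real) - 2 * ln (fact m) \<le> 2 * real m * ln 2" .
    have "ln (fact m :: real) = (\<Sum>d\<in>{1..2*m}. \<Lambda> d * real (m div d))"
      unfolding ln_fact_eq_sum_mangoldt by (rule sum.mono_neutral_left) auto
    then have "ln (fact (2 * m) :: real) - 2 * ln (fact m) =
        (\<Sum>d\<in>{1..2*m}. \<Lambda> d * (real (2 * m div d) - 2 * real (m div d)))"
      unfolding ln_fact_eq_sum_mangoldt[of "2*m"]
      by (simp add: sum_distrib_left sum_subtractf[symmetric] algebra_simps)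
    also have "\<dots> \<ge> (\<Sum>d\<in>{m<..2*m}. \<Lambda> d)"
    proof -
      have "(\<Sum>d\<in>{m<..2*m}. \<Lambda> d) = (\<Sum>d\<in>{m<..2*m}. \<Lambda> d * (real (2 * m div d) - 2 * real (m div d)))"
      proof (intro sum.cong refl)
        fix d assume d: "d \<in> {m<..2*m}"
        then have "m div d = 0" "2 * m div d = 1" by (auto simp: div_nat_eqI)
        then show "\<Lambda> d = \<Lambda> d * (real (2 * m div d) - 2 * real (m div d))" by simp
      qed
      also have "\<dots> \<le> (\<Sum>d\<in>{1..2*m}. \<Lambda> d * (real (2 * m div d) - 2 * real (m div d)))"
      proof (rule sum_mono2)
        fix d
        have "2 * (m div d) \<le> 2 * m div d"
          by (metis mult.commute div_mult1_eq add.commute le_add1 mult_2 mult_2_right div_add1_eq)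
        then have "2 * real (m div d) \<le> real (2 * m div d)" by linarith
        then show "0 \<le> \<Lambda> d * (real (2 * m div d) - 2 * real (m div d))"
          by (intro mult_nonneg_nonneg mangoldt_nonneg) auto
      qed auto
      finally show ?thesis .
    qed
    finally have a: "(\<Sum>d\<in>{m<..2*m}. \<Lambda> d) \<le> 2 * real m * ln 2" using up by linarith
    have "\<psi> n \<le> \<psi> (2 * m + 1)"
      unfolding \<psi>_def using m by (intro sum_mono2) (auto intro: mangoldt_nonneg)
    also have "\<psi> (2 * m + 1) = \<psi> (2 * m) + \<Lambda> (2 * m + 1)" by (simp add: \<psi>_def)
    also have "\<psi> (2 * m) = \<psi> m + (\<Sum>d\<in>{m<..2*m}. \<Lambda> d)"
      unfolding \<psi>_def by (subst sum.union_disjoint[symmetric]) (auto intro!: sum.cong)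
    also have "\<Lambda> (2 * m + 1) \<le> ln (real (2 * m + 1))" by (intro mangoldt_le) auto
    also have "ln (real (2 * m + 1)) \<le> real (2 * m + 1) - 1" by (intro ln_le_minus_one) auto
    also have "\<psi> m \<le> 4 * real m" using less m by auto
    finally have "\<psi> n \<le> 4 * real m + 2 * real m * ln 2 + 2 * real m" using a by simp
    also have "\<dots> \<le> 4 * real m + 2 * real m * 1 + 2 * real m"
      using ln_2_less_1 by (intro add_mono mult_left_mono) auto
    also have "\<dots> = 4 * real (2 * m)" by simp
    also have "\<dots> \<le> 4 * real n" using m by linarith
    finally show ?thesis .
  qed
qed

lemma ln_fact_le: "ln (fact n) \<le> real n * ln (real n)"
proof (cases "n = 0")
  case False
  have "(fact n :: real) \<le> real n ^ n" using fact_le_power[of n, where ?'a = real] by simp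
  then have "ln (fact n :: real) \<le> ln (real n ^ n)"
    using False by (subst ln_le_cancel_iff) auto
  also have "\<dots> = real n * ln (real n)" using False by (simp add: ln_realpow)
  finally show ?thesis .
qed simp

lemma ln_Suc_diff_le:
  assumes "n > 0"
  shows "ln (real (Suc n)) - ln (real n) \<le> 1 / real n"
proof -
  have "ln (real (Suc n)) - ln (real n) = ln (real (Suc n) / real n)"
    using assms by (subst ln_div) auto
  also have "\<dots> \<le> real (Suc n) / real n - 1" using assms by (intro ln_le_minus_one) auto
  also have "\<dots> = 1 / real n" using assms by (simp add: field_simps)
  finally show ?thesis .
qed

lemma ln_fact_ge: "real n * ln (real n) - real n \<le> ln (fact n)"
proof (induction n)
  case (Suc n)
  have "real n * (ln (real (Suc n)) - ln (real n)) \<le> 1"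
  proof (cases "n = 0")
    case False
    then have "ln (real (Suc n)) - ln (real n) \<le> 1 / real n" by (intro ln_Suc_diff_le) auto
    then show ?thesis using False by (simp add: field_simps)
  qed simp
  moreover have "ln (fact (Suc n) :: real) = ln (real (Suc n)) + ln (fact n)"
    by (subst fact_Suc, subst ln_mult) auto
  ultimately show ?case using Suc by (simp add: algebra_simps)
qed simp

text \<open>
  Replacing \<open>n div d\<close> by \<open>n / d\<close> in the formula for \<open>ln (fact n)\<close> costs at most \<open>\<psi> n\<close>, which is \<open>O(n)\<close>.
\<close>

lemma mertens_mangoldt:
  assumes "n \<ge> 1"
  shows "ln (real n) - 1 \<le> (\<Sum>d\<in>{1..n}. \<Lambda> d / real d)"
    and "(\<Sum>d\<in>{1..n}. \<Lambda> d / real d) \<le> ln (real n) + 4"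
proof -
  have n: "real n > 0" using assms by simp
  have "real n * ln (real n) - real n \<le> (\<Sum>d\<in>{1..n}. \<Lambda> d * real (n div d))"
    using ln_fact_ge[of n] ln_fact_eq_sum_mangoldt[of n] by simp
  also have "\<dots> \<le> (\<Sum>d\<in>{1..n}. \<Lambda> d * (real n / real d))"
    by (intro sum_mono mult_left_mono mangoldt_nonneg of_nat_div_le_of_nat)
  also have "\<dots> = real n * (\<Sum>d\<in>{1..n}. \<Lambda> d / real d)"
    unfolding sum_distrib_left by (intro sum.cong) auto
  finally have "real n * (ln (real n) - 1) \<le> real n * (\<Sum>d\<in>{1..n}. \<Lambda> d / real d)"
    by (simp add: algebra_simps)
  then show "ln (real n) - 1 \<le> (\<Sum>d\<in>{1..n}. \<Lambda> d / real d)"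
    using n by (simp only: mult_le_cancel_left_pos)
  have "real n * (\<Sum>d\<in>{1..n}. \<Lambda> d / real d) = (\<Sum>d\<in>{1..n}. \<Lambda> d * (real n / real d))"
    unfolding sum_distrib_left by (intro sum.cong) auto
  also have "\<dots> \<le> (\<Sum>d\<in>{1..n}. \<Lambda> d * (real (n div d) + 1))"
  proof (intro sum_mono mult_left_mono mangoldt_nonneg)
    fix d assume "d \<in> {1..n}"
    then have "n < d * Suc (n div d)" using dividend_less_times_div[of d n] by simp
    then have "real n \<le> real d * real (Suc (n div d))" by (metis less_imp_le of_nat_le_iff of_nat_mult)
    then show "real n / real d \<le> real (n div d) + 1"
      using \<open>d \<in> {1..n}\<close> by (simp add: field_simps)
  qed
  also have "\<dots> = ln (fact n) + \<psi> n"
    by (simp add: ln_fact_eq_sum_mangoldt distrib_left sum.distrib \<psi>_def)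
  also have "\<dots> \<le> real n * ln (real n) + 4 * real n"
    by (intro add_mono ln_fact_le chebyshev_psi_le)
  finally have "real n * (\<Sum>d\<in>{1..n}. \<Lambda> d / real d) \<le> real n * (ln (real n) + 4)"
    by (simp add: algebra_simps)
  then show "(\<Sum>d\<in>{1..n}. \<Lambda> d / real d) \<le> ln (real n) + 4"
    using n by (simp only: mult_le_cancel_left_pos)
qed

text \<open>
  The nonprincipal Dirichlet character modulo 4.
\<close>

definition chi4 :: "nat \<Rightarrow> real" where
  "chi4 n = (if n mod 4 = 1 then 1 else if n mod 4 = 3 then - 1 else 0)"

lemma chi4_mod: "chi4 (n mod 4) = chi4 n"
  by (simp add: chi4_def)

lemma chi4_mult: "chi4 (a * b) = chi4 a * chi4 b"
proof -
  have "a mod 4 \<in> {0,1,2,3}" "b mod 4 \<in> {0,1,2,3}" by auto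
  then have "chi4 ((a mod 4) * (b mod 4)) = chi4 (a mod 4) * chi4 (b mod 4)"
    by (elim insertE emptyE) (simp_all add: chi4_def)
  then show ?thesis
    by (metis chi4_mod mod_mult_eq)
qed

lemma sum_chi4_bounds: "(\<Sum>k\<in>{1..n}. chi4 k) = (if n mod 4 = 1 \<or> n mod 4 = 2 then 1 else 0)"
proof (induction n)
  case (Suc n)
  have "n mod 4 \<in> {0,1,2,3}" by auto
  then show ?case using Suc by (auto simp: chi4_def mod_Suc)
qed simp

text \<open>
  Partial summation: the partial sums of \<open>chi4\<close> over an interval lie in \<open>{-1, 0, 1}\<close>.
\<close>

lemma abs_sum_chi4_antimono_le:
  fixes a :: "nat \<Rightarrow> real"
  assumes anti: "\<And>i. M < i \<Longrightarrow> a (Suc i) \<le> a i" and nn: "\<And>i. 0 \<le> a i"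
  shows "\<bar>\<Sum>k\<in>{M<..N}. chi4 k * a k\<bar> \<le> a (Suc M)"
proof (cases "M < N")
  case True
  define t where "t n = (\<Sum>k\<in>{M<..n}. chi4 k)" for n
  have t1: "\<bar>t n\<bar> \<le> 1" if "M < n" for n
  proof -
    have "(\<Sum>k\<in>{1..n}. chi4 k) = (\<Sum>k\<in>{1..M}. chi4 k) + t n"
      unfolding t_def using that by (subst sum.union_disjoint[symmetric]) (auto intro!: sum.cong)
    then show ?thesis unfolding sum_chi4_bounds by (auto split: if_splits)
  qed
  have "\<bar>(\<Sum>k\<in>{M<..N}. chi4 k * a k) - t N * a N\<bar> \<le> a (Suc M) - a N"
    using Suc_leI[OF True]
  proof (induction N rule: nat_induct_at_least)
    case base
    have "{M<..Suc M} = {Suc M}" by auto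
    then show ?case by (simp add: t_def)
  next
    case (Suc n)
    have ins: "{M<..Suc n} = insert (Suc n) {M<..n}" using Suc by auto
    have "(\<Sum>k\<in>{M<..Suc n}. chi4 k * a k) - t (Suc n) * a (Suc n) =
        ((\<Sum>k\<in>{M<..n}. chi4 k * a k) - t n * a n) + t n * (a n - a (Suc n))"
      unfolding t_def ins by (simp add: algebra_simps)
    moreover have "\<bar>t n * (a n - a (Suc n))\<bar> \<le> a n - a (Suc n)"
      using t1[of n] anti[of n] Suc by (simp add: abs_mult mult_left_le_one_le)
    ultimately show ?case using Suc.IH by linarith
  qed
  moreover have "\<bar>t N * a N\<bar> \<le> a N"
    using t1[OF True] nn[of N] by (simp add: abs_mult mult_left_le_one_le)
  ultimately show ?thesis by linarith
qed (use nn in simp)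

text \<open>
  Primes are equidistributed between the classes \<open>1\<close> and \<open>3\<close> modulo \<open>4\<close> on the scale of Mertens' theorem.
  With \<open>A n\<close> the partial sums of \<open>chi4 k / k\<close>, the bounded sum of \<open>chi4 k * ln k / k\<close> is the sum over \<open>d\<close> of
  \<open>chi4 d * \<Lambda> d / d * A (N div d)\<close>. Replacing \<open>A (N div d)\<close> by \<open>A N\<close> costs \<open>O(d / N)\<close>, in total \<open>\<psi> N / N\<close>,
  and \<open>A N \<ge> 1/2\<close> can be divided out; this is the nonvanishing of the L-function at \<open>1\<close> in finite form.
\<close>

lemma abs_sum_chi4_mangoldt_le:
  assumes N: "N \<ge> 1"
  shows "\<bar>\<Sum>d\<in>{1..N}. chi4 d * \<Lambda> d / real d\<bar> \<le> 10"
proof -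
  define A where "A n = (\<Sum>k\<in>{1..n}. chi4 k / real k)" for n
  define B where "B = (\<Sum>k\<in>{1..N}. chi4 k / real k * ln (real k))"
  have split: "(\<Sum>k\<in>{1..N}. f k) = (\<Sum>k\<in>{1..n}. f k) + (\<Sum>k\<in>{n<..N}. f k)"
    if "n \<le> N" for f :: "nat \<Rightarrow> real" and n
    using that by (subst sum.union_disjoint[symmetric]) (auto intro!: sum.cong)
  have Adiff: "\<bar>A N - A n\<bar> \<le> 1 / real (Suc n)" if "n \<le> N" for n
  proof -
    have "A N - A n = (\<Sum>k\<in>{n<..N}. chi4 k * (1 / real k))"
      using split[OF that, of "\<lambda>k. chi4 k / real k"] by (simp add: A_def)
    then show ?thesis
      using abs_sum_chi4_antimono_le[of n "\<lambda>k. 1 / real k" N] by (simp add: frac_le)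
  qed
  have "A 1 = 1" by (simp add: A_def chi4_def)
  moreover have "\<bar>A N - A 1\<bar> \<le> 1 / 2" using Adiff[OF N] by simp
  ultimately have A: "A N \<ge> 1 / 2" by linarith
  have B: "\<bar>B\<bar> \<le> 1"
  proof (cases "N \<le> 2")
    case True
    then have "N = 1 \<or> N = Suc 1" using N by auto
    then show ?thesis by (elim disjE) (simp_all add: B_def chi4_def)
  next
    case False
    \<comment> \<open>This function decreases from \<open>3\<close> on, while the terms up to \<open>2\<close> vanish.\<close>
    let ?a = "\<lambda>k. ln (real k) / real k"
    have e: "1 \<le> ln (3::real)"
      using exp_le ln_ge_iff[of "3::real" 1] by simp
    have "\<bar>\<Sum>k\<in>{2<..N}. chi4 k * ?a k\<bar> \<le> ?a (Suc 2)"
    proof (rule abs_sum_chi4_antimono_le)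
      fix i :: nat assume i: "2 < i"
      have "ln (real (Suc i)) - ln (real i) \<le> 1 / real i"
        using i by (intro ln_Suc_diff_le) auto
      then have "real i * (ln (real (Suc i)) - ln (real i)) \<le> 1"
        using i by (simp add: field_simps)
      also have "1 \<le> ln (real i)" using e i ln_le_cancel_iff[of 3 "real i"] by linarith
      finally have "real i * ln (real (Suc i)) \<le> real (Suc i) * ln (real i)"
        by (simp add: algebra_simps)
      then show "?a (Suc i) \<le> ?a i" using i by (simp add: field_simps)
    next
      fix i :: nat show "0 \<le> ?a i" by (cases "i = 0") auto
    qed
    moreover have "(\<Sum>k\<in>{2<..N}. chi4 k * ?a k) = (\<Sum>k\<in>{2<..N}. chi4 k / real k * ln (real k))"
      by (intro sum.cong) auto
    moreover have "B = (\<Sum>k\<in>{1..2}. chi4 k / real k * ln (real k)) + (\<Sum>k\<in>{2<..N}. chi4 k / real k * ln (real k))"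
      unfolding B_def using False by (intro split) auto
    moreover have "(\<Sum>k\<in>{1..2}. chi4 k / real k * ln (real k)) = 0"
      by (simp add: chi4_def numeral_2_eq_2)
    moreover have "?a (Suc 2) \<le> 1" using ln_le_minus_one[of "3::real"] by simp
    ultimately show ?thesis by linarith
  qed
  let ?f = "\<lambda>d. chi4 d * \<Lambda> d / real d"
  have "B = (\<Sum>k\<in>{1..N}. \<Sum>d | d dvd k. ?f d * (chi4 (k div d) / real (k div d)))"
    unfolding B_def
  proof (intro sum.cong refl)
    fix k assume k: "k \<in> {1..N}"
    have "chi4 k / real k * ln (real k) = (\<Sum>d | d dvd k. chi4 k / real k * \<Lambda> d)"
      unfolding sum_distrib_left[symmetric] using k by (simp add: mangoldt_sum)
    also have "\<dots> = (\<Sum>d | d dvd k. ?f d * (chi4 (k div d) / real (k div d)))"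
    proof (intro sum.cong refl)
      fix d assume "d \<in> {d. d dvd k}"
      then obtain j where j: "k = d * j" by auto
      then have "d > 0" "j > 0" using k by auto
      then show "chi4 k / real k * \<Lambda> d = ?f d * (chi4 (k div d) / real (k div d))"
        by (simp add: j chi4_mult)
    qed
    finally show "chi4 k / real k * ln (real k) = (\<Sum>d | d dvd k. ?f d * (chi4 (k div d) / real (k div d)))" .
  qed
  then have "B = (\<Sum>d\<in>{1..N}. ?f d * A (N div d))"
    by (simp only: sum_convolution[of ?f "\<lambda>j. chi4 j / real j"] A_def)
  then have "A N * (\<Sum>d\<in>{1..N}. ?f d) - B = (\<Sum>d\<in>{1..N}. ?f d * (A N - A (N div d)))"
    unfolding sum_distrib_left
    by (simp add: sum_subtractf[symmetric] diff_divide_distrib algebra_simps)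
  also have "\<bar>\<dots>\<bar> \<le> (\<Sum>d\<in>{1..N}. \<Lambda> d * (1 / real N))"
  proof (rule order_trans[OF sum_abs], rule sum_mono)
    fix d assume d: "d \<in> {1..N}"
    have abs_chi_le: "\<bar>chi4 d\<bar> \<le> 1" by (auto simp: chi4_def)
    have "\<bar>A N - A (N div d)\<bar> \<le> 1 / real (Suc (N div d))" by (intro Adiff div_le_dividend)
    also have "\<dots> \<le> real d / real N"
    proof -
      have "N \<le> d * Suc (N div d)" using d
        by (metis atLeastAtMost_iff dividend_less_times_div less_imp_le mult_Suc_right less_le_trans zero_less_one add.commute)
      then have "real N \<le> real d * real (Suc (N div d))" by (metis of_nat_le_iff of_nat_mult)
      then show ?thesis using N by (simp add: field_simps del: of_nat_Suc)
    qed
    finally have "\<bar>?f d * (A N - A (N div d))\<bar> \<le> (1 * \<Lambda> d / real d) * (real d / real N)"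
      unfolding abs_mult using abs_chi_le d mult_right_mono[OF abs_chi_le mangoldt_nonneg[of d]]
      by (intro mult_mono) (auto simp: abs_mult mangoldt_nonneg intro!: divide_right_mono)
    then show "\<bar>?f d * (A N - A (N div d))\<bar> \<le> \<Lambda> d * (1 / real N)" using d by simp
  qed
  also have "\<dots> = \<psi> N / real N" by (simp add: \<psi>_def sum_divide_distrib)
  also have "\<dots> \<le> 4" using chebyshev_psi_le[of N] N by (simp add: field_simps)
  finally have "\<bar>A N * (\<Sum>d\<in>{1..N}. ?f d)\<bar> \<le> 5" using B by linarith
  then have "A N * \<bar>\<Sum>d\<in>{1..N}. ?f d\<bar> \<le> 5" using A by (simp add: abs_mult)
  moreover have "1 / 2 * \<bar>\<Sum>d\<in>{1..N}. ?f d\<bar> \<le> A N * \<bar>\<Sum>d\<in>{1..N}. ?f d\<bar>"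
    using A by (intro mult_right_mono) auto
  ultimately show ?thesis by linarith
qed

lemma sum_power_from_2_le:
  fixes x :: real
  assumes x: "0 \<le> x" "x \<le> 1 / 2"
  shows "(\<Sum>k\<in>{2..n}. x ^ k) \<le> 2 * x\<^sup>2"
proof (cases "2 \<le> n")
  case True
  then have "(\<Sum>k\<in>{2..n}. x ^ k) + x ^ n \<le> 2 * x\<^sup>2"
  proof (induction n rule: nat_induct_at_least)
    case (Suc m)
    have "2 * x * x ^ m \<le> 1 * x ^ m" using x by (intro mult_right_mono) auto
    then have "2 * x ^ Suc m \<le> x ^ m" by simp
    moreover have "(\<Sum>k\<in>{2..Suc m}. x ^ k) = (\<Sum>k\<in>{2..m}. x ^ k) + x ^ Suc m"
      using Suc.hyps by (simp add: sum.cl_ivl_Suc)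
    ultimately show ?case using Suc.IH by linarith
  qed simp
  moreover have "0 \<le> x ^ n" using x by simp
  ultimately show ?thesis by linarith
qed (use x in auto)

text \<open>
  The proper prime powers contribute a convergent series, which lets sums over \<open>\<Lambda>\<close> be read as sums over primes.
\<close>

lemma sum_mangoldt_nonprime_le:
  "\<exists>C. \<forall>n. (\<Sum>d | d \<in> {1..n} \<and> \<not> prime d. \<Lambda> d / real d) \<le> C"
proof (intro exI allI)
  fix n
  let ?D = "{d::nat. d \<in> {1..n} \<and> \<not> prime d}"
  let ?P = "{p::nat. p \<in> {1..n} \<and> prime p}"
  let ?I = "?P \<times> {2..n}"
  have "(\<Sum>d\<in>?D. \<Lambda> d / real d) = (\<Sum>d\<in>{d \<in> ?D. primepow d}. \<Lambda> d / real d)"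
    by (rule sum.mono_neutral_right) (auto simp: mangoldt_def)
  also have "\<dots> \<le> (\<Sum>d\<in>(\<lambda>(p, k). p ^ k) ` ?I. \<Lambda> d / real d)"
  proof (rule sum_mono2)
    show "{d \<in> ?D. primepow d} \<subseteq> (\<lambda>(p, k). p ^ k) ` ?I"
    proof
      fix d assume d: "d \<in> {d \<in> ?D. primepow d}"
      then obtain p k where pk: "prime p" "k > 0" "d = p ^ k" by (auto simp: primepow_def)
      have "k \<noteq> 1" using d pk by auto
      then have k: "k \<ge> 2" using pk by auto
      have "p \<le> p ^ k" using pk prime_gt_0_nat[of p] by (simp add: self_le_power)
      moreover have "k < p ^ k" using prime_gt_1_nat[OF pk(1)] by (simp add: power_gt_expt)
      ultimately have "(p, k) \<in> ?I" using d pk k prime_gt_0_nat[of p] by auto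
      then show "d \<in> (\<lambda>(p, k). p ^ k) ` ?I" using pk by force
    qed
  qed (auto simp: mangoldt_nonneg)
  also have "\<dots> \<le> (\<Sum>(p, k)\<in>?I. \<Lambda> (p ^ k) / real (p ^ k))"
    by (rule order_trans[OF sum_image_le]) (auto simp: mangoldt_nonneg o_def case_prod_beta)
  also have "\<dots> = (\<Sum>p\<in>?P. \<Sum>k\<in>{2..n}. ln (real p) * (1 / real p) ^ k)"
    by (subst sum.cartesian_product[symmetric]) (auto intro!: sum.cong simp: power_one_over field_simps)
  also have "\<dots> \<le> (\<Sum>p\<in>?P. 4 * real p powr (- 3/2))"
  proof (rule sum_mono)
    fix p assume p: "p \<in> ?P"
    then have p2: "real p \<ge> 2" using prime_ge_2_nat[of p] by auto
    let ?x = "1 / real p"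
    have x: "0 < ?x" "?x \<le> 1 / 2" using p2 by (auto simp: field_simps)
    have geo: "(\<Sum>k\<in>{2..n}. ?x ^ k) \<le> 2 * ?x ^ 2"
      using x by (intro sum_power_from_2_le) auto
    have "ln (real p) = 2 * ln (sqrt (real p))" using p2 by (simp add: ln_sqrt)
    also have "\<dots> \<le> 2 * sqrt (real p)"
      using ln_le_minus_one[of "sqrt (real p)"] p2 by simp
    finally have ln: "ln (real p) \<le> 2 * sqrt (real p)" .
    have "(\<Sum>k\<in>{2..n}. ln (real p) * ?x ^ k) = ln (real p) * (\<Sum>k\<in>{2..n}. ?x ^ k)"
      by (simp add: sum_distrib_left)
    also have "\<dots> \<le> (2 * sqrt (real p)) * (2 * ?x ^ 2)"
      using ln geo p2 by (intro mult_mono) (auto intro: sum_nonneg)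
    also have "\<dots> = 4 * (real p powr (1/2) * real p powr (-2))"
      using p2 by (simp add: powr_half_sqrt powr_minus power_one_over field_simps)
    also have "real p powr (1/2) * real p powr (-2) = real p powr (- 3/2)"
      by (simp flip: powr_add)
    finally show "(\<Sum>k\<in>{2..n}. ln (real p) * ?x ^ k) \<le> 4 * real p powr (- 3/2)" .
  qed
  also have "\<dots> \<le> (\<Sum>p. 4 * real p powr (- 3/2))"
    by (intro sum_le_suminf summable_mult) (auto simp: summable_real_powr_iff)
  finally show "(\<Sum>d\<in>?D. \<Lambda> d / real d) \<le> (\<Sum>p. 4 * real p powr (- 3/2))" .
qed

lemma sum_nat_interval_diff:
  fixes f :: "nat \<Rightarrow> real"
  assumes "y \<le> z"
  shows "(\<Sum>d | d \<in> {y<..z} \<and> P d. f d) = (\<Sum>d | d \<in> {1..z} \<and> P d. f d) - (\<Sum>d | d \<in> {1..y} \<and> P d. f d)"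
proof -
  have "{d. d \<in> {1..z} \<and> P d} = {d. d \<in> {1..y} \<and> P d} \<union> {d. d \<in> {y<..z} \<and> P d}"
    using assms by auto
  then have "(\<Sum>d | d \<in> {1..z} \<and> P d. f d) = (\<Sum>d | d \<in> {1..y} \<and> P d. f d) + (\<Sum>d | d \<in> {y<..z} \<and> P d. f d)"
    by (simp only:) (rule sum.union_disjoint, auto)
  then show ?thesis by simp
qed

lemma sum_nat_interval_diff_all:
  fixes f :: "nat \<Rightarrow> real"
  assumes "y \<le> z"
  shows "(\<Sum>d\<in>{y<..z}. f d) = (\<Sum>d\<in>{1..z}. f d) - (\<Sum>d\<in>{1..y}. f d)"
  using sum_nat_interval_diff[OF assms, of f "\<lambda>_. True"] by (simp only: simp_thms Collect_mem_eq)

text \<open>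
  Pointwise, \<open>\<Lambda> d\<close> is at most \<open>chi4 d * \<Lambda> d\<close> plus twice its part on the primes congruent to \<open>3\<close>, up to the
  prime \<open>2\<close> and the proper prime powers. Summing leaves half of Mertens' main term for these primes.
\<close>

lemma sum_ln_prime_3mod4_ge:
  "\<exists>C. \<forall>y z. 1 \<le> y \<longrightarrow> y \<le> z \<longrightarrow>
     (ln (real z) - ln (real y)) / 2 - C \<le> (\<Sum>p | p \<in> {y<..z} \<and> prime p \<and> p mod 4 = 3. ln (real p) / real p)"
proof -
  obtain C where C: "\<And>n. (\<Sum>d | d \<in> {1..n} \<and> \<not> prime d. \<Lambda> d / real d) \<le> C"
    using sum_mangoldt_nonprime_le by blast
  show ?thesis
  proof (rule exI[of _ "2 * C + 14"], intro allI impI)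
    fix y z :: nat assume yz: "1 \<le> y" "y \<le> z"
    let ?f = "\<lambda>d. \<Lambda> d / real d"
    let ?s = "\<lambda>P. \<Sum>d | d \<in> {y<..z} \<and> P d. ?f d"
    have nn: "0 \<le> ?f d" for d by (simp add: mangoldt_nonneg)
    have all: "(\<Sum>d\<in>{y<..z}. ?f d) \<ge> ln (real z) - ln (real y) - 5"
      using mertens_mangoldt(1)[of z] mertens_mangoldt(2)[of y] yz
      by (simp add: sum_nat_interval_diff_all)
    have np: "?s (\<lambda>d. \<not> prime d) \<le> C"
      unfolding sum_nat_interval_diff[OF yz(2)]
      using C[of z] sum_nonneg[of "{d. d \<in> {1..y} \<and> \<not> prime d}" ?f, OF nn] by linarith
    have chi: "(\<Sum>d\<in>{y<..z}. chi4 d * ?f d) \<le> 20"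
      using abs_sum_chi4_mangoldt_le[of z] abs_sum_chi4_mangoldt_le[of y] yz
        sum_nat_interval_diff_all[OF yz(2), of "\<lambda>d. chi4 d * ?f d"]
      by (simp add: abs_le_iff)
    have filter: "(\<Sum>d\<in>{y<..z}. ?f d * of_bool (P d)) = ?s P" for P
      by (rule sum.mono_neutral_cong_right) auto
    have "?f d \<le> chi4 d * ?f d + 2 * (?f d * of_bool (prime d \<and> d mod 4 = 3)) +
        2 * (?f d * of_bool (\<not> prime d)) + (if d = 2 then 1 else 0)" for d
    proof (cases "prime d")
      case True
      have "d mod 4 \<in> {0,1,2,3}" by auto
      moreover have "d mod 4 = 0 \<or> d mod 4 = 2 \<Longrightarrow> d = 2"
      proof -
        assume "d mod 4 = 0 \<or> d mod 4 = 2"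
        then have "even d" by presburger
        then show "d = 2" using True primes_dvd_imp_eq two_is_prime_nat by blast
      qed
      moreover have "?f 2 \<le> 1" using ln_2_less_1 by simp
      ultimately show ?thesis using True nn[of d] by (auto simp: chi4_def)
    next
      case False
      have "chi4 d \<ge> -1" by (auto simp: chi4_def)
      then have "- ?f d \<le> chi4 d * ?f d" using mult_right_mono[OF _ nn[of d]] by fastforce
      moreover have "d \<noteq> 2" using False by auto
      ultimately show ?thesis using False by simp
    qed
    then have "(\<Sum>d\<in>{y<..z}. ?f d) \<le> (\<Sum>d\<in>{y<..z}. chi4 d * ?f d + 2 * (?f d * of_bool (prime d \<and> d mod 4 = 3)) +
        2 * (?f d * of_bool (\<not> prime d)) + (if d = 2 then 1 else 0))"
      by (intro sum_mono)
    also have "\<dots> = (\<Sum>d\<in>{y<..z}. chi4 d * ?f d) + 2 * ?s (\<lambda>d. prime d \<and> d mod 4 = 3) +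
        2 * ?s (\<lambda>d. \<not> prime d) + (\<Sum>d\<in>{y<..z}. if d = 2 then 1 else 0)"
      by (simp only: sum.distrib sum_distrib_left[symmetric] filter)
    also have "(\<Sum>d\<in>{y<..z}. if d = 2 then 1 else 0) \<le> (1 :: real)" by simp
    finally have F: "(\<Sum>d\<in>{y<..z}. ?f d) \<le> (\<Sum>d\<in>{y<..z}. chi4 d * ?f d) +
        2 * ?s (\<lambda>d. prime d \<and> d mod 4 = 3) + 2 * ?s (\<lambda>d. \<not> prime d) + 1"
      by simp
    have "0 \<le> C" using C[of 0] by simp
    then have "(ln (real z) - ln (real y)) / 2 - (2 * C + 14) \<le> r"
      if "?s (\<lambda>d. prime d \<and> d mod 4 = 3) = r" for r
      using F[unfolded that] all np chi by argo
    moreover have "?s (\<lambda>d. prime d \<and> d mod 4 = 3) =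
        (\<Sum>p | p \<in> {y<..z} \<and> prime p \<and> p mod 4 = 3. ln (real p) / real p)"
      by (intro sum.cong) auto
    ultimately show "(ln (real z) - ln (real y)) / 2 - (2 * C + 14) \<le>
        (\<Sum>p | p \<in> {y<..z} \<and> prime p \<and> p mod 4 = 3. ln (real p) / real p)"
      by blast
  qed
qed

lemma sum_ln_prime_le:
  assumes "1 \<le> y" "y \<le> z"
  shows "(\<Sum>p | p \<in> {y<..z} \<and> prime p. ln (real p) / real p) \<le> ln (real z) - ln (real y) + 5"
proof -
  have "(\<Sum>p | p \<in> {y<..z} \<and> prime p. ln (real p) / real p) = (\<Sum>p | p \<in> {y<..z} \<and> prime p. \<Lambda> p / real p)"
    by (intro sum.cong) auto
  also have "\<dots> \<le> (\<Sum>d\<in>{y<..z}. \<Lambda> d / real d)"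
    by (intro sum_mono2) (auto simp: mangoldt_nonneg)
  also have "\<dots> \<le> ln (real z) - ln (real y) + 5"
    unfolding sum_nat_interval_diff_all[OF assms(2)]
    using mertens_mangoldt(2)[of z] mertens_mangoldt(1)[of y] assms by simp
  finally show ?thesis .
qed

lemma sum_ln_prime_le_1:
  assumes "1 \<le> z"
  shows "(\<Sum>p | p \<in> {1..z} \<and> prime p. ln (real p) / real p) \<le> ln (real z) + 5"
proof -
  have "{p. p \<in> {1..z} \<and> prime p} = {p. p \<in> {1<..z} \<and> prime p}"
    by (intro Collect_cong) (auto dest: prime_gt_1_nat)
  then show ?thesis using sum_ln_prime_le[of 1 z] assms by simp
qed

text \<open>
  Partial summation against \<open>1 / ln n\<close>, done by induction on \<open>z\<close>: with \<open>S z\<close> and \<open>T z\<close> the sums of \<open>ln p / p\<close>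
  and \<open>1 / p\<close> over the primes in \<open>(y, z]\<close>, the increment of \<open>T z - S z / ln z\<close> is at most the increment of \<open>ln (ln z)\<close> plus a telescoping term.
\<close>

lemma sum_inverse_prime_le:
  assumes "2 \<le> y" "y \<le> z"
  shows "(\<Sum>p | p \<in> {y<..z} \<and> prime p. 1 / real p) \<le> ln (ln (real z)) - ln (ln (real y)) + 11"
proof -
  define S where "S n = (\<Sum>p | p \<in> {y<..n} \<and> prime p. ln (real p) / real p)" for n
  define T where "T n = (\<Sum>p | p \<in> {y<..n} \<and> prime p. 1 / real p)" for n
  have lny: "ln (real y) \<ge> 1 / 2"
  proof -
    have "1 / 2 \<le> ln (2::real)" using ln_le_minus_one[of "1 / 2 :: real"] by (simp add: ln_div)
    also have "\<dots> \<le> ln (real y)" using assms by simp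
    finally show ?thesis .
  qed
  have "T z - S z / ln (real z) \<le> ln (ln (real z)) - ln (ln (real y)) + 5 * (1 / ln (real y) - 1 / ln (real z))"
    using assms(2)
  proof (induction z rule: nat_induct_at_least)
    case base
    show ?case by (simp add: T_def S_def)
  next
    case (Suc n)
    let ?u = "ln (real n)" and ?v = "ln (real (Suc n))"
    have u: "0 < ?u" "ln (real y) \<le> ?u" "?u \<le> ?v" using Suc lny assms by auto
    have v: "0 < ?v" using u by linarith
    have step: "T (Suc n) - S (Suc n) / ?v = T n - S n / ?v"
    proof (cases "prime (Suc n)")
      case True
      then have *: "{p. p \<in> {y<..Suc n} \<and> prime p} = insert (Suc n) {p. p \<in> {y<..n} \<and> prime p}"
        using Suc by auto
      show ?thesis unfolding T_def S_def * using v
        by (simp add: add_divide_distrib)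
    next
      case False
      then have *: "{p. p \<in> {y<..Suc n} \<and> prime p} = {p. p \<in> {y<..n} \<and> prime p}"
        using le_Suc_eq by auto
      show ?thesis unfolding T_def S_def * ..
    qed
    have w: "0 \<le> 1 / ?u - 1 / ?v" using u v by (simp add: frac_le)
    have Sn: "S n \<le> ?u + 5"
      using sum_ln_prime_le[of y n] Suc assms lny by (simp add: S_def)
    have "S n / ?u - S n / ?v = S n * (1 / ?u - 1 / ?v)" by (simp add: algebra_simps)
    also have "\<dots> \<le> (?u + 5) * (1 / ?u - 1 / ?v)" using Sn w by (rule mult_right_mono)
    also have "\<dots> = (1 - ?u / ?v) + 5 * (1 / ?u - 1 / ?v)" using u v by (simp add: field_simps)
    finally have "S n / ?u - S n / ?v \<le> (1 - ?u / ?v) + 5 * (1 / ?u - 1 / ?v)" .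
    moreover have "1 - ?u / ?v \<le> ln ?v - ln ?u"
      using ln_le_minus_one[of "?u / ?v"] u v by (simp add: ln_div)
    ultimately show ?case using Suc.IH step by argo
  qed
  moreover have lnz: "ln (real z) \<ge> ln (real y)" using assms by simp
  moreover have "S z / ln (real z) \<le> (ln (real z) - ln (real y) + 5) / ln (real z)"
    unfolding S_def using lnz lny assms by (intro divide_right_mono sum_ln_prime_le) auto
  moreover have "(ln (real z) - ln (real y) + 5) / ln (real z) \<le> 1 + 5 / ln (real z)"
    using lnz lny by (simp add: field_simps)
  moreover have "5 / ln (real y) \<le> 10" using lny by (simp add: field_simps)
  ultimately show ?thesis unfolding T_def by (simp add: right_diff_distrib)
qed

lemma sum_ln_prime_real_le:
  assumes "1 \<le> z"
  shows "(\<Sum>p | prime p \<and> real p \<le> z. ln (real p) / real p) \<le> ln z + 5"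
proof -
  let ?n = "nat \<lfloor>z\<rfloor>"
  have n: "1 \<le> ?n" "real ?n \<le> z" using assms by (auto simp: le_nat_iff le_floor_iff)
  have "{p. prime p \<and> real p \<le> z} = {p. p \<in> {1..?n} \<and> prime p}"
    using assms by (intro Collect_cong) (auto simp: le_nat_floor le_nat_iff le_floor_iff dest: prime_gt_0_nat)
  then have "(\<Sum>p | prime p \<and> real p \<le> z. ln (real p) / real p) \<le> ln (real ?n) + 5"
    using sum_ln_prime_le_1[OF n(1)] by simp
  also have "ln (real ?n) \<le> ln z" using n by simp
  finally show ?thesis by simp
qed

lemma sum_inverse_prime_real_le:
  assumes "4 \<le> y" "y \<le> z"
  shows "(\<Sum>p | prime p \<and> y < real p \<and> real p \<le> z. 1 / real p) \<le> ln (ln z) - ln (ln y) + 12"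
proof -
  let ?n = "nat \<lfloor>z\<rfloor>" and ?m = "nat \<lfloor>y\<rfloor>"
  have mn: "2 \<le> ?m" "?m \<le> ?n" "real ?n \<le> z" "y - 1 \<le> real ?m"
    using assms by (auto simp: le_nat_iff le_floor_iff nat_mono floor_mono) linarith
  have "{p. prime p \<and> y < real p \<and> real p \<le> z} = {p. p \<in> {?m<..?n} \<and> prime p}"
    using assms by (intro Collect_cong) (auto simp: le_nat_iff le_floor_iff nat_less_iff floor_less_iff)
  then have "(\<Sum>p | prime p \<and> y < real p \<and> real p \<le> z. 1 / real p) \<le> ln (ln (real ?n)) - ln (ln (real ?m)) + 11"
    using sum_inverse_prime_le[OF mn(1,2)] by simp
  moreover have "ln (ln (real ?n)) \<le> ln (ln z)"
    using mn by (subst ln_le_cancel_iff) auto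
  moreover have "ln (ln y) - 1 \<le> ln (ln (real ?m))"
  proof -
    have "2 \<le> sqrt y" using assms by (simp add: real_le_rsqrt)
    then have "2 * sqrt y \<le> sqrt y * sqrt y" by (intro mult_right_mono) (use assms in auto)
    moreover have "sqrt y * sqrt y = y" using assms by simp
    ultimately have "sqrt y \<le> real ?m" using mn(4) \<open>2 \<le> sqrt y\<close> by linarith
    then have "ln (sqrt y) \<le> ln (real ?m)" using assms by (subst ln_le_cancel_iff) auto
    then have le: "ln y / 2 \<le> ln (real ?m)" using assms by (simp add: ln_sqrt)
    have lny: "0 < ln y" using assms by simp
    then have "ln (ln y) - ln 2 = ln (ln y / 2)" by (simp add: ln_div)
    also have "\<dots> \<le> ln (ln (real ?m))" using le lny by (subst ln_le_cancel_iff) auto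
    finally show ?thesis using ln_2_less_1 by linarith
  qed
  ultimately show ?thesis by linarith
qed

lemma sum_inverse_prime_upto_le:
  assumes "2 \<le> n"
  shows "(\<Sum>p | p \<in> {1..n} \<and> prime p. 1 / real p) \<le> ln (ln (real n)) + 13"
proof -
  have "{p. p \<in> {1..n} \<and> prime p} = insert 2 {p. p \<in> {2<..n} \<and> prime p}"
    using assms by (auto dest: prime_ge_2_nat)
  then have "(\<Sum>p | p \<in> {1..n} \<and> prime p. 1 / real p) = 1 / 2 + (\<Sum>p | p \<in> {2<..n} \<and> prime p. 1 / real p)"
    by simp
  also have "\<dots> \<le> 1 / 2 + (ln (ln (real n)) - ln (ln 2) + 11)"
    using sum_inverse_prime_le[of 2 n] assms by simp
  finally have "(\<Sum>p | p \<in> {1..n} \<and> prime p. 1 / real p) \<le> 1 / 2 + (ln (ln (real n)) - ln (ln 2) + 11)" .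
  moreover have "- ln (ln 2) \<le> (1 :: real)"
  proof -
    have half: "1 / 2 \<le> ln (2::real)" using ln_le_minus_one[of "1 / 2 :: real"] by (simp add: ln_div)
    then have "ln (1 / 2) \<le> ln (ln (2::real))" by (subst ln_le_cancel_iff) auto
    then show ?thesis using ln_2_less_1 by (simp add: ln_div)
  qed
  ultimately show ?thesis by linarith
qed

lemma sum_ln_prime_3mod4_real_ge:
  "\<exists>C. \<forall>y z. 1 \<le> y \<longrightarrow> y \<le> z \<longrightarrow>
     (ln z - ln y) / 2 - C \<le> (\<Sum>p | prime p \<and> p mod 4 = 3 \<and> y < real p \<and> real p \<le> z. ln (real p) / real p)"
proof -
  obtain C where C: "\<And>y z :: nat. 1 \<le> y \<Longrightarrow> y \<le> z \<Longrightarrow>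
     (ln (real z) - ln (real y)) / 2 - C \<le> (\<Sum>p | p \<in> {y<..z} \<and> prime p \<and> p mod 4 = 3. ln (real p) / real p)"
    using sum_ln_prime_3mod4_ge by blast
  show ?thesis
  proof (rule exI[of _ "C + 1"], intro allI impI)
    fix y z :: real assume yz: "1 \<le> y" "y \<le> z"
    let ?n = "nat \<lfloor>z\<rfloor>" and ?m = "nat \<lfloor>y\<rfloor>"
    have mn: "1 \<le> ?m" "?m \<le> ?n"
      using yz by (auto simp: le_nat_iff le_floor_iff nat_mono floor_mono intro: order_trans[OF of_int_floor_le])
    have my: "real ?m \<le> y" using yz by linarith
    have "z - 1 \<le> real ?n" using yz by linarith
    moreover have "1 \<le> real ?n" using mn by linarith
    ultimately have z2: "z / 2 \<le> real ?n" by linarith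
    have seteq: "{p. prime p \<and> p mod 4 = 3 \<and> y < real p \<and> real p \<le> z} = {p. p \<in> {?m<..?n} \<and> prime p \<and> p mod 4 = 3}"
      using yz by (intro Collect_cong) (auto simp: le_nat_iff le_floor_iff nat_less_iff floor_less_iff)
    have "ln z - 1 \<le> ln (real ?n)"
    proof -
      have "ln (z / 2) \<le> ln (real ?n)" using z2 yz by (subst ln_le_cancel_iff) auto
      then show ?thesis using ln_2_less_1 yz by (simp add: ln_div)
    qed
    moreover have "ln (real ?m) \<le> ln y" using mn my yz by (subst ln_le_cancel_iff) auto
    ultimately have "(ln z - ln y) / 2 - (C + 1) \<le> (ln (real ?n) - ln (real ?m)) / 2 - C"
      by argo
    then show "(ln z - ln y) / 2 - (C + 1) \<le>
        (\<Sum>p | prime p \<and> p mod 4 = 3 \<and> y < real p \<and> real p \<le> z. ln (real p) / real p)"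
      unfolding seteq using C[OF mn] by (rule order_trans)
  qed
qed

lemma sum_ln_prime_upto_le: "(\<Sum>p | p \<in> {1..n} \<and> prime p. ln (real p)) \<le> 4 * real n"
proof -
  have "(\<Sum>p | p \<in> {1..n} \<and> prime p. ln (real p)) = (\<Sum>p | p \<in> {1..n} \<and> prime p. \<Lambda> p)"
    by (intro sum.cong) auto
  also have "\<dots> \<le> \<psi> n"
    unfolding \<psi>_def by (intro sum_mono2) (auto simp: mangoldt_nonneg)
  also have "\<dots> \<le> 4 * real n" by (rule chebyshev_psi_le)
  finally show ?thesis .
qed

text \<open>
  \<open>1 / (1 - 1/p) = 1 + 1/p + 1/(p (p - 1))\<close>, and the last terms sum to at most \<open>1\<close> by telescoping.
\<close>

lemma prod_inverse_one_minus_prime_le: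
  assumes "finite P" "\<And>p. p \<in> P \<Longrightarrow> prime p"
  shows "(\<Prod>p\<in>P. 1 / (1 - 1 / real p)) \<le> exp ((\<Sum>p\<in>P. 1 / real p) + 1)"
proof -
  have p2: "real p \<ge> 2" if "p \<in> P" for p using assms(2)[OF that] prime_ge_2_nat[of p] by linarith
  have "(\<Prod>p\<in>P. 1 / (1 - 1 / real p)) \<le> (\<Prod>p\<in>P. exp (1 / real p + 1 / (real p * (real p - 1))))"
  proof (intro prod_mono conjI)
    fix p assume p: "p \<in> P"
    have "1 / (1 - 1 / real p) = 1 + (1 / real p + 1 / (real p * (real p - 1)))"
      using p2[OF p] by (simp add: field_simps)
    also have "\<dots> \<le> exp (1 / real p + 1 / (real p * (real p - 1)))" by (rule exp_ge_add_one_self)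
    finally show "1 / (1 - 1 / real p) \<le> exp (1 / real p + 1 / (real p * (real p - 1)))" .
    show "0 \<le> 1 / (1 - 1 / real p)" using p2[OF p] by (simp add: field_simps)
  qed
  also have "\<dots> = exp ((\<Sum>p\<in>P. 1 / real p) + (\<Sum>p\<in>P. 1 / (real p * (real p - 1))))"
    using assms(1) by (simp add: exp_sum sum.distrib[symmetric])
  also have "\<dots> \<le> exp ((\<Sum>p\<in>P. 1 / real p) + 1)"
  proof -
    obtain n where n: "P \<subseteq> {..n}" using assms(1) finite_nat_iff_bounded_le by auto
    have "(\<Sum>p\<in>P. 1 / (real p * (real p - 1))) \<le> (\<Sum>k\<in>{2..max 2 n}. 1 / (real k * (real k - 1)))"
      using n p2 by (intro sum_mono2) fastforce+
    also have "\<dots> = 1 - 1 / real (max 2 n)"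
    proof -
      have "(\<Sum>k\<in>{2..m}. 1 / (real k * (real k - 1))) = 1 - 1 / real m" if "2 \<le> m" for m :: nat
        using that
      proof (induction m rule: nat_induct_at_least)
        case (Suc m)
        have "1 - 1 / real m + 1 / (real (Suc m) * (real (Suc m) - 1)) = 1 - 1 / real (Suc m)"
          using Suc.hyps by (simp add: divide_simps) (simp add: algebra_simps)
        then show ?case using Suc by simp
      qed simp
      then show ?thesis by simp
    qed
    also have "\<dots> \<le> 1" by simp
    finally show ?thesis by simp
  qed
  finally show ?thesis .
qed

section \<open>Prime divisors in a fixed set behave almost independently\<close>

definition prime_divisors_in :: "nat set \<Rightarrow> nat \<Rightarrow> nat set" where
  "prime_divisors_in W n = {p \<in> W. p dvd n}"

text \<open>
  The Euler product as an inequality. A number composed of primes in \<open>insert q P\<close> is either prime to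
  \<open>q\<close> or \<open>q\<close> times a number of the same kind, so the new sum \<open>f'\<close> satisfies \<open>f' \<le> f + f' / q\<close>.
\<close>

lemma sum_inverse_smooth_le:
  assumes "finite P" "\<And>p. p \<in> P \<Longrightarrow> prime p"
  shows "(\<Sum>n | n \<in> {1..N} \<and> (\<forall>p. prime p \<longrightarrow> p dvd n \<longrightarrow> p \<in> P). 1 / real n) \<le> (\<Prod>p\<in>P. 1 / (1 - 1 / real p))"
  using assms
proof (induction P rule: finite_induct)
  case empty
  have "{n. n \<in> {1..N} \<and> (\<forall>p. prime p \<longrightarrow> p dvd n \<longrightarrow> p \<in> ({} :: nat set))} \<subseteq> {1}"
  proof
    fix n assume "n \<in> {n. n \<in> {1..N} \<and> (\<forall>p. prime p \<longrightarrow> p dvd n \<longrightarrow> p \<in> ({} :: nat set))}"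
    then have "\<not> (\<exists>p. prime p \<and> p dvd n)" by auto
    then show "n \<in> {1}" using prime_factor_nat by blast
  qed
  then have "(\<Sum>n | n \<in> {1..N} \<and> (\<forall>p. prime p \<longrightarrow> p dvd n \<longrightarrow> p \<in> ({} :: nat set)). 1 / real n) \<le> (\<Sum>n\<in>{1::nat}. 1 / real n)"
    by (intro sum_mono2) auto
  then show ?case by simp
next
  case (insert q P)
  define X where "X P = {n. n \<in> {1..N} \<and> (\<forall>p. prime p \<longrightarrow> p dvd n \<longrightarrow> p \<in> P)}" for P :: "nat set"
  define f where "f P = (\<Sum>n\<in>X P. 1 / real n)" for P
  have q: "prime q" "real q \<ge> 2" using insert prime_ge_2_nat[of q] by auto
  have fin: "finite (X P)" for P by (simp add: X_def)
  have "X (insert q P) \<subseteq> X P \<union> (\<lambda>n. q * n) ` X (insert q P)"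
  proof
    fix n assume n: "n \<in> X (insert q P)"
    show "n \<in> X P \<union> (\<lambda>n. q * n) ` X (insert q P)"
    proof (cases "q dvd n")
      case True
      then obtain k where k: "n = q * k" by blast
      have "k > 0" using n k by (auto simp: X_def)
      moreover have "k \<le> n" using k q by simp
      then have "k \<le> N" using n by (simp add: X_def)
      ultimately have "k \<in> X (insert q P)" using n k by (auto simp: X_def)
      then show ?thesis using k by blast
    next
      case False
      then show ?thesis using n by (auto simp: X_def)
    qed
  qed
  then have "f (insert q P) \<le> (\<Sum>n\<in>X P \<union> (\<lambda>n. q * n) ` X (insert q P). 1 / real n)"
    unfolding f_def using fin by (intro sum_mono2) auto
  also have "\<dots> \<le> f P + (\<Sum>n\<in>(\<lambda>n. q * n) ` X (insert q P). 1 / real n)"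
    unfolding f_def using fin by (subst sum.union_inter[symmetric]) (auto intro: sum_nonneg)
  also have "(\<Sum>n\<in>(\<lambda>n. q * n) ` X (insert q P). 1 / real n) = 1 / real q * f (insert q P)"
    using q unfolding f_def by (subst sum.reindex) (auto simp: inj_on_def sum_distrib_left)
  finally have *: "f (insert q P) * (1 - 1 / real q) \<le> f P" by (simp add: algebra_simps)
  have "f (insert q P) \<le> f P * (1 / (1 - 1 / real q))"
    using * q by (simp add: pos_le_divide_eq)
  also have "\<dots> \<le> (\<Prod>p\<in>P. 1 / (1 - 1 / real p)) * (1 / (1 - 1 / real q))"
    using insert q by (intro mult_right_mono) (auto simp: f_def X_def)
  finally show ?case using insert(1,2) by (simp add: f_def X_def mult.commute)
qed

text \<open>
  The probability that \<open>U\<close> is the set of primes in \<open>W\<close> dividing \<open>n\<close>, in the model in which every \<open>p\<close> in \<open>W\<close>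
  divides \<open>n\<close> with probability \<open>1/p\<close> independently of the others.
\<close>

definition sieve_weight :: "nat set \<Rightarrow> nat set \<Rightarrow> real" where
  "sieve_weight W U = (\<Prod>p\<in>U. 1 / real p) * (\<Prod>p\<in>W - U. 1 - 1 / real p)"

lemma prod_primes_dvd:
  fixes n :: nat
  assumes "finite U" "\<And>p. p \<in> U \<Longrightarrow> prime p \<and> p dvd n"
  shows "\<Prod>U dvd n"
  using assms
proof (induction U rule: finite_induct)
  case (insert q U)
  have "coprime q (\<Prod>U)"
    using insert by (intro prod_coprime_right) (auto intro: primes_coprime)
  then show ?case using insert by (auto intro: divides_mult)
qed simp

text \<open>
  Dividing \<open>n\<close> by the primes of \<open>U\<close> leaves a number without prime factors in \<open>W - U\<close>, and the Euler product
  over the other primes differs from the full one by the factors of the model.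
\<close>

lemma sum_inverse_prime_divisors_eq_le:
  assumes W: "finite W" "\<And>p. p \<in> W \<Longrightarrow> prime p" "W \<subseteq> {1..N}" and U: "U \<subseteq> W"
  shows "(\<Sum>n | n \<in> {1..N} \<and> prime_divisors_in W n = U. 1 / real n)
    \<le> (\<Prod>p | p \<in> {1..N} \<and> prime p. 1 / (1 - 1 / real p)) * sieve_weight W U"
proof -
  let ?P = "{p. p \<in> {1..N} \<and> prime p}"
  let ?X = "{n. n \<in> {1..N} \<and> prime_divisors_in W n = U}"
  define R where "R = ?P - (W - U)"
  let ?Y = "{n. n \<in> {1..N} \<and> (\<forall>p. prime p \<longrightarrow> p dvd n \<longrightarrow> p \<in> R)}"
  have finU: "finite U" using W(1) U finite_subset by blast
  have gt1: "1 - 1 / real p > 0" if "prime p" for p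
    using prime_gt_1_nat[OF that] by simp
  have M: "\<Prod>U > 0" using U W(2) prime_gt_0_nat by (intro prod_pos) blast
  have "?X \<subseteq> (\<lambda>n. \<Prod>U * n) ` ?Y"
  proof
    fix n assume n: "n \<in> ?X"
    have "\<Prod>U dvd n"
      using n U W(2) finU by (intro prod_primes_dvd) (auto simp: prime_divisors_in_def)
    then obtain k where k: "n = \<Prod>U * k" by blast
    have "k > 0" "k \<le> n" using n k M by auto
    moreover have "p \<in> R" if p: "prime p" "p dvd k" for p
    proof -
      have "p dvd n" using p k by simp
      have "p \<le> k" using p \<open>k > 0\<close> by (auto intro: dvd_imp_le)
      then have "p \<in> ?P" using p n \<open>k \<le> n\<close> prime_gt_0_nat[of p] by auto
      moreover have "p \<notin> W - U" using n \<open>p dvd n\<close> unfolding prime_divisors_in_def by blast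
      ultimately show ?thesis by (simp add: R_def)
    qed
    ultimately have "k \<in> ?Y" using n by simp
    then show "n \<in> (\<lambda>n. \<Prod>U * n) ` ?Y" using k by blast
  qed
  then have "(\<Sum>n\<in>?X. 1 / real n) \<le> (\<Sum>n\<in>(\<lambda>n. \<Prod>U * n) ` ?Y. 1 / real n)"
    by (intro sum_mono2) auto
  also have "\<dots> = 1 / real (\<Prod>U) * (\<Sum>n\<in>?Y. 1 / real n)"
    using M by (subst sum.reindex) (auto simp: inj_on_def sum_distrib_left)
  also have "\<dots> \<le> 1 / real (\<Prod>U) * (\<Prod>p\<in>R. 1 / (1 - 1 / real p))"
    by (intro mult_left_mono sum_inverse_smooth_le) (auto simp: R_def intro: prod_nonneg)
  also have "1 / real (\<Prod>U) = (\<Prod>p\<in>U. 1 / real p)"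
    by (simp add: prod_dividef)
  also have "(\<Prod>p\<in>R. 1 / (1 - 1 / real p)) =
      (\<Prod>p\<in>?P. 1 / (1 - 1 / real p)) * (\<Prod>p\<in>W - U. 1 - 1 / real p)"
  proof -
    have sub: "W - U \<subseteq> ?P" using W by blast
    have "(\<Prod>p\<in>?P. 1 / (1 - 1 / real p)) =
        (\<Prod>p\<in>R. 1 / (1 - 1 / real p)) * (\<Prod>p\<in>W - U. 1 / (1 - 1 / real p))"
      unfolding R_def by (rule prod.subset_diff[OF sub]) simp
    moreover have "(\<Prod>p\<in>W - U. 1 / (1 - 1 / real p)) * (\<Prod>p\<in>W - U. 1 - 1 / real p) = 1"
      unfolding prod.distrib[symmetric] using gt1 W(2) by (intro prod.neutral) force
    ultimately show ?thesis by (simp add: mult.assoc)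
  qed
  finally show ?thesis by (simp add: sieve_weight_def mult_ac)
qed

lemma sum_inverse_prime_divisors_family_le:
  assumes W: "finite W" "\<And>p. p \<in> W \<Longrightarrow> prime p" "W \<subseteq> {1..N}"
  shows "(\<Sum>n | n \<in> {1..N} \<and> prime_divisors_in W n \<in> \<F>. 1 / real n)
    \<le> (\<Prod>p | p \<in> {1..N} \<and> prime p. 1 / (1 - 1 / real p)) * (\<Sum>U | U \<subseteq> W \<and> U \<in> \<F>. sieve_weight W U)"
proof -
  let ?X = "{n. n \<in> {1..N} \<and> prime_divisors_in W n \<in> \<F>}"
  let ?F = "{U. U \<subseteq> W \<and> U \<in> \<F>}"
  have "(\<Sum>n\<in>?X. 1 / real n) = (\<Sum>U\<in>?F. \<Sum>n\<in>{n. n \<in> ?X \<and> prime_divisors_in W n = U}. 1 / real n)"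
    using W(1) by (intro sum.group[symmetric]) (auto simp: prime_divisors_in_def)
  also have "\<dots> = (\<Sum>U\<in>?F. \<Sum>n | n \<in> {1..N} \<and> prime_divisors_in W n = U. 1 / real n)"
    by (intro sum.cong) auto
  also have "\<dots> \<le> (\<Sum>U\<in>?F. (\<Prod>p | p \<in> {1..N} \<and> prime p. 1 / (1 - 1 / real p)) * sieve_weight W U)"
    using W by (intro sum_mono sum_inverse_prime_divisors_eq_le) auto
  finally show ?thesis by (simp add: sum_distrib_left)
qed

text \<open>
  This turns an unweighted count into the logarithmic average treated above. Writing \<open>m = p n\<close> with \<open>p\<close> a
  prime outside \<open>W\<close> leaves the prime divisors in \<open>W\<close> unchanged, and for fixed \<open>n\<close> Chebyshev's bound gives
  \<open>O(N / n)\<close> for the sum of \<open>ln p\<close>. The factor \<open>H\<close>, of size \<open>ln N\<close> in the application, makes up for the factor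
  \<open>ln N\<close> in the logarithmic average.
\<close>

lemma sum_count_ln_le:
  assumes W: "\<And>p. p \<in> W \<Longrightarrow> prime p"
    and E: "E \<subseteq> {1..N}"
    and F: "\<And>m. m \<in> E \<Longrightarrow> prime_divisors_in W m \<in> \<F>"
    and H: "\<And>m. m \<in> E \<Longrightarrow> H \<le> (\<Sum>p | p \<in> {1..N} \<and> prime p \<and> p dvd m \<and> p \<notin> W. ln (real p))"
  shows "H * real (card E) \<le> 4 * real N * (\<Sum>n | n \<in> {1..N} \<and> prime_divisors_in W n \<in> \<F>. 1 / real n)"
proof -
  let ?X = "{n. n \<in> {1..N} \<and> prime_divisors_in W n \<in> \<F>}"
  let ?P = "\<lambda>m. {p. p \<in> {1..N} \<and> prime p \<and> p dvd m \<and> p \<notin> W}"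
  let ?Q = "\<lambda>n. {p. p \<in> {1..N div n} \<and> prime p}"
  have finE: "finite E" using E finite_subset by blast
  have "H * real (card E) = (\<Sum>m\<in>E. H)" by simp
  also have "\<dots> \<le> (\<Sum>m\<in>E. \<Sum>p\<in>?P m. ln (real p))" by (intro sum_mono H)
  also have "\<dots> = (\<Sum>(m, p)\<in>(SIGMA m:E. ?P m). ln (real p))"
    using finE by (intro sum.Sigma) auto
  also have "\<dots> = (\<Sum>(n, p)\<in>(\<lambda>(m, p). (m div p, p)) ` (SIGMA m:E. ?P m). ln (real p))"
  proof -
    have "inj_on (\<lambda>(m, p). (m div p, p)) (SIGMA m:E. ?P m)"
      by (rule inj_on_inverseI[where g = "\<lambda>(n, p). (n * p, p)"]) auto
    from sum.reindex[OF this, of "\<lambda>(n, p). ln (real p)"] show ?thesis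
      by (simp add: case_prod_beta o_def)
  qed
  also have "\<dots> \<le> (\<Sum>(n, p)\<in>(SIGMA n:?X. ?Q n). ln (real p))"
  proof (rule sum_mono2)
    show "(\<lambda>(m, p). (m div p, p)) ` (SIGMA m:E. ?P m) \<subseteq> (SIGMA n:?X. ?Q n)"
    proof
      fix b assume "b \<in> (\<lambda>(m, p). (m div p, p)) ` (SIGMA m:E. ?P m)"
      then obtain m p where b: "b = (m div p, p)"
        and mp: "m \<in> E" "p \<in> {1..N}" "prime p" "p dvd m" "p \<notin> W"
        by auto
      then obtain n where n: "m = p * n" by blast
      have m: "m \<ge> 1" "m \<le> N" using E mp by auto
      have p0: "p > 0" using mp by (simp add: prime_gt_0_nat)
      have "n \<ge> 1" using n m by (cases n) auto
      have "n \<le> m" using n p0 by simp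
      have eq: "prime_divisors_in W m = prime_divisors_in W n"
      proof -
        have "w dvd m \<longleftrightarrow> w dvd n" if w: "w \<in> W" for w
        proof -
          have "\<not> w dvd p" using W[OF w] mp w primes_dvd_imp_eq by blast
          then show ?thesis using W[OF w] n by (auto simp: prime_dvd_mult_iff)
        qed
        then show ?thesis by (auto simp: prime_divisors_in_def)
      qed
      have "p \<le> N div n"
        using m n \<open>n \<ge> 1\<close> by (simp add: less_eq_div_iff_mult_less_eq)
      moreover have "m div p = n" using n p0 by simp
      moreover have "prime_divisors_in W n \<in> \<F>" using F[OF mp(1)] eq by simp
      moreover have "n \<le> N" using \<open>n \<le> m\<close> m by simp
      ultimately show "b \<in> (SIGMA n:?X. ?Q n)"
        using \<open>n \<ge> 1\<close> mp(2,3) unfolding b by simp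
    qed
  qed (auto simp: Suc_leI prime_gt_0_nat)
  also have "\<dots> = (\<Sum>n\<in>?X. \<Sum>p\<in>?Q n. ln (real p))"
    by (rule sum.Sigma[symmetric]) auto
  also have "\<dots> \<le> (\<Sum>n\<in>?X. 4 * (real N / real n))"
  proof (rule sum_mono)
    fix n
    have "(\<Sum>p\<in>?Q n. ln (real p)) \<le> 4 * real (N div n)" by (rule sum_ln_prime_upto_le)
    also have "\<dots> \<le> 4 * (real N / real n)" by (intro mult_left_mono of_nat_div_le_of_nat) auto
    finally show "(\<Sum>p\<in>?Q n. ln (real p)) \<le> 4 * (real N / real n)" .
  qed
  also have "\<dots> = 4 * real N * (\<Sum>n\<in>?X. 1 / real n)" by (simp add: sum_distrib_left)
  finally show ?thesis .
qed

lemma sum_sieve_weight: 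
  assumes "finite W" shows "(\<Sum>U | U \<subseteq> W. sieve_weight W U) = 1"
proof -
  have "(\<Sum>U\<in>Pow W. sieve_weight W U) = (\<Prod>p\<in>W. 1 / real p + (1 - 1 / real p))"
    unfolding sieve_weight_def by (rule prod_add[OF assms, symmetric])
  then show ?thesis by (simp add: Pow_def)
qed

lemma sieve_weight_nonneg:
  assumes "\<And>p. p \<in> W \<Longrightarrow> p > 0" "U \<subseteq> W"
  shows "0 \<le> sieve_weight W U"
proof -
  have "1 / real p \<le> 1" if "p \<in> W" for p using assms(1)[OF that] by simp
  then show ?thesis unfolding sieve_weight_def by (intro mult_nonneg_nonneg prod_nonneg) auto
qed

lemma sieve_weight_union:
  assumes "finite W1" "finite W2" "W1 \<inter> W2 = {}" "U1 \<subseteq> W1" "U2 \<subseteq> W2"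
  shows "sieve_weight (W1 \<union> W2) (U1 \<union> U2) = sieve_weight W1 U1 * sieve_weight W2 U2"
proof -
  have "(W1 \<union> W2) - (U1 \<union> U2) = (W1 - U1) \<union> (W2 - U2)" using assms by auto
  then have "(\<Prod>p\<in>(W1 \<union> W2) - (U1 \<union> U2). 1 - 1 / real p) = (\<Prod>p\<in>W1 - U1. 1 - 1 / real p) * (\<Prod>p\<in>W2 - U2. 1 - 1 / real p)"
    using assms by (simp only:) (rule prod.union_disjoint, auto)
  moreover have "(\<Prod>p\<in>U1 \<union> U2. 1 / real p) = (\<Prod>p\<in>U1. 1 / real p) * (\<Prod>p\<in>U2. 1 / real p)"
    using assms finite_subset by (intro prod.union_disjoint) blast+
  ultimately show ?thesis by (simp add: sieve_weight_def)
qed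

text \<open>
  In the model the disjoint windows \<open>W i\<close> are independent, so the probability that none of the events \<open>G i\<close>
  occurs is at most \<open>(1 - \<delta>)^J\<close>.
\<close>

lemma sum_sieve_weight_avoiding_le:
  fixes W :: "nat \<Rightarrow> nat set"
  assumes W: "\<And>i. i < J \<Longrightarrow> finite (W i)" "\<And>i p. i < J \<Longrightarrow> p \<in> W i \<Longrightarrow> p > 0"
    and disj: "\<And>i j. i < J \<Longrightarrow> j < J \<Longrightarrow> i \<noteq> j \<Longrightarrow> W i \<inter> W j = {}"
    and \<delta>: "\<And>i. i < J \<Longrightarrow> \<delta> \<le> (\<Sum>U | U \<subseteq> W i \<and> G i U. sieve_weight (W i) U)"
  shows "(\<Sum>U | U \<subseteq> (\<Union>i<J. W i) \<and> (\<forall>i<J. \<not> G i (U \<inter> W i)). sieve_weight (\<Union>i<J. W i) U) \<le> exp (- \<delta> * real J)"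
  using assms
proof (induction J)
  case 0
  have "{U. U \<subseteq> (\<Union>i<0. W i) \<and> (\<forall>i<0. \<not> G i (U \<inter> W i))} = {{}}" by auto
  then show ?case by (simp add: sieve_weight_def)
next
  case (Suc J)
  define V where "V = (\<Union>i<J. W i)"
  define A where "A = {U. U \<subseteq> V \<and> (\<forall>i<J. \<not> G i (U \<inter> W i))}"
  define B where "B = {U. U \<subseteq> W J \<and> \<not> G J U}"
  have finV: "finite V" using Suc.prems by (auto simp: V_def)
  have finWJ: "finite (W J)" using Suc.prems by auto
  have "W i \<inter> W J = {}" if "i < J" for i using Suc.prems(3)[of i J] that by simp
  then have VJ: "V \<inter> W J = {}" unfolding V_def by blast
  have UN: "(\<Union>i<Suc J. W i) = V \<union> W J" by (auto simp: V_def less_Suc_eq)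
  have inV: "W i \<subseteq> V" if "i < J" for i using that by (auto simp: V_def)
  have restr: "(U1 \<union> U2) \<inter> W i = U1 \<inter> W i" if "i < J" "U2 \<subseteq> W J" for U1 U2 i
    using inV[OF that(1)] VJ that(2) by blast
  have restrJ: "(U1 \<union> U2) \<inter> W J = U2" if "U1 \<subseteq> V" "U2 \<subseteq> W J" for U1 U2
    using VJ that by blast
  have "(\<Sum>U | U \<subseteq> (\<Union>i<Suc J. W i) \<and> (\<forall>i<Suc J. \<not> G i (U \<inter> W i)). sieve_weight (\<Union>i<Suc J. W i) U) =
      (\<Sum>(U1, U2)\<in>A \<times> B. sieve_weight (V \<union> W J) (U1 \<union> U2))"
    unfolding UN
  proof (rule sum.reindex_bij_witness[where i = "\<lambda>(U1, U2). U1 \<union> U2" and j = "\<lambda>U. (U \<inter> V, U \<inter> W J)"])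
    fix U assume U: "U \<in> {U. U \<subseteq> V \<union> W J \<and> (\<forall>i<Suc J. \<not> G i (U \<inter> W i))}"
    then show split: "(case (U \<inter> V, U \<inter> W J) of (U1, U2) \<Rightarrow> U1 \<union> U2) = U" by auto
    have "U \<inter> V \<inter> W i = U \<inter> W i" if "i < J" for i using inV[OF that] by blast
    then show "(U \<inter> V, U \<inter> W J) \<in> A \<times> B" using U by (auto simp: A_def B_def)
    have "(U \<inter> V) \<union> (U \<inter> W J) = U" using U by auto
    then show "(case (U \<inter> V, U \<inter> W J) of (U1, U2) \<Rightarrow> sieve_weight (V \<union> W J) (U1 \<union> U2)) = sieve_weight (V \<union> W J) U"
      by simp
  next
    fix b assume b: "b \<in> A \<times> B"
    obtain U1 U2 where U: "b = (U1, U2)" by (cases b)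
    have sub: "U1 \<subseteq> V" "U2 \<subseteq> W J" using b U by (auto simp: A_def B_def)
    have "(U1 \<union> U2) \<inter> V = U1" using sub VJ by blast
    then show "((case b of (U1, U2) \<Rightarrow> U1 \<union> U2) \<inter> V, (case b of (U1, U2) \<Rightarrow> U1 \<union> U2) \<inter> W J) = b"
      using U restrJ[OF sub] by simp
    have "\<not> G i ((U1 \<union> U2) \<inter> W i)" if "i < Suc J" for i
    proof (cases "i = J")
      case True
      then show ?thesis using restrJ[OF sub] b U by (simp add: B_def)
    next
      case False
      then have i: "i < J" using that by simp
      show ?thesis using restr[OF i sub(2)] b U i by (simp add: A_def)
    qed
    then show "(case b of (U1, U2) \<Rightarrow> U1 \<union> U2) \<in> {U. U \<subseteq> V \<union> W J \<and> (\<forall>i<Suc J. \<not> G i (U \<inter> W i))}"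
      using sub U by auto
  qed
  also have "\<dots> = (\<Sum>U1\<in>A. \<Sum>U2\<in>B. sieve_weight V U1 * sieve_weight (W J) U2)"
    unfolding sum.cartesian_product[symmetric]
    using finV finWJ VJ by (intro sum.cong refl sieve_weight_union) (auto simp: A_def B_def)
  also have "\<dots> = (\<Sum>U\<in>A. sieve_weight V U) * (\<Sum>U\<in>B. sieve_weight (W J) U)"
    by (simp add: sum_product)
  also have "\<dots> \<le> exp (- \<delta> * real J) * exp (- \<delta>)"
  proof (rule mult_mono)
    show "(\<Sum>U\<in>A. sieve_weight V U) \<le> exp (- \<delta> * real J)"
      unfolding A_def V_def
    proof (rule Suc.IH)
      show "p > 0" if "i < J" "p \<in> W i" for i p
        using Suc.prems(2)[OF less_SucI[OF that(1)] that(2)] .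
    qed (use Suc.prems in auto)
    have "(\<Sum>U | U \<subseteq> W J. sieve_weight (W J) U) =
        (\<Sum>U\<in>B. sieve_weight (W J) U) + (\<Sum>U | U \<subseteq> W J \<and> G J U. sieve_weight (W J) U)"
      unfolding B_def using finWJ
      by (subst sum.union_disjoint[symmetric]) (auto intro!: sum.cong)
    then have "(\<Sum>U\<in>B. sieve_weight (W J) U) \<le> 1 + (- \<delta>)"
      using sum_sieve_weight[OF finWJ] Suc.prems(4)[of J] by simp
    also have "\<dots> \<le> exp (- \<delta>)" by (rule exp_ge_add_one_self)
    finally show "(\<Sum>U\<in>B. sieve_weight (W J) U) \<le> exp (- \<delta>)" .
    show "0 \<le> (\<Sum>U\<in>B. sieve_weight (W J) U)"
      using Suc.prems(2) by (intro sum_nonneg sieve_weight_nonneg) (auto simp: B_def)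
  qed simp
  also have "\<dots> = exp (- \<delta> * real (Suc J))" by (simp add: exp_add[symmetric] algebra_simps)
  finally show ?case .
qed

section \<open>Large smooth parts and large square parts are rare\<close>

definition smooth_radical :: "real \<Rightarrow> nat \<Rightarrow> nat" where
  "smooth_radical z m = \<Prod>{p. prime p \<and> real p \<le> z \<and> p dvd m}"

lemma smooth_radical_pos: "smooth_radical z m > 0"
  unfolding smooth_radical_def by (intro prod_pos) (auto intro: prime_gt_0_nat)

lemma finite_primes_real_le [simp]: "finite {p. prime p \<and> real p \<le> z}"
proof (rule finite_subset)
  show "{p. prime p \<and> real p \<le> z} \<subseteq> {..nat \<lfloor>z\<rfloor>}"
    by (auto simp: le_nat_floor)
qed simp

lemma card_multiples_le:
  assumes "d > 0" shows "real (card {m \<in> {1..N}. d dvd m}) \<le> real N / real d"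
proof -
  have "{m \<in> {1..N}. d dvd m} \<subseteq> (\<lambda>k. d * k) ` {1..N div d}"
  proof
    fix m assume "m \<in> {m \<in> {1..N}. d dvd m}"
    then obtain k where k: "m = d * k" "1 \<le> m" "m \<le> N" by auto
    then have "1 \<le> k" "k \<le> N div d" using assms
      by (auto simp: less_eq_div_iff_mult_less_eq mult.commute Suc_le_eq)
    then show "m \<in> (\<lambda>k. d * k) ` {1..N div d}" using k by auto
  qed
  then have "card {m \<in> {1..N}. d dvd m} \<le> card ((\<lambda>k. d * k) ` {1..N div d})"
    by (intro card_mono) auto
  also have "\<dots> \<le> N div d" using card_image_le[of "{1..N div d}" "\<lambda>k. d * k"] by simp
  finally have "real (card {m \<in> {1..N}. d dvd m}) \<le> real (N div d)" by simp
  then show ?thesis using of_nat_div_le_of_nat[of N d, where ?'a = real] by linarith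
qed

text \<open>
  Rankin's trick with the exponent \<open>1 / ln z\<close>: the average of \<open>(smooth_radical z m)\<close> to this power is
  bounded, because it is at most the product of \<open>1 + a p / p\<close> with \<open>a p = O(ln p / ln z)\<close> over \<open>p \<le> z\<close>. Expanding
  the power as a sum over sets of prime divisors avoids any appeal to multiplicativity.
\<close>

lemma card_smooth_radical_gt_le:
  assumes z: "z \<ge> exp 1"
  shows "real (card {m \<in> {1..N}. real (smooth_radical z m) > z powr u}) \<le> exp 12 * exp (- u) * real N"
proof -
  let ?B = "{m \<in> {1..N}. real (smooth_radical z m) > z powr u}"
  let ?Z = "{p. prime p \<and> real p \<le> z}"
  have z0: "z > 0" using z exp_gt_zero[of "1::real"] by linarith
  have lnz: "ln z \<ge> 1" using z z0 by (simp add: ln_ge_iff)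
  \<comment> \<open>So that \<open>1 + a p\<close> is \<open>p\<close> to the power \<open>1 / ln z\<close>.\<close>
  define a where "a p = exp (ln (real p) / ln z) - 1" for p :: nat
  have p1: "1 \<le> real p" if "p \<in> ?Z" for p using that prime_gt_0_nat[of p] by (simp add: Suc_leI)
  have a_nonneg: "0 \<le> a p" if "p \<in> ?Z" for p
    using p1[OF that] lnz by (simp add: a_def)
  have a_le: "a p \<le> 2 * ln (real p) / ln z" if p: "p \<in> ?Z" for p
  proof -
    have "ln (real p) \<le> ln z" using p p1[OF p] z0 by (subst ln_le_cancel_iff) auto
    then have t: "0 \<le> ln (real p) / ln z" "ln (real p) / ln z \<le> 1" using lnz p1[OF p] by (auto simp: field_simps)
    have "exp (ln (real p) / ln z) \<le> 1 + ln (real p) / ln z + (ln (real p) / ln z)\<^sup>2"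
      using t by (intro exp_bound) auto
    also have "(ln (real p) / ln z)\<^sup>2 \<le> (ln (real p) / ln z) ^ 1"
      using t by (intro power_decreasing) auto
    finally show ?thesis by (simp add: a_def)
  qed
  let ?f = "\<lambda>m. \<Prod>p\<in>{p \<in> ?Z. p dvd m}. 1 + a p"
  have f: "?f m = exp (ln (real (smooth_radical z m)) / ln z)" for m
  proof -
    have "{p. prime p \<and> real p \<le> z \<and> p dvd m} = {p \<in> ?Z. p dvd m}" by auto
    moreover have "ln (real (\<Prod>{p \<in> ?Z. p dvd m})) = (\<Sum>p\<in>{p \<in> ?Z. p dvd m}. ln (real p))"
      unfolding of_nat_prod using p1 by (subst ln_prod) fastforce+
    moreover have "finite {p \<in> ?Z. p dvd m}"
      by (rule finite_subset[OF _ finite_primes_real_le[of z]]) auto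
    ultimately show ?thesis
      by (simp add: a_def smooth_radical_def sum_divide_distrib exp_sum)
  qed
  have "exp u * real (card ?B) =
     (\<Sum>m\<in>?B. exp u)" by simp
  also have "\<dots> \<le> (\<Sum>m\<in>?B. ?f m)"
  proof (rule sum_mono)
    fix m assume m: "m \<in> ?B"
    then have "ln (z powr u) \<le> ln (real (smooth_radical z m))"
      using z0 smooth_radical_pos[of z m] by (subst ln_le_cancel_iff) auto
    then have "u * ln z \<le> ln (real (smooth_radical z m))" using z0 by (simp add: ln_powr)
    then have "u \<le> ln (real (smooth_radical z m)) / ln z" using lnz by (simp add: pos_le_divide_eq)
    then show "exp u \<le> ?f m" unfolding f by simp
  qed
  also have "\<dots> \<le> (\<Sum>m\<in>{1..N}. ?f m)"
    using a_nonneg by (intro sum_mono2) (auto intro!: prod_nonneg)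
  also have "\<dots> = (\<Sum>m\<in>{1..N}. \<Sum>S\<in>Pow ?Z. if S \<subseteq> {p. p dvd m} then \<Prod>p\<in>S. a p else 0)"
  proof (intro sum.cong refl)
    fix m
    have "?f m = (\<Sum>S\<in>Pow {p \<in> ?Z. p dvd m}. \<Prod>p\<in>S. a p)"
      using prod_add[of "{p \<in> ?Z. p dvd m}" a "\<lambda>_. 1"] finite_subset[OF _ finite_primes_real_le[of z], of "{p \<in> ?Z. p dvd m}"]
      by (auto simp: add.commute)
    also have "\<dots> = (\<Sum>S\<in>Pow ?Z. if S \<subseteq> {p. p dvd m} then \<Prod>p\<in>S. a p else 0)"
      by (subst sum.inter_filter[symmetric]) (auto intro!: sum.cong)
    finally show "?f m = (\<Sum>S\<in>Pow ?Z. if S \<subseteq> {p. p dvd m} then \<Prod>p\<in>S. a p else 0)" .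
  qed
  also have "\<dots> = (\<Sum>S\<in>Pow ?Z. \<Sum>m\<in>{1..N}. if S \<subseteq> {p. p dvd m} then \<Prod>p\<in>S. a p else 0)"
    by (rule sum.swap)
  also have "\<dots> \<le> (\<Sum>S\<in>Pow ?Z. real N * (\<Prod>p\<in>S. a p / real p))"
  proof (rule sum_mono)
    fix S assume S: "S \<in> Pow ?Z"
    then have finS: "finite S" using finite_subset finite_primes_real_le by blast
    have S0: "\<Prod>S > 0" using S prime_gt_0_nat by (intro prod_pos) blast
    have aS: "0 \<le> (\<Prod>p\<in>S. a p)" using S a_nonneg by (intro prod_nonneg) blast
    have "(\<Sum>m\<in>{1..N}. if S \<subseteq> {p. p dvd m} then \<Prod>p\<in>S. a p else 0) =
        real (card {m \<in> {1..N}. S \<subseteq> {p. p dvd m}}) * (\<Prod>p\<in>S. a p)"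
      by (subst sum.inter_filter[symmetric]) auto
    also have "\<dots> \<le> real (card {m \<in> {1..N}. \<Prod>S dvd m}) * (\<Prod>p\<in>S. a p)"
    proof (intro mult_right_mono aS)
      have "{m \<in> {1..N}. S \<subseteq> {p. p dvd m}} \<subseteq> {m \<in> {1..N}. \<Prod>S dvd m}"
        using S finS by (auto intro!: prod_primes_dvd)
      then show "real (card {m \<in> {1..N}. S \<subseteq> {p. p dvd m}}) \<le> real (card {m \<in> {1..N}. \<Prod>S dvd m})"
        by (intro of_nat_mono card_mono) auto
    qed
    also have "\<dots> \<le> (real N / real (\<Prod>S)) * (\<Prod>p\<in>S. a p)"
      by (intro mult_right_mono aS card_multiples_le S0)
    finally show "(\<Sum>m\<in>{1..N}. if S \<subseteq> {p. p dvd m} then \<Prod>p\<in>S. a p else 0) \<le> real N * (\<Prod>p\<in>S. a p / real p)"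
      by (simp add: prod_dividef)
  qed
  also have "\<dots> = real N * (\<Prod>p\<in>?Z. a p / real p + 1)"
    by (simp add: prod_add sum_distrib_left)
  also have "\<dots> \<le> real N * (\<Prod>p\<in>?Z. exp (2 / ln z * (ln (real p) / real p)))"
  proof (intro mult_left_mono prod_mono conjI)
    fix p assume p: "p \<in> ?Z"
    show "0 \<le> a p / real p + 1" using a_nonneg[OF p] by simp
    have "a p / real p \<le> 2 * ln (real p) / ln z / real p" using a_le[OF p] by (intro divide_right_mono) auto
    then have "a p / real p + 1 \<le> 1 + 2 / ln z * (ln (real p) / real p)" by simp
    also have "\<dots> \<le> exp (2 / ln z * (ln (real p) / real p))" by (rule exp_ge_add_one_self)
    finally show "a p / real p + 1 \<le> exp (2 / ln z * (ln (real p) / real p))" .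
  qed auto
  also have "(\<Prod>p\<in>?Z. exp (2 / ln z * (ln (real p) / real p))) = exp (2 / ln z * (\<Sum>p\<in>?Z. ln (real p) / real p))"
    by (subst exp_sum[symmetric]) (simp_all only: finite_primes_real_le sum_distrib_left)
  also have "real N * \<dots> \<le> real N * exp 12"
  proof (intro mult_left_mono)
    have "2 / ln z * (\<Sum>p\<in>?Z. ln (real p) / real p) \<le> 2 / ln z * (ln z + 5)"
      using lnz z by (intro mult_left_mono sum_ln_prime_real_le) (auto intro: order_trans[OF _ z])
    also have "\<dots> \<le> 12" using lnz by (simp add: field_simps)
    finally show "exp (2 / ln z * (\<Sum>p\<in>?Z. ln (real p) / real p)) \<le> exp 12" by simp
  qed auto
  finally have "exp u * real (card ?B) \<le> real N * exp 12" .
  then have "real (card ?B) \<le> real N * exp 12 / exp u"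
    by (simp add: pos_le_divide_eq mult.commute)
  then show ?thesis by (simp add: exp_minus field_simps)
qed

lemma sum_inverse_squares_tail_le:
  assumes "a \<ge> 1"
  shows "(\<Sum>d\<in>{a<..b}. 1 / (real d)\<^sup>2) \<le> 1 / real a"
proof (cases "a \<le> b")
  case True
  then have "(\<Sum>d\<in>{a<..b}. 1 / (real d)\<^sup>2) \<le> 1 / real a - 1 / real b"
  proof (induction b rule: nat_induct_at_least)
    case (Suc b)
    have "{a<..Suc b} = insert (Suc b) {a<..b}" using Suc by auto
    then have "(\<Sum>d\<in>{a<..Suc b}. 1 / (real d)\<^sup>2) = 1 / (real (Suc b))\<^sup>2 + (\<Sum>d\<in>{a<..b}. 1 / (real d)\<^sup>2)"
      by simp
    moreover have "1 / (real (Suc b))\<^sup>2 \<le> 1 / (real b * real (Suc b))"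
      using Suc.hyps assms by (intro frac_le) (auto simp: power2_eq_square intro!: mult_pos_pos)
    moreover have "1 / (real b * real (Suc b)) = 1 / real b - 1 / real (Suc b)"
      using Suc.hyps assms by (simp add: field_simps)
    ultimately show ?case using Suc.IH by linarith
  qed simp
  then show ?thesis using of_nat_0_le_iff[of b, where ?'a = real] by (smt (verit) divide_nonneg_nonneg)
qed simp

lemma card_square_part_gt_le:
  assumes "D \<ge> 1"
  shows "real (card {m \<in> {1..N}. real (square_part m) > D}) \<le> 2 * real N / D"
proof -
  let ?B = "{m \<in> {1..N}. real (square_part m) > D}"
  let ?a = "nat \<lfloor>D\<rfloor>"
  have a1: "?a \<ge> 1" using assms by (auto simp: le_nat_iff le_floor_iff)
  have "D \<le> real ?a + 1" using assms by linarith
  then have a: "?a \<ge> 1" "D \<le> 2 * real ?a" using a1 by linarith+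
  have "?B \<subseteq> (\<Union>d\<in>{?a<..N}. {m \<in> {1..N}. d\<^sup>2 dvd m})"
  proof
    fix m assume m: "m \<in> ?B"
    let ?d = "square_part m"
    have dv: "?d\<^sup>2 dvd m" by simp
    then have "?d\<^sup>2 \<le> N" using m dvd_imp_le[of "?d\<^sup>2" m] by auto
    then have "?d \<le> N" by (meson le_trans power2_nat_le_imp_le)
    moreover have "?a < ?d" using m assms by (auto simp: nat_less_iff floor_less_iff)
    ultimately show "m \<in> (\<Union>d\<in>{?a<..N}. {m \<in> {1..N}. d\<^sup>2 dvd m})" using m dv by auto
  qed
  then have "card ?B \<le> card (\<Union>d\<in>{?a<..N}. {m \<in> {1..N}. d\<^sup>2 dvd m})"
    by (intro card_mono) auto
  also have "\<dots> \<le> (\<Sum>d\<in>{?a<..N}. card {m \<in> {1..N}. d\<^sup>2 dvd m})" by (intro card_UN_le) simp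
  finally have "real (card ?B) \<le> (\<Sum>d\<in>{?a<..N}. real (card {m \<in> {1..N}. d\<^sup>2 dvd m}))"
    by (simp flip: of_nat_sum)
  also have "\<dots> \<le> (\<Sum>d\<in>{?a<..N}. real N / real (d\<^sup>2))"
    by (intro sum_mono card_multiples_le) auto
  also have "\<dots> = real N * (\<Sum>d\<in>{?a<..N}. 1 / (real d)\<^sup>2)" by (simp add: sum_distrib_left)
  also have "\<dots> \<le> real N * (1 / real ?a)"
    using a by (intro mult_left_mono sum_inverse_squares_tail_le) auto
  also have "\<dots> \<le> real N * (2 / D)"
    using a assms by (intro mult_left_mono) (auto simp: field_simps)
  finally show ?thesis by (simp add: mult.commute)
qed

section \<open>A gap among the prime divisors congruent to 3 modulo 4 gives a saving\<close>

lemma squarefree_part_eq_prod: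
  fixes m :: nat
  assumes "m > 0"
  shows "squarefree_part m = \<Prod>{p. prime p \<and> p dvd squarefree_part m}"
proof -
  let ?s = "squarefree_part m"
  have s: "?s > 0" by (simp add: zero_less_iff_neq_zero)
  have "?s = (\<Prod>p\<in>prime_factors ?s. p ^ multiplicity p ?s)"
    using s by (intro prime_factorization_nat) 
  also have "\<dots> = (\<Prod>p\<in>prime_factors ?s. p)"
  proof (intro prod.cong refl)
    fix p assume p: "p \<in> prime_factors ?s"
    then have "multiplicity p ?s > 0" by (simp add: prime_factors_multiplicity)
    moreover have "multiplicity p ?s \<le> Suc 0" using p by (intro prime_multiplicity_squarefree_part_le_Suc_0) auto
    ultimately have "multiplicity p ?s = 1" by linarith
    then show "p ^ multiplicity p ?s = p" by simp
  qed
  also have "prime_factors ?s = {p. prime p \<and> p dvd ?s}" using s by (auto simp: prime_factors_dvd)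
  finally show ?thesis .
qed

lemma prod_prime_subset_le:
  fixes A B :: "nat set"
  assumes "finite B" "A \<subseteq> B" "\<And>p. p \<in> B \<Longrightarrow> prime p"
  shows "\<Prod>A \<le> \<Prod>B"
proof -
  have "\<Prod>B = \<Prod>A * \<Prod>(B - A)" using assms(1,2) by (metis prod.subset_diff mult.commute)
  moreover have "\<Prod>(B - A) > 0" using assms(3) prime_gt_0_nat by (intro prod_pos) blast
  ultimately show ?thesis by simp
qed

lemma finite_prime_divisors_pred:
  assumes "m > (0::nat)" shows "finite {p. prime p \<and> P p \<and> p dvd m \<and> R p}"
  by (rule finite_subset[of _ "{..m}"]) (use assms in \<open>auto dest: dvd_imp_le\<close>)

text \<open>
  The primes congruent to \<open>1\<close>, and those congruent to \<open>3\<close> above \<open>z'\<close>, that divide \<open>m\<close> exactly once form \<open>M\<close>. The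
  cofactor \<open>r\<close> is made of the square part and of primes up to \<open>z\<close>, hence \<open>r \<le> D\<^sup>2 * sqrt z'\<close>. Since
  \<open>r * sqrt M = sqrt m * sqrt r\<close>, it loses \<open>D * z'^(1/4)\<close> against the saving \<open>sqrt z'\<close>.
\<close>

lemma card_square_difference_free_gap_le:
  fixes A :: "int set" and m :: nat
  assumes m: "m > 0" and D: "real (square_part m) \<le> D" "D \<le> z" and z: "2 \<le> z" "z \<le> z'"
    and gap: "\<And>p. prime p \<Longrightarrow> p mod 4 = 3 \<Longrightarrow> p dvd m \<Longrightarrow> z < real p \<Longrightarrow> z' < real p"
    and odd: "odd (card {p. prime p \<and> p mod 4 = 3 \<and> p dvd m \<and> z' < real p})"
    and rad: "real (smooth_radical z m) \<le> sqrt z'"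
    and A: "A \<subseteq> carrier (residue_ring (int m))"
    and free: "difference_set (residue_ring (int m)) A \<inter> squares (residue_ring (int m)) =
      {\<zero>\<^bsub>residue_ring (int m)\<^esub>}"
    and k: "k = card {p. prime p \<and> p mod 4 = 3 \<and> p dvd m \<and> z' < real p}"
  shows "real (card A) \<le> sqrt (real m) * (D * (3 * real k) ^ k / z' powr (1/4))"
proof -
  let ?d = "square_part m" and ?s = "squarefree_part m"
  define S1 where "S1 = {p. prime p \<and> p mod 4 = 1 \<and> p dvd m \<and> \<not> p dvd ?d}"
  define S3 where "S3 = {p. prime p \<and> p mod 4 = 3 \<and> p dvd m \<and> z' < real p}"
  define M where "M = \<Prod>(S1 \<union> S3)"
  have fin: "finite S1" "finite S3"
    unfolding S1_def S3_def by (rule finite_prime_divisors_pred[OF m])+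
  have d0: "?d > 0" using m by (intro Nat.gr0I) auto
  have pr: "prime p" "p dvd m" if "p \<in> S1 \<union> S3" for p using that by (auto simp: S1_def S3_def)
  have nd: "\<not> p dvd ?d" if "p \<in> S1 \<union> S3" for p
  proof (cases "p \<in> S1")
    case False
    then have "z' < real p" using that by (auto simp: S3_def)
    then have "?d < p" using D z by linarith
    then show ?thesis using d0 by (auto dest: dvd_imp_le)
  qed (auto simp: S1_def)
  have "M dvd m" unfolding M_def using fin pr by (intro prod_primes_dvd) auto
  then obtain r where r: "m = r * M" by (metis dvd_def mult.commute)
  have M0: "M > 0" and r0: "r > 0" using r m by (auto intro: Nat.gr0I)
  have cop: "coprime r M"
    unfolding M_def
  proof (rule prod_coprime_right)
    fix p assume p: "p \<in> S1 \<union> S3"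
    show "coprime r p"
    proof (rule ccontr)
      assume "\<not> coprime r p"
      then have "p dvd r" using pr(1)[OF p] by (metis coprime_commute prime_imp_coprime)
      moreover have "p dvd M" unfolding M_def using fin p by (intro dvd_prodI) auto
      ultimately have "p\<^sup>2 dvd m" unfolding r power2_eq_square by (rule mult_dvd_mono)
      then show False using nd[OF p] by (simp add: dvd_square_part_iff)
    qed
  qed
  have s_le: "?s \<le> M * smooth_radical z m"
  proof -
    let ?R = "{p. prime p \<and> real p \<le> z \<and> p dvd m}"
    have finR: "finite ?R" by (rule finite_subset[OF _ finite_primes_real_le[of z]]) auto
    have sub: "{p. prime p \<and> p dvd ?s} \<subseteq> (S1 \<union> S3) \<union> ?R"
    proof
      fix p assume "p \<in> {p. prime p \<and> p dvd ?s}"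
      moreover have "?s dvd m" using squarefree_decompose[of m] by (metis dvd_triv_left)
      ultimately have p: "prime p" "p dvd m" by (auto intro: dvd_trans)
      show "p \<in> (S1 \<union> S3) \<union> ?R"
      proof (rule ccontr)
        assume *: "p \<notin> (S1 \<union> S3) \<union> ?R"
        then have pz: "z < real p" using p by auto
        have "\<not> p dvd ?d" using pz D d0 by (auto dest!: dvd_imp_le)
        then have "p mod 4 \<noteq> 1" using * p by (auto simp: S1_def)
        moreover have "p mod 4 \<noteq> 3" using * p gap[OF p(1) _ p(2) pz] by (auto simp: S3_def)
        moreover have "odd p" using p pz z prime_odd_nat[of p] by auto
        ultimately show False by presburger
      qed
    qed
    have "?s \<le> \<Prod>((S1 \<union> S3) \<union> ?R)"
      by (subst squarefree_part_eq_prod[OF m]) (rule prod_prime_subset_le, use fin finR sub pr in auto)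
    also have "(S1 \<union> S3) \<union> ?R = (S1 \<union> S3) \<union> (?R - (S1 \<union> S3))" by auto
    also have "\<Prod>\<dots> = M * \<Prod>(?R - (S1 \<union> S3))"
      unfolding M_def using fin finR by (intro prod.union_disjoint) auto
    also have "\<dots> \<le> M * \<Prod>?R"
      using finR by (intro mult_left_mono prod_prime_subset_le) auto
    finally show ?thesis by (simp add: smooth_radical_def)
  qed
  have z'0: "z' > 0" using z by linarith
  have D0: "D \<ge> 1" using d0 D by linarith
  have "real r * real M = real ?s * (real ?d)\<^sup>2"
    using squarefree_decompose[of m] r by (metis of_nat_mult of_nat_power)
  also have "\<dots> \<le> (real M * sqrt z') * D\<^sup>2"
  proof (intro mult_mono power_mono D)
    have "real ?s \<le> real M * real (smooth_radical z m)" using s_le by (metis of_nat_le_iff of_nat_mult)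
    also have "\<dots> \<le> real M * sqrt z'" using rad by (intro mult_left_mono) auto
    finally show "real ?s \<le> real M * sqrt z'" .
  qed (use z'0 in auto)
  finally have "real r * real M \<le> (D\<^sup>2 * sqrt z') * real M" by (simp add: mult_ac)
  then have "real r \<le> D\<^sup>2 * sqrt z'" using M0 by simp
  then have "sqrt (real r) \<le> sqrt (D\<^sup>2 * sqrt z')" by simp
  also have "\<dots> = D * z' powr (1/4)"
    using D0 z'0 by (simp add: real_sqrt_mult powr_half_sqrt[symmetric] powr_powr)
  finally have r_le: "sqrt (real r) \<le> D * z' powr (1/4)" .
  have "real (card A) \<le> real r * (sqrt (real M) * (3 * real (card S3)) ^ card S3 / sqrt z')"
    unfolding M_def
  proof (rule card_square_difference_free_residue_le[OF _ r0 _ A free fin])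
    show "m = r * \<Prod>(S1 \<union> S3)" "coprime r (\<Prod>(S1 \<union> S3))" using r cop by (simp_all add: M_def)
    show "odd (card S3)" using odd by (simp add: S3_def)
  qed (use z'0 in \<open>auto simp: S1_def S3_def\<close>)
  also have "\<dots> = sqrt (real m) * (sqrt (real r) * (3 * real k) ^ k / sqrt z')"
    using r by (simp add: real_sqrt_mult k S3_def)
  also have "\<dots> \<le> sqrt (real m) * (D * z' powr (1/4) * (3 * real k) ^ k / sqrt z')"
    using r_le z'0 by (intro mult_left_mono divide_right_mono mult_right_mono) auto
  also have "z' powr (1/4) = sqrt z' / z' powr (1/4)"
    using z'0 by (simp add: powr_half_sqrt[symmetric] powr_diff[symmetric])
  also have "D * (sqrt z' / z' powr (1/4)) * (3 * real k) ^ k / sqrt z' = D * (3 * real k) ^ k / z' powr (1/4)"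
    using z'0 by simp
  finally show ?thesis .
qed

lemma sum_ln_eq_ln_prod:
  fixes S :: "nat set"
  assumes "\<And>p. p \<in> S \<Longrightarrow> prime p"
  shows "ln (real (\<Prod>S)) = (\<Sum>p\<in>S. ln (real p))"
proof (cases "finite S")
  case True
  have "real p > 0" if "p \<in> S" for p using prime_gt_0_nat[OF assms[OF that]] by simp
  then show ?thesis unfolding of_nat_prod using True by (subst ln_prod) auto
qed simp

lemma ln_le_sum_prime_divisors:
  fixes m :: nat
  assumes "m > 0"
  shows "ln (real m) \<le> 2 * ln (real (square_part m)) + (\<Sum>p | prime p \<and> p dvd m. ln (real p))"
proof -
  let ?d = "square_part m" and ?s = "squarefree_part m"
  have d: "?d > 0" using assms by (intro Nat.gr0I) auto
  have s: "?s > 0" by (intro Nat.gr0I) auto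
  have fin: "finite {p. prime p \<and> p dvd m}"
    using assms finite_prime_divisors by auto
  have sm: "?s dvd m" using squarefree_decompose[of m] by (metis dvd_triv_left)
  have "real m = real ?s * (real ?d)\<^sup>2"
    using squarefree_decompose[of m] by (metis of_nat_mult of_nat_power)
  then have "ln (real m) = ln (real ?s) + 2 * ln (real ?d)"
    using d s by (simp add: ln_mult ln_realpow)
  also have "ln (real ?s) = (\<Sum>p | prime p \<and> p dvd ?s. ln (real p))"
    by (subst squarefree_part_eq_prod[OF assms]) (rule sum_ln_eq_ln_prod, simp)
  also have "\<dots> \<le> (\<Sum>p | prime p \<and> p dvd m. ln (real p))"
    using sm by (intro sum_mono2[OF fin]) (auto intro: dvd_trans simp: Suc_leI prime_gt_0_nat)
  finally show ?thesis by simp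
qed

text \<open>
  Here \<open>s\<close> stands for \<open>1 / sqrt \<epsilon>\<close>, \<open>X\<close> for \<open>ln x\<close>, \<open>v\<close> for \<open>ln z'\<close>, \<open>l\<close> for \<open>ln D\<close> and \<open>y\<close> for \<open>ln m\<close>. All losses are
  \<open>O(X / s\<^sup>2)\<close>, that is \<open>O(\<epsilon> X)\<close>, while the saving \<open>v / 4\<close> is of order \<open>sqrt \<epsilon> X\<close>.
\<close>

lemma saving_inequality:
  fixes s X k v l y \<epsilon> :: real
  assumes s: "17 \<le> s" and X: "s ^ 4 \<le> X" and k: "1 \<le> k" "k \<le> s" and v: "X / s \<le> v"
    and l: "l \<le> s\<^sup>2" and y: "0 \<le> y" "y \<le> X" and \<epsilon>: "\<epsilon> = 1 / s\<^sup>2"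
  shows "l + k * ln (3 * k) - v / 4 \<le> - (\<epsilon> / 5) * y"
proof -
  define Y where "Y = X / s\<^sup>2"
  have s0: "s > 0" using s by linarith
  have Y: "s\<^sup>2 \<le> Y"
  proof -
    have "s\<^sup>2 * s\<^sup>2 \<le> X" using X by (simp add: power2_eq_square power4_eq_xxxx mult.assoc)
    then show ?thesis using s0 by (simp add: Y_def pos_le_divide_eq)
  qed
  have "k * ln (3 * k) \<le> s * (3 * s)"
  proof (rule mult_mono)
    have "ln (3 * k) \<le> 3 * k - 1" using k by (intro ln_le_minus_one) auto
    then show "ln (3 * k) \<le> 3 * s" using k by linarith
  qed (use k s in auto)
  then have kk: "k * ln (3 * k) \<le> 3 * Y" using Y by (simp add: power2_eq_square)
  have "\<epsilon> * y \<le> Y" using y s0 by (simp add: \<epsilon> Y_def divide_right_mono)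
  moreover have "17 * Y \<le> v"
  proof -
    have "Y \<ge> 0" using Y by (smt (verit) zero_le_power2)
    then have "17 * Y \<le> s * Y" using s by (intro mult_right_mono)
    also have "\<dots> = X / s" using s0 by (simp add: Y_def power2_eq_square)
    finally show ?thesis using v by linarith
  qed
  moreover have "0 \<le> Y" using Y order_trans zero_le_power2 by blast
  ultimately show ?thesis using kk l Y by simp
qed

text \<open>
  The requirements on the parameters \<open>T = L^(1/8)\<close> and \<open>J \<approx> L / ln L\<close>, all true for large \<open>L\<close>. The
  second line says that \<open>3 J\<close> steps by the exponent \<open>T\<close>, starting from \<open>x^(1/(2T))\<close>, do not lead below
  \<open>x^(sqrt \<epsilon>)\<close>. The fourth and fifth bound the exceptional proportions due to smooth parts and to the sieve.
\<close>

lemma parameter_asymptotics: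
  fixes c C :: real
  assumes "c > 0"
  shows "\<exists>L0. \<forall>L\<ge>L0. 8 \<le> L \<and> 2 \<le> L powr (1/8) \<and>
    ln 2 + (3 * (L / ln L) + 1) * (ln L / 8) \<le> L / 2 \<and>
    C \<le> exp (3 * L / 2) \<and>
    (3 * (L / ln L) + 1) * exp (- (L powr (1/8) / 2)) \<le> exp (- (L powr (1/10))) \<and>
    exp (- (c / (L powr (1/8)) ^ 3) * (L / ln L - 1)) \<le> exp (- (L powr (1/10))) \<and>
    8 * L powr (1/10) \<le> exp (2 * L)"
proof -
  have 1: "eventually (\<lambda>L::real. 8 \<le> L) at_top" by real_asymp
  have 2: "eventually (\<lambda>L::real. 2 \<le> L powr (1/8)) at_top" by real_asymp
  have 3: "eventually (\<lambda>L::real. ln 2 + (3 * (L / ln L) + 1) * (ln L / 8) \<le> L / 2) at_top" by real_asymp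
  have 4: "eventually (\<lambda>L::real. C \<le> exp (3 * L / 2)) at_top" by real_asymp
  have 5: "eventually (\<lambda>L::real. (3 * (L / ln L) + 1) * exp (- (L powr (1/8) / 2)) \<le> exp (- (L powr (1/10)))) at_top"
    by real_asymp
  have 6: "eventually (\<lambda>L::real. exp (- (c / (L powr (1/8)) ^ 3) * (L / ln L - 1)) \<le> exp (- (L powr (1/10)))) at_top"
    using assms by real_asymp
  have 7: "eventually (\<lambda>L::real. 8 * L powr (1/10) \<le> exp (2 * L)) at_top" by real_asymp
  from 1 2 3 4 5 6 7 show ?thesis
    unfolding eventually_at_top_linorder[symmetric] by eventually_elim auto
qed

definition square_difference_bound :: "real \<Rightarrow> nat \<Rightarrow> bool" where
  "square_difference_bound \<epsilon> m \<longleftrightarrow>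
    (\<forall>A. A \<subseteq> carrier (residue_ring (int m)) \<longrightarrow>
      difference_set (residue_ring (int m)) A \<inter> squares (residue_ring (int m))
        = {\<zero>\<^bsub>residue_ring (int m)\<^esub>} \<longrightarrow>
      real (card A) \<le> real m powr (1/2 - \<epsilon>/5))"

text \<open>
  The number \<open>k\<close> of large primes is at most \<open>1 / sqrt \<epsilon>\<close>, since each of them exceeds \<open>x^(sqrt \<epsilon>)\<close> and their
  product divides \<open>m\<close>. This keeps the factor \<open>(3 k)^k\<close> harmless, and it is the reason for stopping the
  windows at \<open>x^(sqrt \<epsilon>)\<close>.
\<close>

lemma square_difference_bound_of_gap:
  fixes L X a0 a1 \<epsilon> :: real
  assumes m: "m > 0" "ln (real m) \<le> X" and L: "8 \<le> L" and X: "exp (2 * L) \<le> X" and \<epsilon>: "\<epsilon> = exp (- L)"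
    and a: "X * exp (- (L / 2)) \<le> a1" "a1 \<le> a0"
    and D: "real (square_part m) \<le> exp (L powr (1/10))"
    and gap: "\<And>p. prime p \<Longrightarrow> p mod 4 = 3 \<Longrightarrow> p dvd m \<Longrightarrow> exp a1 < real p \<Longrightarrow> exp a0 < real p"
    and odd: "odd (card {p. prime p \<and> p mod 4 = 3 \<and> p dvd m \<and> exp a0 < real p})"
    and rad: "real (smooth_radical (exp a1) m) \<le> exp (a0 / 2)"
  shows "square_difference_bound \<epsilon> m"
  unfolding square_difference_bound_def
proof (intro allI impI)
  fix A :: "int set"
  assume A: "A \<subseteq> carrier (residue_ring (int m))"
    and free: "difference_set (residue_ring (int m)) A \<inter> squares (residue_ring (int m))
        = {\<zero>\<^bsub>residue_ring (int m)\<^esub>}"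
  define s where "s = exp (L / 2)"
  define S where "S = {p. prime p \<and> p mod 4 = 3 \<and> p dvd m \<and> exp a0 < real p}"
  define k where "k = card S"
  define l where "l = L powr (1/10)"
  have s4: "s ^ 4 = exp (2 * L)" by (simp add: s_def flip: exp_of_nat_mult)
  have s2: "s\<^sup>2 = exp L" by (simp add: s_def flip: exp_of_nat_mult)
  have s17: "17 \<le> s"
  proof -
    have "1 + 2 + 2\<^sup>2 / 2 \<le> exp (2::real)" by (rule exp_lower_Taylor_quadratic) simp
    then have "5 * 5 \<le> exp (2::real) * exp 2" by (intro mult_mono) auto
    also have "\<dots> = exp 4" by (simp flip: exp_add)
    also have "\<dots> \<le> s" using L by (simp add: s_def)
    finally show ?thesis by simp
  qed
  have Xs: "X * exp (- (L / 2)) = X / s" by (simp only: s_def exp_minus divide_inverse)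
  have s0: "s > 0" by (simp add: s_def)
  have X0: "X > 0" using X exp_gt_zero[of "2 * L"] by linarith
  have l_le: "l \<le> L"
    using L powr_mono[of "1/10" 1 L] by (simp add: l_def)
  have L_le: "L \<le> s\<^sup>2" unfolding s2 using exp_ge_add_one_self[of L] by linarith
  have a1: "s\<^sup>2 \<le> a1"
  proof -
    have "s\<^sup>2 * s \<le> s ^ 4" using s17 power_increasing[of 3 4 s] by (simp add: power2_eq_square power3_eq_cube)
    then have "s\<^sup>2 \<le> X / s" using X s0 unfolding s4 by (simp add: pos_le_divide_eq)
    then show ?thesis using a(1) Xs by linarith
  qed
  have finS: "finite S" unfolding S_def by (rule finite_prime_divisors_pred[OF m(1)])
  have k1: "1 \<le> k" using odd unfolding k_def S_def by (metis Suc_leI odd_pos One_nat_def)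
  have ks: "real k \<le> s"
  proof -
    have "\<Prod>S dvd m" using finS by (intro prod_primes_dvd) (auto simp: S_def)
    then have "\<Prod>S \<le> m" using m(1) by (rule dvd_imp_le)
    moreover have "0 < \<Prod>S" using prime_gt_0_nat by (intro prod_pos) (auto simp: S_def)
    ultimately have "ln (real (\<Prod>S)) \<le> ln (real m)"
      using m(1) by (subst ln_le_cancel_iff) (simp_all only: of_nat_le_iff of_nat_0_less_iff)
    also have "ln (real (\<Prod>S)) = (\<Sum>p\<in>S. ln (real p))" by (rule sum_ln_eq_ln_prod) (simp add: S_def)
    finally have "(\<Sum>p\<in>S. ln (real p)) \<le> X" using m(2) by linarith
    moreover have "(\<Sum>p\<in>S. a0) \<le> (\<Sum>p\<in>S. ln (real p))"
    proof (rule sum_mono)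
      fix p assume "p \<in> S"
      then have "exp a0 < real p" "0 < real p" using prime_gt_0_nat by (auto simp: S_def)
      then show "a0 \<le> ln (real p)" by (simp add: ln_ge_iff)
    qed
    ultimately have "real k * a0 \<le> X" by (simp add: k_def)
    moreover have "real k * (X / s) \<le> real k * a0" using a Xs by (intro mult_left_mono) auto
    ultimately have "real k * (X / s) \<le> X" by linarith
    then show ?thesis using X0 s0 by (simp add: field_simps)
  qed
  have "real (card A) \<le> sqrt (real m) * (exp l * (3 * real k) ^ k / exp a0 powr (1/4))"
  proof (rule card_square_difference_free_gap_le[OF m(1) _ _ _ _ gap _ _ A free])
    show "real (square_part m) \<le> exp l" using D by (simp add: l_def)
    show "exp l \<le> exp a1" using l_le L_le a1 by simp
    have "1 \<le> a1" using a1 L_le L by linarith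
    then have "1 + 1 \<le> exp a1" using exp_ge_add_one_self[of a1] by linarith
    then show "2 \<le> exp a1" by simp
    show "exp a1 \<le> exp a0" using a by simp
    show "real (smooth_radical (exp a1) m) \<le> sqrt (exp a0)"
      using rad by (simp add: powr_half_sqrt[symmetric] powr_def)
  qed (use odd in \<open>simp_all add: k_def S_def\<close>)
  also have "exp l * (3 * real k) ^ k / exp a0 powr (1/4) = exp (l + real k * ln (3 * real k) - a0 / 4)"
  proof -
    have "(3 * real k) ^ k = exp (real k * ln (3 * real k))"
      using k1 by (simp add: exp_of_nat_mult)
    then show ?thesis by (simp add: exp_add exp_diff powr_def)
  qed
  also have "l + real k * ln (3 * real k) - a0 / 4 \<le> - (\<epsilon> / 5) * ln (real m)"
  proof (rule saving_inequality[OF s17])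
    show "s ^ 4 \<le> X" using X by (simp add: s4)
    show "X / s \<le> a0" using a Xs by linarith
    show "l \<le> s\<^sup>2" using l_le L_le by linarith
    show "0 \<le> ln (real m)" using m(1) by simp
    show "\<epsilon> = 1 / s\<^sup>2" by (simp only: \<epsilon> s2 exp_minus inverse_eq_divide)
  qed (use k1 ks m(2) in auto)
  finally have "real (card A) \<le> sqrt (real m) * exp (- (\<epsilon> / 5) * ln (real m))"
    by (simp add: mult_left_mono)
  also have "\<dots> = real m powr (1/2 - \<epsilon>/5)"
  proof -
    have "real m powr (1/2 - \<epsilon>/5) = real m powr (1/2) * real m powr (- (\<epsilon>/5))"
      by (simp flip: powr_add)
    also have "real m powr (- (\<epsilon>/5)) = exp (- (\<epsilon>/5) * ln (real m))"
      using m(1) by (simp add: powr_def)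
    also have "real m powr (1/2) = sqrt (real m)" by (simp add: powr_half_sqrt)
    finally show ?thesis by simp
  qed
  finally show "real (card A) \<le> real m powr (1/2 - \<epsilon>/5)" .
qed

section \<open>Almost every modulus has such a gap\<close>

definition window :: "real \<Rightarrow> real \<Rightarrow> nat set" where
  "window b T = {p. prime p \<and> p mod 4 = 3 \<and> exp b < real p \<and> real p \<le> exp (b * T ^ 3)}"

text \<open>
  With \<open>U\<close> the set of prime divisors of \<open>m\<close> in the window, the two outer pieces of the window are free of
  them and can serve as gaps.
\<close>

definition good_pattern :: "real \<Rightarrow> real \<Rightarrow> nat set \<Rightarrow> bool" where
  "good_pattern b T U \<longleftrightarrow> (\<exists>p. U = {p} \<and> exp (b * T) < real p \<and> real p \<le> exp (b * T\<^sup>2))"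

text \<open>
  The three pieces of the window end at \<open>b T\<close>, \<open>b T\<^sup>2\<close> and \<open>b T\<^sup>3\<close> on the logarithmic scale. The probability of
  having one given prime of the middle piece and no other is at least \<open>1/p\<close> times the product of \<open>1 - 1/q\<close>
  over the whole window, which is of order \<open>T^(-3)\<close> even if all primes are counted. The reciprocals of the primes
  congruent to \<open>3\<close> in the middle piece have a sum bounded below.
\<close>

lemma window_weight_ge:
  "\<exists>B::real. \<forall>b T. B \<le> b \<longrightarrow> 2 \<le> T \<longrightarrow>
     exp (- 13) / 8 / T ^ 3 \<le> (\<Sum>U | U \<subseteq> window b T \<and> good_pattern b T U. sieve_weight (window b T) U)"
proof -
  obtain C where C: "\<And>y z. 1 \<le> y \<Longrightarrow> y \<le> z \<Longrightarrow>
     (ln z - ln y) / 2 - C \<le> (\<Sum>p | prime p \<and> p mod 4 = 3 \<and> y < real p \<and> real p \<le> z. ln (real p) / real p)"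
    using sum_ln_prime_3mod4_real_ge by blast
  show ?thesis
  proof (intro exI[of _ "max 2 (8 * C)"] allI impI)
    fix b T :: real assume b: "max 2 (8 * C) \<le> b" and T: "2 \<le> T"
    define W where "W = window b T"
    note W_def = W_def[unfolded window_def]
    define V where "V = {p. prime p \<and> p mod 4 = 3 \<and> exp (b * T) < real p \<and> real p \<le> exp (b * T\<^sup>2)}"
    have b2: "2 \<le> b" "C \<le> b / 8" using b by auto
    have T1: "1 \<le> T" "T \<le> T\<^sup>2" "T\<^sup>2 \<le> T ^ 3" "1 \<le> T ^ 3"
      using T power_increasing[of 1 2 T] power_increasing[of 2 3 T] power_increasing[of 0 3 T] by auto
    have mono: "b \<le> b * T" "b * T \<le> b * T\<^sup>2" "b * T\<^sup>2 \<le> b * T ^ 3" "b \<le> b * T ^ 3"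
      using b2 T1 mult_left_mono[of 1 T b] mult_left_mono[of 1 "T ^ 3" b]
      by (auto intro!: mult_left_mono)
    have VW: "V \<subseteq> W"
      unfolding V_def W_def using mono by (auto intro: le_less_trans[of "exp b"] order_trans)
    have finW: "finite W" unfolding W_def by (rule finite_subset[OF _ finite_primes_real_le]) auto
    then have finV: "finite V" using VW finite_subset by blast
    have prW: "prime p" if "p \<in> W" for p using that by (simp add: W_def)
    have one: "0 < 1 - 1 / real p" "1 - 1 / real p \<le> 1" if "p \<in> W" for p
      using prime_gt_1_nat[OF prW[OF that]] by auto
    have prodW: "exp (- 13) / T ^ 3 \<le> (\<Prod>p\<in>W. 1 - 1 / real p)"
    proof -
      have "(\<Sum>p\<in>W. 1 / real p) \<le> (\<Sum>p | prime p \<and> exp b < real p \<and> real p \<le> exp (b * T ^ 3). 1 / real p)"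
        unfolding W_def by (intro sum_mono2 finite_subset[OF _ finite_primes_real_le[of "exp (b * T ^ 3)"]]) auto
      also have "\<dots> \<le> ln (ln (exp (b * T ^ 3))) - ln (ln (exp b)) + 12"
      proof (rule sum_inverse_prime_real_le)
        have "(4::real) \<le> 1 + 2 + 2\<^sup>2 / 2" by simp
        also have "\<dots> \<le> exp 2" by (rule exp_lower_Taylor_quadratic) simp
        also have "\<dots> \<le> exp b" using b2 by simp
        finally show "4 \<le> exp b" .
        show "exp b \<le> exp (b * T ^ 3)" using mono by simp
      qed
      also have "\<dots> = ln (T ^ 3) + 12" using b2 T1 by (simp add: ln_mult)
      finally have "(\<Sum>p\<in>W. 1 / real p) + 1 \<le> ln (T ^ 3) + 13" by simp
      then have "exp ((\<Sum>p\<in>W. 1 / real p) + 1) \<le> exp (ln (T ^ 3) + 13)" by simp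
      also have "\<dots> = T ^ 3 * exp 13" using T1 by (simp add: exp_add)
      finally have "(\<Prod>p\<in>W. 1 / (1 - 1 / real p)) \<le> T ^ 3 * exp 13"
        using prod_inverse_one_minus_prime_le[OF finW prW] by linarith
      then have "1 / (\<Prod>p\<in>W. 1 - 1 / real p) \<le> T ^ 3 * exp 13"
        by (simp add: prod_dividef)
      moreover have "0 < (\<Prod>p\<in>W. 1 - 1 / real p)" using one by (intro prod_pos) auto
      ultimately show ?thesis using T1 by (simp add: exp_minus field_simps)
    qed
    have sumV: "1 / 8 \<le> (\<Sum>p\<in>V. 1 / real p)"
    proof -
      have pos: "0 < b * T\<^sup>2" using b2 T1 by simp
      have "b * T\<^sup>2 / 8 \<le> (b * T\<^sup>2 - b * T) / 2 - C"
      proof -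
        have "b * (2 * T) \<le> b * T\<^sup>2" using b2 T by (intro mult_left_mono) (auto simp: power2_eq_square)
        then have "2 * (b * T) \<le> b * T\<^sup>2" by simp
        moreover have "b \<le> b * T\<^sup>2" using mono by linarith
        ultimately have "b * T\<^sup>2 / 8 \<le> b * T\<^sup>2 / 2 - b * T / 2 - C" using b2 by linarith
        then show ?thesis by (simp add: diff_divide_distrib)
      qed
      also have "\<dots> = (ln (exp (b * T\<^sup>2)) - ln (exp (b * T))) / 2 - C" by simp
      also have "\<dots> \<le> (\<Sum>p\<in>V. ln (real p) / real p)"
        unfolding V_def using mono b2 by (intro C) auto
      also have "\<dots> \<le> (\<Sum>p\<in>V. b * T\<^sup>2 * (1 / real p))"
      proof (rule sum_mono)
        fix p assume p: "p \<in> V"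
        then have "0 < real p" using prW VW prime_gt_0_nat by auto
        then have "ln (real p) \<le> ln (exp (b * T\<^sup>2))" using p by (subst ln_le_cancel_iff) (auto simp: V_def)
        then show "ln (real p) / real p \<le> b * T\<^sup>2 * (1 / real p)" by (simp add: divide_right_mono)
      qed
      also have "\<dots> = b * T\<^sup>2 * (\<Sum>p\<in>V. 1 / real p)" by (simp add: sum_distrib_left)
      finally have "b * T\<^sup>2 * (1 / 8) \<le> b * T\<^sup>2 * (\<Sum>p\<in>V. 1 / real p)" by simp
      then show ?thesis using pos by (simp only: mult_le_cancel_left_pos)
    qed
    have "exp (- 13) / 8 / T ^ 3 = 1 / 8 * (exp (- 13) / T ^ 3)" by simp
    also have "\<dots> \<le> (\<Sum>p\<in>V. 1 / real p) * (\<Prod>p\<in>W. 1 - 1 / real p)"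
      using sumV prodW T1 by (intro mult_mono) (auto intro: sum_nonneg)
    also have "\<dots> = (\<Sum>p\<in>V. 1 / real p * (\<Prod>q\<in>W. 1 - 1 / real q))" by (simp add: sum_distrib_right)
    also have "\<dots> \<le> (\<Sum>p\<in>V. sieve_weight W {p})"
    proof (rule sum_mono)
      fix p assume p: "p \<in> V"
      have "(\<Prod>q\<in>W. 1 - 1 / real q) = (1 - 1 / real p) * (\<Prod>q\<in>W - {p}. 1 - 1 / real q)"
        using finW p VW by (intro prod.remove) auto
      also have "\<dots> \<le> 1 * (\<Prod>q\<in>W - {p}. 1 - 1 / real q)"
        using one p VW by (intro mult_right_mono prod_nonneg) (auto intro: less_imp_le)
      finally show "1 / real p * (\<Prod>q\<in>W. 1 - 1 / real q) \<le> sieve_weight W {p}"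
        by (simp add: sieve_weight_def divide_right_mono)
    qed
    also have "\<dots> = (\<Sum>U\<in>(\<lambda>p. {p}) ` V. sieve_weight W U)"
      by (subst sum.reindex) auto
    also have "(\<lambda>p. {p}) ` V = {U. U \<subseteq> window b T \<and> good_pattern b T U}"
      using VW by (auto simp: V_def W_def window_def good_pattern_def)
    finally show "exp (- 13) / 8 / T ^ 3 \<le>
        (\<Sum>U | U \<subseteq> window b T \<and> good_pattern b T U. sieve_weight (window b T) U)"
      by (simp add: W_def window_def)
  qed
qed

text \<open>
  An \<open>m\<close> is exceptional only if its square part is large (\<open>B1\<close>), a smooth part is large at some cut point (\<open>B2\<close>),
  \<open>m\<close> itself is small (\<open>B3\<close>), or no window is good (\<open>B4\<close>).
\<close>

lemma card_exceptional_le: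
  fixes x \<epsilon> L B c :: real
  defines "T \<equiv> L powr (1/8)"
  assumes c: "c = exp (- 13) / 8"
    and window: "\<And>b T::real. B \<le> b \<Longrightarrow> 2 \<le> T \<Longrightarrow>
      c / T ^ 3 \<le> (\<Sum>U | U \<subseteq> window b T \<and> good_pattern b T U. sieve_weight (window b T) U)"
    and x: "0 < x" and \<epsilon>: "\<epsilon> = exp (- L)" and X: "exp (2 * L) \<le> ln x"
    and L8: "8 \<le> L" and T2: "2 \<le> T"
    and low: "ln 2 + (3 * (L / ln L) + 1) * (ln L / 8) \<le> L / 2"
    and B: "B \<le> exp (3 * L / 2)"
    and smooth: "(3 * (L / ln L) + 1) * exp (- (T / 2)) \<le> exp (- (L powr (1/10)))"
    and sieve: "exp (- (c / T ^ 3) * (L / ln L - 1)) \<le> exp (- (L powr (1/10)))"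
    and D8: "8 * L powr (1/10) \<le> exp (2 * L)"
  shows "real (card {m. 0 < m \<and> real m \<le> x \<and> \<not> square_difference_bound \<epsilon> m})
    \<le> (3 + exp 12 + 16 * exp 14) * exp (- (L powr (1/10))) * x"
proof -
  let ?E = "{m. 0 < m \<and> real m \<le> x \<and> \<not> square_difference_bound \<epsilon> m}"
  define X where "X = ln x"
  define l where "l = L powr (1/10)"
  define N where "N = nat \<lfloor>x\<rfloor>"
  define J where "J = nat \<lfloor>L / ln L\<rfloor>"
  \<comment> \<open>The cut points are \<open>exp (a j)\<close>; window \<open>i\<close> lies between the cut points \<open>3 i + 3\<close> and \<open>3 i\<close>.\<close>
  define a where "a j = X / (2 * T ^ (j + 1))" for j :: nat
  define W where "W i = window (a (3 * i + 3)) T" for i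
  define G where "G i = good_pattern (a (3 * i + 3)) T" for i
  define WW where "WW = (\<Union>i<J. W i)"
  define F where "F = {U. \<forall>i<J. \<not> G i (U \<inter> W i)}"

  have X_ge: "exp (2 * L) \<le> X" using X by (simp add: X_def)
  have X0: "X > 0" using X_ge exp_gt_zero[of "2 * L"] by linarith
  have X1: "1 + 2 * L \<le> X" using X_ge exp_ge_add_one_self[of "2 * L"] by linarith
  have x_eq: "x = exp X" using x by (simp add: X_def)
  have x2: "2 \<le> x" unfolding x_eq using X1 L8 exp_ge_add_one_self[of X] by linarith
  have N: "real N \<le> x" "2 \<le> N"
    using x2 by (auto simp: N_def le_nat_iff le_floor_iff)
  have mN: "0 < m \<and> real m \<le> x \<longleftrightarrow> m \<in> {1..N}" for m
    using x by (auto simp: N_def le_nat_iff le_floor_iff)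
  have T0: "T > 0" using T2 by simp
  have lnL: "ln L > 0" using L8 by simp
  have lnT: "ln T = ln L / 8" using L8 by (simp add: T_def ln_powr)
  have J: "real J \<le> L / ln L" "L / ln L - 1 \<le> real J"
    using L8 lnL by (auto simp: J_def)
  have l: "0 \<le> l" "l \<le> L" using L8 powr_mono[of "1/10" 1 L] by (auto simp: l_def)

  have l8: "8 * l \<le> X" using D8 X_ge by (simp add: l_def)
  have c0: "0 \<le> c" by (simp add: c)

  have a_Suc: "a (Suc j) * T = a j" for j using T0 by (simp add: a_def field_simps)
  have a3: "a (3 * i + 3) * T ^ 3 = a (3 * i)" "a (3 * i + 3) * T\<^sup>2 = a (3 * i + 1)" "a (3 * i + 3) * T = a (3 * i + 2)" for i
  proof -
    have s: "a (3 * i + 3) * T = a (3 * i + 2)" "a (3 * i + 2) * T = a (3 * i + 1)" "a (3 * i + 1) * T = a (3 * i)"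
      using a_Suc[of "3 * i + 2"] a_Suc[of "3 * i + 1"] a_Suc[of "3 * i"]
      by (simp_all add: numeral_2_eq_2 numeral_3_eq_3)
    then show "a (3 * i + 3) * T = a (3 * i + 2)" by simp
    have "a (3 * i + 3) * T\<^sup>2 = a (3 * i + 3) * T * T" by (simp add: power2_eq_square)
    then show "a (3 * i + 3) * T\<^sup>2 = a (3 * i + 1)" by (simp only: s)
    have "a (3 * i + 3) * T ^ 3 = a (3 * i + 3) * T * T * T" by (simp add: power3_eq_cube)
    then show "a (3 * i + 3) * T ^ 3 = a (3 * i)" by (simp only: s)
  qed
  have a_pos: "0 < a j" for j using X0 T0 by (simp add: a_def)
  have a_antimono: "a j \<le> a i" if "i \<le> j" for i j
  proof -
    have "T ^ (i + 1) \<le> T ^ (j + 1)" using that T2 by (intro power_increasing) auto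
    then show ?thesis unfolding a_def using T0 X0 by (intro divide_left_mono) auto
  qed
  have a_low: "X * exp (- (L / 2)) \<le> a j" if "j \<le> 3 * J" for j
  proof -
    have "2 * T ^ (3 * J + 1) = exp (ln 2 + real (3 * J + 1) * ln T)"
      using T0 by (simp add: exp_add exp_of_nat_mult del: of_nat_Suc)
    also have "\<dots> \<le> exp (L / 2)"
    proof -
      have "real (3 * J + 1) * ln T \<le> (3 * (L / ln L) + 1) * (ln L / 8)"
        unfolding lnT using J lnL by (intro mult_right_mono) auto
      then have "ln 2 + real (3 * J + 1) * ln T \<le> L / 2" using low by linarith
      then show ?thesis by (simp only: exp_le_cancel_iff)
    qed
    finally have "X / exp (L / 2) \<le> a (3 * J)"
      unfolding a_def using X0 T0 by (intro divide_left_mono) auto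
    also have "\<dots> \<le> a j" using that by (rule a_antimono)
    finally show ?thesis by (simp only: exp_minus divide_inverse)
  qed
  have a_big: "exp (3 * L / 2) \<le> a j" if "j \<le> 3 * J" for j
  proof -
    have "3 * L / 2 = 2 * L + - (L / 2)" by simp
    then have "exp (3 * L / 2) = exp (2 * L) * exp (- (L / 2))" by (simp only: exp_add)
    also have "\<dots> \<le> X * exp (- (L / 2))" using X_ge by (intro mult_right_mono) auto
    also have "\<dots> \<le> a j" by (rule a_low[OF that])
    finally show ?thesis .
  qed
  have a1: "1 \<le> a j" if "j \<le> 3 * J" for j
    using a_big[OF that] exp_ge_add_one_self[of "3 * L / 2"] L8 by linarith
  have a0: "a 0 * (T / 2) = X / 4" using T0 by (simp add: a_def)

  have finW: "finite (W i)" for i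
    unfolding W_def window_def by (rule finite_subset[OF _ finite_primes_real_le[of "exp (a (3 * i + 3) * T ^ 3)"]]) auto
  have WW_prime: "prime p" "real p \<le> exp (a 0)" if p: "p \<in> WW" for p
  proof -
    obtain i where i: "i < J" "p \<in> W i" using p by (auto simp: WW_def)
    then show "prime p" by (simp add: W_def window_def)
    have "real p \<le> exp (a (3 * i))" using i(2) by (simp add: W_def window_def a3)
    also have "\<dots> \<le> exp (a 0)" using a_antimono[of 0 "3 * i"] by simp
    finally show "real p \<le> exp (a 0)" .
  qed
  have finWW: "finite WW" using finW by (simp add: WW_def)
  have a0X: "a 0 \<le> X" using X0 T2 by (simp add: a_def field_simps) 
  have WWN: "WW \<subseteq> {1..N}"
  proof
    fix p assume p: "p \<in> WW"
    have "real p \<le> exp X" using WW_prime(2)[OF p] a0X by (meson exp_le_cancel_iff order_trans)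
    then show "p \<in> {1..N}" using mN[of p] prime_gt_0_nat[OF WW_prime(1)[OF p]] by (simp add: x_eq)
  qed

  define B1 where "B1 = {m \<in> {1..N}. real (square_part m) > exp l}"
  define B2 where "B2 j = {m \<in> {1..N}. real (smooth_radical (exp (a j)) m) > exp (a j) powr (T / 2)}" for j
  define B3 where "B3 = {m \<in> {1..N}. real m \<le> exp (3 / 4 * X)}"
  define B4 where "B4 = {m \<in> {1..N}. m \<notin> B1 \<and> m \<notin> B2 0 \<and> m \<notin> B3 \<and> prime_divisors_in WW m \<in> F}"

  have good: "square_difference_bound \<epsilon> m"
    if m: "m \<in> {1..N}" "m \<notin> B1" "\<And>j. j \<le> 3 * J \<Longrightarrow> m \<notin> B2 j" "m \<notin> B3" "m \<notin> B4" for m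
  proof -
    have m0: "m > 0" using m by auto
    have lnm: "ln (real m) \<le> X"
      using mN[of m] m m0 unfolding X_def by (subst ln_le_cancel_iff) (auto intro: x)
    have D: "real (square_part m) \<le> exp (L powr (1/10))"
      using m by (auto simp: B1_def l_def not_less)
    \<comment> \<open>The parity of \<open>card (P (a j))\<close> decides whether the piece below the cut point \<open>j\<close> can be used as a gap.\<close>
    define P where "P y = {p. prime p \<and> p mod 4 = 3 \<and> p dvd m \<and> exp y < real p}" for y
    have finP: "finite (P y)" for y unfolding P_def by (rule finite_prime_divisors_pred[OF m0])
    have main: "square_difference_bound \<epsilon> m"
      if j: "j < 3 * J" and gap: "\<And>p. p \<in> P (a (Suc j)) \<Longrightarrow> p \<in> P (a j)" and odd: "odd (card (P (a j)))" for j
    proof (rule square_difference_bound_of_gap[OF m0 lnm L8 X_ge \<epsilon> _ _ D])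
      show "X * exp (- (L / 2)) \<le> a (Suc j)" using j by (intro a_low) auto
      show "a (Suc j) \<le> a j" by (intro a_antimono) auto
      show "exp (a j) < real p" if "prime p" "p mod 4 = 3" "p dvd m" "exp (a (Suc j)) < real p" for p
        using gap[of p] that by (auto simp: P_def)
      show "odd (card {p. prime p \<and> p mod 4 = 3 \<and> p dvd m \<and> exp (a j) < real p})"
        using odd by (simp add: P_def)
      have "m \<notin> B2 (Suc j)" using j by (intro m(3)) auto
      then have "real (smooth_radical (exp (a (Suc j))) m) \<le> exp (a (Suc j)) powr (T / 2)"
        using m(1) by (auto simp: B2_def not_less)
      also have "\<dots> = exp (a j / 2)" using a_Suc[of j] by (simp add: powr_def mult.commute)
      finally show "real (smooth_radical (exp (a (Suc j))) m) \<le> exp (a j / 2)" .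
    qed
    have "prime_divisors_in WW m \<notin> F" using m by (auto simp: B4_def)
    then obtain i where i: "i < J" "G i (prime_divisors_in WW m \<inter> W i)" by (auto simp: F_def)
    have "prime_divisors_in WW m \<inter> W i = {p \<in> W i. p dvd m}"
      using i by (auto simp: prime_divisors_in_def WW_def)
    then obtain q where q: "{p \<in> W i. p dvd m} = {q}" "exp (a (3 * i + 2)) < real q" "real q \<le> exp (a (3 * i + 1))"
      using i(2) by (auto simp: G_def good_pattern_def a3)
    have "q \<in> W i" and qm: "q dvd m" using q(1) by blast+
    then have qp: "prime q" "q mod 4 = 3" "exp (a (3 * i + 3)) < real q" "real q \<le> exp (a (3 * i))"
      unfolding W_def window_def a3 by blast+
    have only: "p = q \<or> p \<in> P (a (3 * i))" if p: "p \<in> P (a (3 * i + 3))" for p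
    proof (cases "real p \<le> exp (a (3 * i))")
      case True
      then have "p \<in> {p \<in> W i. p dvd m}" using p unfolding P_def W_def window_def a3 by blast
      then show ?thesis using q(1) by blast
    next
      case False
      then show ?thesis using p unfolding P_def by simp
    qed
    have mono: "P (a i) \<subseteq> P (a j)" if "i \<le> j" for i j
    proof
      fix p assume p: "p \<in> P (a i)"
      have "exp (a j) \<le> exp (a i)" using a_antimono[OF that] by simp
      then show "p \<in> P (a j)" using p unfolding P_def mem_Collect_eq by (blast intro: order_le_less_trans)
    qed
    have sub: "P (a (Suc (3 * i))) \<subseteq> P (a (3 * i + 3))" "P (a (3 * i + 2)) \<subseteq> P (a (3 * i + 3))"
      "P (a (3 * i)) \<subseteq> P (a (3 * i + 2))"
      by (rule mono, simp)+
    have qP: "q \<in> P (a (3 * i + 2))" "q \<notin> P (a (3 * i))" "q \<notin> P (a (Suc (3 * i)))"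
      using qp qm q(2,3) unfolding P_def by simp_all
    \<comment> \<open>The top piece serves if the count above the window is odd; otherwise the prime \<open>q\<close> makes it odd above the bottom piece.\<close>
    show ?thesis
    proof (cases "odd (card (P (a (3 * i))))")
      case True
      show ?thesis
      proof (rule main[of "3 * i"])
        show "p \<in> P (a (3 * i))" if "p \<in> P (a (Suc (3 * i)))" for p
          using that only sub(1) qP(3) by blast
        show "3 * i < 3 * J" using i by simp
        show "odd (card (P (a (3 * i))))" by (rule True)
      qed
    next
      case False
      have "P (a (3 * i + 2)) = insert q (P (a (3 * i)))"
        using only sub qP by blast
      then have odd: "odd (card (P (a (3 * i + 2))))" using False finP qP(2) by simp
      have Suc3: "Suc (3 * i + 2) = 3 * i + 3" by simp
      show ?thesis
      proof (rule main[of "3 * i + 2"])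
        show "p \<in> P (a (3 * i + 2))" if "p \<in> P (a (Suc (3 * i + 2)))" for p
          using that only sub qP unfolding Suc3 by blast
        show "3 * i + 2 < 3 * J" using i by simp
        show "odd (card (P (a (3 * i + 2))))" by (rule odd)
      qed
    qed
  qed

  have cB1: "real (card B1) \<le> 2 * exp (- l) * x"
  proof -
    have "real (card B1) \<le> 2 * real N / exp l"
      unfolding B1_def using l by (intro card_square_part_gt_le) auto
    also have "\<dots> \<le> 2 * x / exp l" using N by (intro divide_right_mono) auto
    finally show ?thesis by (simp add: exp_minus field_simps)
  qed
  have cB2: "real (card (\<Union>j\<in>{..3 * J}. B2 j)) \<le> exp 12 * exp (- l) * x"
  proof -
    have "real (card (\<Union>j\<in>{..3 * J}. B2 j)) \<le> real (\<Sum>j\<in>{..3 * J}. card (B2 j))"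
      by (intro of_nat_mono card_UN_le) auto
    also have "\<dots> = (\<Sum>j\<in>{..3 * J}. real (card (B2 j)))" by simp
    also have "\<dots> \<le> (\<Sum>j\<in>{..3 * J}. exp 12 * exp (- (T / 2)) * real N)"
      unfolding B2_def by (intro sum_mono card_smooth_radical_gt_le) (use a1 in auto)
    also have "\<dots> = (real (3 * J) + 1) * exp (- (T / 2)) * (exp 12 * real N)" by simp
    also have "\<dots> \<le> (3 * (L / ln L) + 1) * exp (- (T / 2)) * (exp 12 * x)"
      using J N lnL L8 by (intro mult_mono) auto
    also have "\<dots> \<le> exp (- l) * (exp 12 * x)"
      using smooth x by (intro mult_right_mono) (auto simp: l_def)
    finally show ?thesis by (simp add: mult_ac)
  qed
  have cB3: "real (card B3) \<le> exp (- l) * x"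
  proof -
    let ?n = "nat \<lfloor>exp (3 / 4 * X)\<rfloor>"
    have "B3 \<subseteq> {1..?n}" by (auto simp: B3_def le_nat_iff le_floor_iff)
    then have "card B3 \<le> card {1..?n}" by (intro card_mono) auto
    then have "card B3 \<le> ?n" by simp
    then have "real (card B3) \<le> real ?n" by (rule of_nat_mono)
    also have "\<dots> \<le> exp (3 / 4 * X)" by simp
    also have "\<dots> = exp (- (X / 4)) * x" unfolding x_eq by (simp flip: exp_add)
    also have "\<dots> \<le> exp (- l) * x"
      using l8 l x by (intro mult_right_mono) auto
    finally show ?thesis .
  qed
  have cB4: "real (card B4) \<le> 16 * exp 14 * exp (- l) * x"
  proof -
    let ?S = "\<Sum>n | n \<in> {1..N} \<and> prime_divisors_in WW n \<in> F. 1 / real n"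
    \<comment> \<open>For \<open>m\<close> in \<open>B4\<close> the square part and the primes in the windows account for at most \<open>X / 2\<close> of \<open>ln m \<ge> 3 X / 4\<close>.\<close>
    have "X / 4 * real (card B4) \<le> 4 * real N * ?S"
    proof (rule sum_count_ln_le)
      fix m assume m: "m \<in> B4"
      then have m0: "m > 0" and mle: "m \<le> N" by (auto simp: B4_def)
      let ?Q = "{p. prime p \<and> p dvd m}"
      have finQ: "finite ?Q" using finite_prime_divisors_pred[OF m0, of "\<lambda>_. True" "\<lambda>_. True"] by simp
      have "real m > exp (3 / 4 * X)" using m by (auto simp: B4_def B3_def)
      then have "ln (exp (3 / 4 * X)) \<le> ln (real m)" using m0 by (subst ln_le_cancel_iff) auto
      then have "3 / 4 * X \<le> ln (real m)" by simp
      also have "\<dots> \<le> 2 * ln (real (square_part m)) + (\<Sum>p\<in>?Q. ln (real p))"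
        by (rule ln_le_sum_prime_divisors[OF m0])
      finally have 1: "3 / 4 * X \<le> 2 * ln (real (square_part m)) + (\<Sum>p\<in>?Q. ln (real p))" .
      have "real (square_part m) \<le> exp l" using m by (auto simp: B4_def B1_def not_less)
      moreover have "square_part m > 0" using m0 by (intro Nat.gr0I) auto
      ultimately have "ln (real (square_part m)) \<le> ln (exp l)" by (subst ln_le_cancel_iff) auto
      then have 2: "ln (real (square_part m)) \<le> l" by simp
      have fin': "finite {p \<in> ?Q. p \<notin> WW}" "finite {p \<in> ?Q. p \<in> WW}"
        by (rule finite_subset[OF _ finQ], blast)+
      have "(\<Sum>p\<in>{p \<in> ?Q. p \<notin> WW}. ln (real p)) + (\<Sum>p\<in>{p \<in> ?Q. p \<in> WW}. ln (real p)) =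
          (\<Sum>p\<in>{p \<in> ?Q. p \<notin> WW} \<union> {p \<in> ?Q. p \<in> WW}. ln (real p))"
        by (rule sum.union_disjoint[OF fin', symmetric]) blast
      also have "{p \<in> ?Q. p \<notin> WW} \<union> {p \<in> ?Q. p \<in> WW} = ?Q" by blast
      finally have 3: "(\<Sum>p\<in>{p \<in> ?Q. p \<notin> WW}. ln (real p)) + (\<Sum>p\<in>{p \<in> ?Q. p \<in> WW}. ln (real p)) =
          (\<Sum>p\<in>?Q. ln (real p))" .
      have "(\<Sum>p\<in>{p \<in> ?Q. p \<in> WW}. ln (real p)) \<le> (\<Sum>p | prime p \<and> real p \<le> exp (a 0) \<and> p dvd m. ln (real p))"
        using WW_prime by (intro sum_mono2 finite_subset[OF _ finite_primes_real_le[of "exp (a 0)"]])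
          (auto simp: Suc_leI prime_gt_0_nat)
      also have "\<dots> = ln (real (smooth_radical (exp (a 0)) m))"
        unfolding smooth_radical_def by (rule sum_ln_eq_ln_prod[symmetric]) auto
      also have "\<dots> \<le> ln (exp (a 0) powr (T / 2))"
        using m smooth_radical_pos[of "exp (a 0)" m] by (subst ln_le_cancel_iff) (auto simp: B4_def B2_def not_less)
      also have "\<dots> = X / 4" using a0 by (simp add: ln_powr mult.commute)
      finally have 4: "(\<Sum>p\<in>{p \<in> ?Q. p \<in> WW}. ln (real p)) \<le> X / 4" .
      have "X / 4 \<le> (\<Sum>p\<in>{p \<in> ?Q. p \<notin> WW}. ln (real p))"
        using 1 2 3 4 l8 l by linarith
      also have "{p \<in> ?Q. p \<notin> WW} = {p. p \<in> {1..N} \<and> prime p \<and> p dvd m \<and> p \<notin> WW}"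
      proof -
        have "p \<le> N" if "p dvd m" for p using dvd_imp_le[OF that m0] mle by simp
        then show ?thesis by (auto simp: Suc_leI prime_gt_0_nat)
      qed
      finally show "X / 4 \<le> (\<Sum>p | p \<in> {1..N} \<and> prime p \<and> p dvd m \<and> p \<notin> WW. ln (real p))" .
    qed (use WW_prime in \<open>auto simp: B4_def\<close>)
    also have "?S \<le> (\<Prod>p | p \<in> {1..N} \<and> prime p. 1 / (1 - 1 / real p)) * (\<Sum>U | U \<subseteq> WW \<and> U \<in> F. sieve_weight WW U)"
      by (rule sum_inverse_prime_divisors_family_le[OF finWW WW_prime(1) WWN])
    also have "\<dots> \<le> (X * exp 14) * exp (- l)"
    proof (rule mult_mono)
      have "(\<Prod>p | p \<in> {1..N} \<and> prime p. 1 / (1 - 1 / real p)) \<le> exp ((\<Sum>p | p \<in> {1..N} \<and> prime p. 1 / real p) + 1)"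
        by (rule prod_inverse_one_minus_prime_le) auto
      also have "\<dots> \<le> exp (ln (ln (real N)) + 14)"
        using sum_inverse_prime_upto_le[OF N(2)] by simp
      also have "\<dots> = ln (real N) * exp 14" using N by (simp add: exp_add)
      also have "\<dots> \<le> X * exp 14"
        unfolding X_def using N x by (intro mult_right_mono) auto
      finally show "(\<Prod>p | p \<in> {1..N} \<and> prime p. 1 / (1 - 1 / real p)) \<le> X * exp 14" .
      have "(\<Sum>U | U \<subseteq> WW \<and> U \<in> F. sieve_weight WW U) \<le> exp (- (c / T ^ 3) * real J)"
        unfolding WW_def F_def mem_Collect_eq
      proof (rule sum_sieve_weight_avoiding_le)
        show "W i \<inter> W j = {}" if ij: "i < J" "j < J" "i \<noteq> j" for i j
        proof -
          have *: "W i \<inter> W j = {}" if "i < j" for i j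
          proof -
            have "a (3 * j) \<le> a (3 * i + 3)" using that by (intro a_antimono) auto
            then have le: "exp (a (3 * j)) \<le> exp (a (3 * i + 3))" by simp
            show ?thesis
            proof (rule equals0I)
              fix p assume "p \<in> W i \<inter> W j"
              then have "exp (a (3 * i + 3)) < real p" "real p \<le> exp (a (3 * j))"
                unfolding W_def window_def a3 by blast+
              then show False using le by linarith
            qed
          qed
          show ?thesis using *[of i j] *[of j i] ij(3) by (cases "i < j") auto
        qed
        show "c / T ^ 3 \<le> (\<Sum>U | U \<subseteq> W i \<and> G i U. sieve_weight (W i) U)" if "i < J" for i
        proof -
          have "B \<le> a (3 * i + 3)" using B a_big[of "3 * i + 3"] that by force
          from window[OF this T2] show ?thesis by (simp only: W_def G_def)
        qed
        show "p > 0" if "i < J" "p \<in> W i" for i p using that prime_gt_0_nat by (auto simp: W_def window_def)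
      qed (rule finW)
      also have "\<dots> \<le> exp (- (c / T ^ 3) * (L / ln L - 1))"
        using J c0 T0 by (auto intro!: divide_right_mono mult_left_mono)
      also have "\<dots> \<le> exp (- l)" using sieve by (simp add: l_def)
      finally show "(\<Sum>U | U \<subseteq> WW \<and> U \<in> F. sieve_weight WW U) \<le> exp (- l)" .
      show "0 \<le> (\<Sum>U | U \<subseteq> WW \<and> U \<in> F. sieve_weight WW U)"
        using WW_prime prime_gt_0_nat by (intro sum_nonneg sieve_weight_nonneg) auto
      show "0 \<le> X * exp 14" using X0 by simp
    qed
    finally have "X / 4 * real (card B4) \<le> 4 * real N * ((X * exp 14) * exp (- l))"
      by (simp add: mult_left_mono)
    also have "\<dots> \<le> 4 * x * ((X * exp 14) * exp (- l))"
      using N X0 by (intro mult_right_mono mult_left_mono) auto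
    also have "\<dots> = X / 4 * (16 * exp 14 * exp (- l) * x)" by simp
    finally show ?thesis using X0 by (simp only: mult_le_cancel_left_pos) 
  qed

  have "?E \<subseteq> B1 \<union> (\<Union>j\<in>{..3 * J}. B2 j) \<union> B3 \<union> B4"
  proof
    fix m assume m: "m \<in> ?E"
    then have "m \<in> {1..N}" using mN by blast
    then show "m \<in> B1 \<union> (\<Union>j\<in>{..3 * J}. B2 j) \<union> B3 \<union> B4" using good[of m] m by auto
  qed
  moreover have "finite (B1 \<union> (\<Union>j\<in>{..3 * J}. B2 j) \<union> B3 \<union> B4)"
    by (auto simp: B1_def B2_def B3_def B4_def)
  ultimately have "card ?E \<le> card (B1 \<union> (\<Union>j\<in>{..3 * J}. B2 j) \<union> B3 \<union> B4)"
    by (intro card_mono)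
  also have "\<dots> \<le> card B1 + card (\<Union>j\<in>{..3 * J}. B2 j) + card B3 + card B4"
    by (intro order_trans[OF card_Un_le] add_mono) auto
  finally have "real (card ?E) \<le>
      real (card B1) + real (card (\<Union>j\<in>{..3 * J}. B2 j)) + real (card B3) + real (card B4)"
    by linarith
  then show ?thesis using cB1 cB2 cB3 cB4 unfolding l_def[symmetric] by (simp add: algebra_simps)
qed

theorem theorem1p2:
  shows "\<exists>K::real. K > 0 \<and>
    (\<forall>x::real. x \<ge> exp 1 \<longrightarrow>
      (\<forall>\<epsilon>::real. ln x powr (- 1/2) \<le> \<epsilon> \<and> \<epsilon> \<le> 1 \<longrightarrow>
        real (card {m::nat. 0 < m \<and> real m \<le> x \<and>
          \<not> (\<forall>A. A \<subseteq> carrier (residue_ring (int m)) \<longrightarrow>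
                difference_set (residue_ring (int m)) A \<inter> squares (residue_ring (int m))
                  = {\<zero>\<^bsub>residue_ring (int m)\<^esub>} \<longrightarrow>
                real (card A) \<le> real m powr (1/2 - \<epsilon>/5))})
        \<le> K * c_eps \<epsilon> * x))"
proof -
  define c :: real where "c = exp (- 13) / 8"
  obtain B where B: "\<And>b T::real. B \<le> b \<Longrightarrow> 2 \<le> T \<Longrightarrow>
      c / T ^ 3 \<le> (\<Sum>U | U \<subseteq> window b T \<and> good_pattern b T U. sieve_weight (window b T) U)"
    using window_weight_ge unfolding c_def by blast
  have "c > 0" by (simp add: c_def)
  from parameter_asymptotics[OF this, of B] obtain L0 where L0: "\<And>L. L0 \<le> L \<Longrightarrow> 8 \<le> L \<and> 2 \<le> L powr (1/8) \<and>
    ln 2 + (3 * (L / ln L) + 1) * (ln L / 8) \<le> L / 2 \<and>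
    B \<le> exp (3 * L / 2) \<and>
    (3 * (L / ln L) + 1) * exp (- (L powr (1/8) / 2)) \<le> exp (- (L powr (1/10))) \<and>
    exp (- (c / (L powr (1/8)) ^ 3) * (L / ln L - 1)) \<le> exp (- (L powr (1/10))) \<and>
    8 * L powr (1/10) \<le> exp (2 * L)"
    by blast
  define L1 where "L1 = max L0 0"
  define K where "K = 3 + exp 12 + 16 * exp 14 + exp (L1 powr (1/10))"
  have K: "K > 0" "3 + exp 12 + 16 * exp 14 \<le> K" "exp (L1 powr (1/10)) \<le> K"
    by (auto simp: K_def intro!: add_pos_pos)
  have "real (card {m::nat. 0 < m \<and> real m \<le> x \<and> \<not> square_difference_bound \<epsilon> m}) \<le> K * c_eps \<epsilon> * x"
    if x: "exp 1 \<le> x" and \<epsilon>: "ln x powr (- 1/2) \<le> \<epsilon>" "\<epsilon> \<le> 1" for x \<epsilon> :: real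
  proof -
    have x0: "x > 0" using x exp_gt_zero[of "1::real"] by linarith
    have lnx: "ln x \<ge> 1" using x x0 by (simp add: ln_ge_iff)
    then have "0 < ln x powr (- 1/2)" by simp
    then have \<epsilon>0: "\<epsilon> > 0" using \<epsilon> by linarith
    define L where "L = ln (inverse \<epsilon>)"
    have L: "L \<ge> 0" "\<epsilon> = exp (- L)" using \<epsilon> \<epsilon>0 by (auto simp: L_def ln_inverse)
    have c_eps: "c_eps \<epsilon> = exp (- (L powr (1/10)))" by (simp add: c_eps_def L_def)
    let ?E = "{m::nat. 0 < m \<and> real m \<le> x \<and> \<not> square_difference_bound \<epsilon> m}"
    show ?thesis
    proof (cases "L0 \<le> L")
      case True
      have "ln (ln x powr (- 1/2)) \<le> ln \<epsilon>"
        using \<epsilon> \<epsilon>0 lnx by (subst ln_le_cancel_iff) auto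
      then have "2 * L \<le> ln (ln x)" using lnx L(2) by (simp add: ln_powr)
      then have "exp (2 * L) \<le> ln x" using lnx by (metis exp_le_cancel_iff exp_ln less_le_trans zero_less_one)
      then have "real (card ?E)
          \<le> (3 + exp 12 + 16 * exp 14) * exp (- (L powr (1/10))) * x"
        using L0[OF True] x0 L(2) by (intro card_exceptional_le[OF c_def B]) auto
      also have "\<dots> \<le> K * exp (- (L powr (1/10))) * x"
        using K x0 by (intro mult_right_mono) auto
      finally show ?thesis by (simp add: c_eps)
    next
      \<comment> \<open>For bounded \<open>L\<close> the value of \<open>c_eps\<close> is bounded below, and the trivial count \<open>x\<close> suffices.\<close>
      case False
      then have "L powr (1/10) \<le> L1 powr (1/10)" using L by (intro powr_mono2) (auto simp: L1_def)
      then have "1 \<le> exp (L1 powr (1/10)) * exp (- (L powr (1/10)))" by (simp flip: exp_add)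
      also have "\<dots> \<le> K * c_eps \<epsilon>" unfolding c_eps using K by (intro mult_right_mono) auto
      finally have "1 * x \<le> K * c_eps \<epsilon> * x" using x0 by (intro mult_right_mono) auto
      moreover have "real (card ?E) \<le> x"
      proof -
        have "?E \<subseteq> {1..nat \<lfloor>x\<rfloor>}"
          by (auto simp: le_nat_floor)
        then have "card ?E \<le> card {1..nat \<lfloor>x\<rfloor>}"
          by (intro card_mono) auto
        then have "real (card ?E) \<le> real (nat \<lfloor>x\<rfloor>)" by simp
        also have "\<dots> \<le> x" using x0 by simp
        finally show ?thesis .
      qed
      ultimately show ?thesis by linarith
    qed
  qed
  then show ?thesis
    using K(1) unfolding square_difference_bound_def by blast
qed

end
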